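(* For every integer $m\ge0$ the following quasimodular forms have all their Fourier coefficients (in $q$) in $\mathbb{Z}$: \[ \binom{6m}{2m}\binom{12m}{6m}G_{12m}^{(1)},\quad \frac{12m+1}{12m-1}\binom{6m}{2m}\binom{12m}{6m}G_{12m+2}^{(1)}, \] \[ \binom{6m+3}{2m+1}\binom{12m+6}{6m+3}G_{12m+6}^{(1)},\quad \frac{12m+7}{12m+5}\binom{6m+3}{2m+1}\binom{12m+6}{6m+3}G_{12m+8}^{(1)},\quad \binom{6m+3}{2m+1}\binom{12m+6}{6m+3}G_{12m+10}^{(1)}, \] and, for every $m\ge1$, also $\binom{6m}{2m}\binom{12m}{6m}G_{12m+4}^{(1)}$. Equivalently, in terms of $N_{m,0} = 24m \binom{6m}{2m} \binom{12m}{6m}$, $N_{m,2} = \frac{12m+1}{12m-1} N_{m,0}$, $N_{m,6} = 12(2m+1) \binom{6m+3}{2m+1} \binom{12m+6}{6m+3}$, $N_{m,8} = \frac{12m+7}{12m+5} N_{m,6}$, the forms $\frac{N_{m,0}}{24m} G_{12m}^{(1)}$, $\frac{N_{m,2}}{24m} G_{12m+2}^{(1)}$, $\frac{N_{m,6}}{12(2m+1)} G_{12m+6}^{(1)}$, $\frac{N_{m,8}}{12(2m+1)} G_{12m+8}^{(1)}$, $\frac{N_{m,0}}{24m}G_{12m+4}^{(1)}$, $\frac{N_{m,6}}{12(2m+1)}G_{12m+10}^{(1)}$ have integral Fourier coefficients (the quotients by $24m$ being understood after cancellation of $m$, so that at $m=0$ they equal $1$ and $-1$ respectively).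
   Context: $q=e^{2\pi i\tau}$; $E_2,E_4,E_6$ are the standard Eisenstein series on $SL_2(\mathbb{Z})$. For even $w\ge2$, $w\ne4$, $G_w^{(1)}$ is the normalized extremal quasimodular form of weight $w$ and depth 1: the unique $f=f_0+E_2f_1$ with $f_0,f_1$ holomorphic modular forms on $SL_2(\mathbb{Z})$ of weights $w,w-2$, $f_1\ne0$, whose $q$-expansion is $q^{m-1}+O(q^m)$ where $m$ is the dimension of the space of all such $f_0+E_2f_1$ (of depth $\le1$). Convention: $G_0^{(1)}:=1$; $G_2^{(1)}=E_2$. *)

theory Defs
  imports "HOL-Analysis.Analysis" "HOL-Library.Function_Algebras"
begin

definition qpar :: "complex \<Rightarrow> complex" where
  "qpar \<tau> = exp (2 * of_real pi * \<i> * \<tau>)"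

definition sigma_div :: "nat \<Rightarrow> nat \<Rightarrow> nat" where
  "sigma_div k n = (\<Sum>d\<in>{d. d dvd n}. d ^ k)"

definition E2 :: "complex \<Rightarrow> complex" where
  "E2 \<tau> = 1 - 24 * (\<Sum>n. of_nat (sigma_div 1 (Suc n)) * qpar \<tau> ^ Suc n)"

text \<open>Holomorphic modular forms of weight k on SL2(Z), as functions on the upper
  half plane (extended by 0 outside it, so that they form a vector space of functions).
  Invariance under T and S (which generate SL2(Z)) and holomorphy at the cusp
  (boundedness for Im tau >= 1).\<close>
definition modform :: "nat \<Rightarrow> (complex \<Rightarrow> complex) \<Rightarrow> bool" where
  "modform k f \<longleftrightarrow>
     (\<forall>z. Im z \<le> 0 \<longrightarrow> f z = 0) \<and>
     f holomorphic_on {z. Im z > 0} \<and>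
     (\<forall>z. Im z > 0 \<longrightarrow> f (z + 1) = f z) \<and>
     (\<forall>z. Im z > 0 \<longrightarrow> f (- 1 / z) = z ^ k * f z) \<and>
     (\<exists>B. \<forall>z. Im z \<ge> 1 \<longrightarrow> norm (f z) \<le> B)"

definition qm_decomp :: "nat \<Rightarrow> (complex \<Rightarrow> complex) \<Rightarrow> (complex \<Rightarrow> complex) \<Rightarrow> (complex \<Rightarrow> complex) \<Rightarrow> bool" where
  "qm_decomp w f f0 f1 \<longleftrightarrow> modform w f0 \<and> modform (w - 2) f1 \<and>
     f = (\<lambda>z. f0 z + E2 z * f1 z)"

definition QM1 :: "nat \<Rightarrow> (complex \<Rightarrow> complex) set" where
  "QM1 w = {f. \<exists>f0 f1. qm_decomp w f f0 f1}"

definition fourier_coeff :: "(complex \<Rightarrow> complex) \<Rightarrow> nat \<Rightarrow> complex" where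
  "fourier_coeff f n =
     integral {0..1} (\<lambda>x::real. f (of_real x + \<i>) * exp (- 2 * of_real pi * \<i> * of_nat n * (of_real x + \<i>)))"

definition qm_dim :: "nat \<Rightarrow> nat" where
  "qm_dim w = vector_space.dim (\<lambda>(c::complex) (f::complex \<Rightarrow> complex) z. c * f z) (QM1 w)"

definition G1 :: "nat \<Rightarrow> complex \<Rightarrow> complex" where
  "G1 w = (if w = 0 then (\<lambda>_. 1) else
     (THE f. (\<exists>f0 f1. qm_decomp w f f0 f1 \<and> f1 \<noteq> (\<lambda>_. 0)) \<and>
        (\<forall>n < qm_dim w - 1. fourier_coeff f n = 0) \<and>
        fourier_coeff f (qm_dim w - 1) = 1))"

definition integral_coeffs :: "(complex \<Rightarrow> complex) \<Rightarrow> bool" where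
  "integral_coeffs f \<longleftrightarrow> (\<forall>n. fourier_coeff f n \<in> \<int>)"

end

theory Submission
  imports Defs "HOL-Complex_Analysis.Complex_Analysis"
begin

text \<open>
  Let \<open>P\<close>, \<open>Q\<close>, \<open>R\<close> be the expansions of the Eisenstein series of weight 2, 4, 6, and let
  \<open>\<theta> = q d/dq\<close>. Put \<open>\<psi> = Q\<^sup>1\<^sup>/\<^sup>4\<close> and \<open>t = (1 - R / Q\<^sup>3\<^sup>/\<^sup>2) / 864\<close>, so that
  \<open>T = t (1 - 432 t) = \<Delta> / Q\<^sup>3 = 1 / j\<close> and \<open>\<theta> t = T \<psi>\<^sup>2\<close>. Then \<open>\<psi> = \<Sum> c\<^sub>i t\<^sup>i\<close> with
  \<open>c\<^sub>i = (6i)! / ((3i)! (2i)! i!)\<close>, because both sides solve the same hypergeometric equation.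
  Its \<open>n\<close>-th derivative with respect to \<open>t\<close> yields the series
  \<open>H\<^sub>n = \<psi>\<^sup>6\<^sup>n\<^sup>-\<^sup>1 T\<^sup>n \<psi>\<^sup>(\<^sup>n\<^sup>) / n!\<close>, which has integral coefficients since
  \<open>\<psi>\<^sup>(\<^sup>n\<^sup>) / n! = \<Sum> (n+i choose n) c\<^sub>n\<^sub>+\<^sub>i t\<^sup>i\<close>, vanishes to order \<open>n\<close> with leading coefficient \<open>c\<^sub>n\<close>, and
  satisfies a three-term recurrence with coefficients \<open>\<Delta>\<close> and \<open>R\<close>, hence is quasimodular of weight \<open>6n\<close>.
  So \<open>H\<^sub>n = c\<^sub>n G\<^sub>6\<^sub>n\<close>; similarly \<open>Q H\<^sub>n = c\<^sub>n G\<^sub>6\<^sub>n\<^sub>+\<^sub>4\<close>, and the Serre derivative of \<open>H\<^sub>n\<close> is, up to a factor,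
  \<open>G\<^sub>6\<^sub>n\<^sub>+\<^sub>2\<close>. The two families of the theorem are the cases \<open>n = 2m\<close> and \<open>n = 2m + 1\<close>.

  Extremality is meaningful because a nonzero form \<open>f = f\<^sub>0 + P f\<^sub>1\<close> of weight \<open>w\<close> vanishes to order at most \<open>w/6\<close>:
  \<open>12 (f \<theta>f\<^sub>1 - f\<^sub>1 \<theta>f) + f\<^sup>2\<close> is a modular form of weight \<open>2w\<close>.
\<close>

text \<open>Only the q-series of \<open>E2\<close> is given, so its anomaly under S has to be
  derived first; all modularity follows from it. \<open>E4\<close> and \<open>E6\<close> come from
  solving two of Ramanujan's identities for Q and R, and \<open>Delta\<close> from its logarithmic
  derivative. The obstacle in \<open>G1\<close> is a definite description that involves the
  dimension of a space. One order bound settles both uniqueness and dimension, once forms with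
  leading exponents 0, ..., n are known; these are the smaller extremal forms multiplied by powers
  of R. The exponents in H_n are forced. psi has formal weight 1, T has weight 0, and d/dt is theta
  divided by T psi^2, so it preserves weights. The recurrence is the n-fold differentiated
  hypergeometric equation, multiplied by powers of psi that turn T and R / Q^(3/2) into Delta and R;
  all fractional powers of Q disappear. Integrality of t, in spite of the 864, rests on t = T + 432
  t^2; that of psi comes from its expansion in t. In weight 6n + 2 the denominator 6n - 1 requires a
  separate divisibility argument.\<close>

unbundle no vec_syntax

section \<open>Partial fractions\<close>

text \<open>Logarithmic derivative of the reflection formula for the Gamma function.\<close>

lemma Digamma_reflection_complex:
  fixes z :: complex
  assumes z: "z \<notin> \<int>"
  shows "Digamma (1 - z) - Digamma z = of_real pi * cot (of_real pi * z)"
proof -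
  have nz: "z \<notin> \<int>\<^sub>\<le>\<^sub>0" "1 - z \<notin> \<int>\<^sub>\<le>\<^sub>0"
    using z by (auto elim!: nonpos_Ints_cases simp: algebra_simps)
      (metis Ints_1 Ints_diff Ints_of_int add_diff_cancel_left' diff_add_cancel)
  have s: "sin (of_real pi * z) \<noteq> 0"
    using z by (auto simp: sin_eq_0 mult.commute)
  have "((\<lambda>z. Gamma z * Gamma (1 - z)) has_field_derivative
      Gamma z * Gamma (1 - z) * (Digamma z - Digamma (1 - z))) (at z)"
    by (auto intro!: derivative_eq_intros nz simp: algebra_simps)
  moreover have "(\<lambda>z. Gamma z * Gamma (1 - z)) = (\<lambda>z::complex. of_real pi / sin (of_real pi * z))"
    using Gamma_reflection_complex by auto
  moreover have "((\<lambda>z. of_real pi / sin (of_real pi * z)) has_field_derivative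
      - (of_real pi * (of_real pi * cos (of_real pi * z))) / sin (of_real pi * z) ^ 2) (at z)"
    by (auto intro!: derivative_eq_intros s simp: power2_eq_square)
  ultimately have "of_real pi / sin (of_real pi * z) * (Digamma z - Digamma (1 - z)) =
      - (of_real pi * (of_real pi * cos (of_real pi * z))) / sin (of_real pi * z) ^ 2"
    by (metis DERIV_unique Gamma_reflection_complex)
  hence "of_real pi * ((Digamma z - Digamma (1 - z)) * sin (of_real pi * z)) =
      of_real pi * (- (of_real pi * cos (of_real pi * z)))"
    using s by (simp add: divide_simps power2_eq_square)
  hence "(Digamma z - Digamma (1 - z)) * sin (of_real pi * z) = - (of_real pi * cos (of_real pi * z))"
    unfolding mult_cancel_left by simp
  hence "(Digamma (1 - z) - Digamma z) * sin (of_real pi * z) = of_real pi * cos (of_real pi * z)"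
    by (metis minus_diff_eq minus_mult_minus minus_minus mult_minus_left)
  hence "Digamma (1 - z) - Digamma z = of_real pi * cos (of_real pi * z) / sin (of_real pi * z)"
    using s by (metis nonzero_mult_div_cancel_right)
  thus ?thesis by (simp add: cot_def)
qed

text \<open>The Digamma series at 1 - w and 1 + w are subtracted term by term. Reflection evaluates
  the difference, and the shift from w to 1 + w accounts for the term 1 / w.\<close>

lemma cot_partial_fractions:
  fixes w :: complex
  assumes w: "w \<notin> \<int>"
  shows "(\<lambda>m. 2 * w / (w\<^sup>2 - of_nat (Suc m) ^ 2)) sums (of_real pi * cot (of_real pi * w) - 1 / w)"
proof -
  have w0: "w \<noteq> 0" using w by auto
  have nz: "1 - w + of_nat k \<noteq> 0" "1 + w + of_nat k \<noteq> 0" for k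
  proof -
    have "w - of_int (1 + int k) \<noteq> 0" "w - of_int (- 1 - int k) \<noteq> 0" using w Ints_of_int by auto
    thus "1 - w + of_nat k \<noteq> 0" "1 + w + of_nat k \<noteq> 0"
      by (auto simp: algebra_simps)
  qed
  have S: "(\<lambda>k. inverse (of_nat (Suc k)) - inverse (z + of_nat k)) sums (Digamma z + euler_mascheroni)"
    if "z \<noteq> 0" for z :: complex
    using summable_sums[OF summable_Digamma[OF that]] by (simp add: Digamma_def)
  have "(\<lambda>k. (inverse (of_nat (Suc k)) - inverse (1 - w + of_nat k)) - (inverse (of_nat (Suc k)) - inverse (1 + w + of_nat k)))
     sums (Digamma (1 - w) + euler_mascheroni - (Digamma (1 + w) + euler_mascheroni))"
    by (intro sums_diff S) (use nz[of 0] in auto)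
  moreover have "(inverse (of_nat (Suc k)) - inverse (1 - w + of_nat k)) - (inverse (of_nat (Suc k)) - inverse (1 + w + of_nat k))
      = 2 * w / (w\<^sup>2 - of_nat (Suc k) ^ 2)" for k
  proof -
    define a b where "a = 1 - w + of_nat k" and "b = 1 + w + of_nat k"
    have "w\<^sup>2 - of_nat (Suc k) ^ 2 = - (a * b)" "2 * w = b - a"
      by (simp_all add: power2_eq_square algebra_simps a_def b_def)
    moreover have "a \<noteq> 0" "b \<noteq> 0" using nz by (auto simp: a_def b_def)
    hence "(c - inverse a) - (c - inverse b) = (b - a) / (- (a * b))" for c
      by (simp add: divide_simps) (simp add: algebra_simps)
    ultimately show ?thesis by (simp add: a_def b_def)
  qed
  moreover have "Digamma (1 - w) - Digamma (1 + w) = of_real pi * cot (of_real pi * w) - 1 / w"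
    using Digamma_reflection_complex[OF w] Digamma_plus1[OF w0] by (simp add: algebra_simps)
  ultimately show ?thesis by simp
qed

text \<open>The two halves of the series are trigamma series at 1 + w and 1 - w. Their sum is
  evaluated by differentiating the closed reflection formula, which avoids differentiating the
  cotangent series term by term.\<close>

lemma inverse_sin_squared_partial_fractions:
  fixes w :: complex
  assumes w: "w \<notin> \<int>"
  shows "(\<lambda>n. 1 / (w + of_nat (Suc n)) ^ 2 + 1 / (w - of_nat (Suc n)) ^ 2) sums
           (of_real pi ^ 2 / sin (of_real pi * w) ^ 2 - 1 / w\<^sup>2)"
proof -
  have w0: "w \<noteq> 0" using w by auto
  have nz: "1 + w \<notin> \<int>\<^sub>\<le>\<^sub>0" "1 - w \<notin> \<int>\<^sub>\<le>\<^sub>0" "w \<notin> \<int>\<^sub>\<le>\<^sub>0"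
    using w by (auto elim!: nonpos_Ints_cases simp: algebra_simps)
      (metis Ints_1 Ints_diff Ints_of_int add_diff_cancel_left' diff_add_cancel)+
  have s: "sin (of_real pi * w) \<noteq> 0"
    using w by (auto simp: sin_eq_0 mult.commute)
  have S: "(\<lambda>k. inverse ((z + of_nat k) ^ 2)) sums Polygamma 1 z" if "z \<noteq> 0" for z :: complex
    using Polygamma_LIMSEQ[OF that, of 1] by (simp add: numeral_2_eq_2)
  have "(\<lambda>k. inverse ((1 + w + of_nat k) ^ 2) + inverse ((1 - w + of_nat k) ^ 2)) sums
      (Polygamma 1 (1 + w) + Polygamma 1 (1 - w))"
    by (intro sums_add S) (use nz in auto)
  moreover have "inverse ((1 + w + of_nat k) ^ 2) + inverse ((1 - w + of_nat k) ^ 2) =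
      1 / (w + of_nat (Suc k)) ^ 2 + 1 / (w - of_nat (Suc k)) ^ 2" for k
    by (simp add: field_simps power2_commute[of w])
  moreover have "Polygamma 1 (1 + w) + Polygamma 1 (1 - w) =
      of_real pi ^ 2 / sin (of_real pi * w) ^ 2 - 1 / w\<^sup>2"
  proof -
    have D: "((\<lambda>z. Digamma (1 - z) - Digamma (1 + z)) has_field_derivative
       - Polygamma 1 (1 - w) - Polygamma 1 (1 + w)) (at w)"
      by (auto intro!: derivative_eq_intros nz)
    moreover have "((\<lambda>z. of_real pi * (cos (of_real pi * z) / sin (of_real pi * z)) - 1 / z) has_field_derivative
        - (of_real pi ^ 2 / sin (of_real pi * w) ^ 2 - 1 / w\<^sup>2)) (at w)"
    proof -
      have "((\<lambda>z. of_real pi * (cos (of_real pi * z) / sin (of_real pi * z)) - 1 / z) has_field_derivative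
        of_real pi * ((- sin (of_real pi * w) * of_real pi * sin (of_real pi * w) - cos (of_real pi * w) * (cos (of_real pi * w) * of_real pi))
           / (sin (of_real pi * w) * sin (of_real pi * w))) - (- (1 * 1) / (w * w))) (at w)"
        by (rule derivative_eq_intros refl | use s w0 in simp)+
      also have "- sin (of_real pi * w) * of_real pi * sin (of_real pi * w) - cos (of_real pi * w) * (cos (of_real pi * w) * of_real pi) =
          - of_real pi * (sin (of_real pi * w) ^ 2 + cos (of_real pi * w) ^ 2)"
        unfolding power2_eq_square distrib_left by (simp add: mult_ac)
      also have "sin (of_real pi * w) ^ 2 + cos (of_real pi * w) ^ 2 = 1" by simp
      finally show ?thesis by (simp add: power2_eq_square algebra_simps)
    qed
    moreover have "eventually (\<lambda>z. z \<in> - \<int>) (nhds w)"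
      using w by (intro eventually_nhds_in_open) (auto simp: open_Compl)
    hence ev: "eventually (\<lambda>z. Digamma (1 - z) - Digamma (1 + z) =
       of_real pi * (cos (of_real pi * z) / sin (of_real pi * z)) - 1 / z) (nhds w)"
    proof eventually_elim
      case (elim z)
      hence "z \<notin> \<int>" "z \<noteq> 0" by auto
      thus ?case using Digamma_reflection_complex[of z] Digamma_plus1[of z]
        by (simp add: algebra_simps cot_def)
    qed
    ultimately have "- Polygamma 1 (1 - w) - Polygamma 1 (1 + w) = - (of_real pi ^ 2 / sin (of_real pi * w) ^ 2 - 1 / w\<^sup>2)"
      using D DERIV_unique DERIV_cong_ev[OF refl ev refl] by blast
    thus ?thesis by (simp add: algebra_simps)
  qed
  ultimately show ?thesis by simp
qed

text \<open>Fubini's theorem for an unconditionally summable family, with the row and column sums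
  known only as ordinary series.\<close>

lemma double_sums_swap:
  fixes d :: "nat \<Rightarrow> nat \<Rightarrow> 'a :: banach"
  assumes d: "(\<lambda>(m, n). d m n) summable_on UNIV \<times> UNIV"
      and r: "\<And>m. d m sums r m" and c: "\<And>n. (\<lambda>m. d m n) sums c n"
  shows "\<exists>S. r sums S \<and> c sums S"
proof -
  have row: "(f m has_sum g m) UNIV" if "(\<lambda>(m, n). f m n) summable_on UNIV \<times> UNIV" "\<And>m. f m sums g m"
    for f :: "nat \<Rightarrow> nat \<Rightarrow> 'a" and g m
  proof -
    have "(\<lambda>(m, n). f m n) summable_on (\<lambda>n. (m, n)) ` UNIV"
      by (rule summable_on_subset_banach[OF that(1)]) auto
    hence "f m summable_on UNIV"
      by (subst (asm) summable_on_reindex) (auto simp: inj_on_def o_def)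
    thus ?thesis using that(2)[of m] has_sum_imp_sums has_sum_infsum sums_unique2 by metis
  qed
  have d': "(\<lambda>(n, m). d m n) summable_on UNIV \<times> UNIV"
    using d by (subst summable_on_swap) (simp add: case_prod_unfold)
  obtain S where S: "((\<lambda>(m, n). d m n) has_sum S) (UNIV \<times> UNIV)"
    using d by (auto simp: summable_on_def)
  hence S': "((\<lambda>(n, m). d m n) has_sum S) (UNIV \<times> UNIV)"
    by (subst has_sum_swap) (simp add: case_prod_unfold)
  have "(r has_sum S) UNIV"
    by (rule has_sum_SigmaD[OF S]) (use row[of d r, OF d r] in simp)
  moreover have "(c has_sum S) UNIV"
    by (rule has_sum_SigmaD[OF S']) (use row[of "\<lambda>n m. d m n" c, OF d' c] in simp)
  ultimately show ?thesis by (auto dest: has_sum_imp_sums)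
qed

lemma summable_on_inverse_squares_prod:
  "(\<lambda>(m, n). C / (real (Suc m) ^ 2 * real (Suc n) ^ 2)) summable_on UNIV \<times> UNIV"
proof -
  have s: "summable (\<lambda>n. 1 / real (Suc n) ^ 2)"
    using inverse_squares_sums by (auto simp: sums_iff add.commute)
  hence h: "((\<lambda>n. 1 / real (Suc n) ^ 2) has_sum (\<Sum>n. 1 / real (Suc n) ^ 2)) UNIV"
    by (intro norm_summable_imp_has_sum) (auto simp: summable_sums)
  have "(\<lambda>x. (case x of (m, n) \<Rightarrow> 1 / (real (Suc m) ^ 2 * real (Suc n) ^ 2))) summable_on UNIV \<times> UNIV"
  proof (rule summable_on_SigmaI)
    show "((\<lambda>n. case (m, n) of (m, n) \<Rightarrow> 1 / (real (Suc m) ^ 2 * real (Suc n) ^ 2)) has_sum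
            1 / real (Suc m) ^ 2 * (\<Sum>n. 1 / real (Suc n) ^ 2)) UNIV" for m
      using has_sum_cmult_right[OF h, of "1 / real (Suc m) ^ 2"] by (simp add: field_simps)
    show "(\<lambda>m. 1 / real (Suc m) ^ 2 * (\<Sum>n. 1 / real (Suc n) ^ 2)) summable_on UNIV"
      using has_sum_cmult_left[OF h] by (auto simp: summable_on_def)
  qed auto
  from summable_on_cmult_right[OF this, of C] show ?thesis
    by (simp add: case_prod_unfold)
qed

text \<open>One constant bounds the norm from below by both coordinates. For \<bar>x\<bar> at least
  2 m \<bar>z\<bar> the triangle inequality suffices; otherwise x is controlled by m, and the
  imaginary part m Im z takes over.\<close>

lemma norm_lattice_ge:
  assumes z: "Im z > 0"
  obtains \<delta> where "\<delta> > 0" "\<And>m x. real m * \<delta> \<le> cmod (of_nat m * z + of_real x)"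
    "\<And>m x. \<bar>x\<bar> * \<delta> \<le> cmod (of_nat m * z + of_real x)"
proof
  define \<delta> where "\<delta> = min (Im z) (min (1/2) (Im z / (2 * cmod z)))"
  have z0: "cmod z > 0" using z by auto
  show "\<delta> > 0" using z z0 by (auto simp: \<delta>_def)
  have a: "real m * Im z \<le> cmod (of_nat m * z + of_real x)" for m x
    using abs_Im_le_cmod[of "of_nat m * z + of_real x"] by simp
  show "real m * \<delta> \<le> cmod (of_nat m * z + of_real x)" for m x
    by (rule order_trans[OF _ a]) (auto simp: \<delta>_def intro!: mult_left_mono)
  show "\<bar>x\<bar> * \<delta> \<le> cmod (of_nat m * z + of_real x)" for m x
  proof (cases "\<bar>x\<bar> \<ge> 2 * real m * cmod z")
    case True
    have "\<bar>x\<bar> \<le> cmod (of_nat m * z + of_real x) + real m * cmod z"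
      using norm_triangle_ineq4[of "of_nat m * z + of_real x" "of_nat m * z"] by (simp add: norm_mult)
    with True have "\<bar>x\<bar> * (1/2) \<le> cmod (of_nat m * z + of_real x)" by simp
    moreover have "\<bar>x\<bar> * \<delta> \<le> \<bar>x\<bar> * (1/2)" by (intro mult_left_mono) (auto simp: \<delta>_def)
    ultimately show ?thesis by linarith
  next
    case False
    have "\<bar>x\<bar> * \<delta> \<le> \<bar>x\<bar> * (Im z / (2 * cmod z))" by (intro mult_left_mono) (auto simp: \<delta>_def)
    also have "\<dots> \<le> 2 * real m * cmod z * (Im z / (2 * cmod z))"
      using False z z0 by (intro mult_right_mono) auto
    also have "\<dots> = real m * Im z" using z0 by simp
    finally show ?thesis using a[of m x] by linarith
  qed
qed

section \<open>Trigonometric functions and Lambert series in q\<close>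

lemma norm_qpar: "cmod (qpar z) = exp (- 2 * pi * Im z)"
  by (simp add: qpar_def norm_exp_eq_Re)

lemma norm_qpar_less_1: "Im z > 0 \<Longrightarrow> cmod (qpar z) < 1"
  by (simp add: norm_qpar)

lemma qpar_of_nat_mult: "qpar (of_nat m * z) = qpar z ^ m"
  by (simp add: qpar_def exp_of_nat_mult [symmetric] mult_ac)

lemma not_Ints_of_Im: "Im z \<noteq> 0 \<Longrightarrow> z \<notin> \<int>"
  by (auto elim!: Ints_cases)

lemma sin_qpar: "(sin (of_real pi * w) ^ 2) * (4 * qpar w) = - ((1 - qpar w) ^ 2)"
proof -
  define e where "e = exp (\<i> * (of_real pi * w))"
  have e0: "e \<noteq> 0" by (simp add: e_def)
  have q: "qpar w = e ^ 2" by (simp add: qpar_def e_def exp_double [symmetric] mult_ac)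
  have s: "sin (of_real pi * w) = (e - 1 / e) / (2 * \<i>)"
    by (simp add: sin_exp_eq e_def exp_minus field_simps)
  show ?thesis unfolding q s using e0
    by (simp add: power_divide power_mult_distrib) (simp add: field_simps power2_eq_square)
qed

text \<open>Lipschitz's formula in weight 2: the left side of \<open>sin_qpar\<close> turns the
  quotient into -4 pi^2 q / (1 - q)^2, which is a differentiated geometric series.\<close>

lemma inverse_sin_squared_sums:
  assumes "Im w > 0"
  shows "(\<lambda>r. - 4 * of_real pi ^ 2 * (of_nat (Suc r) * qpar w ^ Suc r)) sums (of_real pi ^ 2 / sin (of_real pi * w) ^ 2)"
proof -
  have q: "cmod (qpar w) < 1" using assms by (rule norm_qpar_less_1)
  hence q1: "qpar w \<noteq> 1" by auto
  have q0: "qpar w \<noteq> 0" by (simp add: qpar_def)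
  have s: "sin (of_real pi * w) ^ 2 = - ((1 - qpar w) ^ 2) / (4 * qpar w)"
    using sin_qpar[of w] q0 by (simp add: field_simps)
  have "(\<lambda>r. (- 4 * of_real pi ^ 2 * qpar w) * (of_nat (Suc r) * qpar w ^ r)) sums
      ((- 4 * of_real pi ^ 2 * qpar w) * (1 / (1 - qpar w) ^ 2))"
    by (intro sums_mult geometric_deriv_sums q)
  thus ?thesis using q0 q1 unfolding s by (simp add: field_simps)
qed

text \<open>Formulated in the lower half plane because it is applied to x / z with x > 0 and Im z >
  0.\<close>

lemma cot_qpar:
  assumes "Im w < 0"
  shows "cot (of_real pi * w) = \<i> * (1 + qpar (- w)) / (1 - qpar (- w))"
proof -
  define e where "e = exp (\<i> * (of_real pi * w))"
  have e0: "e \<noteq> 0" by (simp add: e_def)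
  have q: "qpar (- w) = 1 / e ^ 2"
    by (simp add: qpar_def e_def exp_double [symmetric] exp_minus inverse_eq_divide mult_ac)
  have "cmod (qpar (- w)) < 1" using assms by (intro norm_qpar_less_1) auto
  hence q1: "qpar (-w) \<noteq> 1" by auto
  hence e1: "e\<^sup>2 \<noteq> 1" unfolding q by auto
  have s: "sin (of_real pi * w) = (e - 1 / e) / (2 * \<i>)" "cos (of_real pi * w) = (e + 1 / e) / 2"
    by (simp_all add: sin_exp_eq cos_exp_eq e_def exp_minus field_simps)
  show ?thesis unfolding q s cot_def using e0 e1
    by (simp add: field_simps power2_eq_square)
qed

text \<open>Absolute convergence allows the double series to be regrouped by the value of the
  product of its two indices, which turns it into a series of divisor sums.\<close>

lemma lambert_sums:
  fixes q :: complex
  assumes q: "cmod q < 1"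
  shows "\<exists>S. (\<lambda>m. \<Sum>r. of_nat (Suc r) * (q ^ Suc m) ^ Suc r) sums S \<and>
            (\<lambda>n. of_nat (sigma_div 1 (Suc n)) * q ^ Suc n) sums S"
proof -
  define f :: "nat \<Rightarrow> nat \<Rightarrow> complex" where "f m r = of_nat (Suc r) * (q ^ Suc m) ^ Suc r" for m r
  have qm: "cmod (q ^ Suc m) < 1" for m
    using q by (simp add: norm_power power_less_one_iff del: power_Suc)
  have nrm: "((\<lambda>r. cmod (f m r)) has_sum (\<Sum>r. cmod (f m r))) UNIV" and
       sf: "(f m has_sum (\<Sum>r. f m r)) UNIV" and
       val: "(\<Sum>r. cmod (f m r)) = cmod q ^ Suc m / (1 - cmod q ^ Suc m) ^ 2" for m
  proof -
    define x where "x = cmod q ^ Suc m"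
    have x: "\<bar>x\<bar> < 1" using qm[of m] by (simp add: x_def norm_power del: power_Suc)
    have "(\<lambda>r. x * (of_nat (Suc r) * x ^ r)) sums (x * (1 / (1 - x) ^ 2))"
      using x by (intro sums_mult geometric_deriv_sums) auto
    hence s: "(\<lambda>r. cmod (f m r)) sums (x / (1 - x) ^ 2)"
      by (simp add: f_def norm_mult norm_power x_def mult_ac del: power_Suc of_nat_Suc) (simp add: mult_ac)
    show "(\<Sum>r. cmod (f m r)) = cmod q ^ Suc m / (1 - cmod q ^ Suc m) ^ 2"
      using s by (simp add: sums_iff x_def)
    show "((\<lambda>r. cmod (f m r)) has_sum (\<Sum>r. cmod (f m r))) UNIV"
      using s by (intro norm_summable_imp_has_sum) (auto simp: sums_iff)
    show "(f m has_sum (\<Sum>r. f m r)) UNIV"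
      using s by (intro norm_summable_imp_has_sum summable_sums)
        (auto simp: sums_iff intro: summable_norm_cancel)
  qed
  have "summable (\<lambda>m. cmod q ^ Suc m / (1 - cmod q ^ Suc m) ^ 2)"
  proof (rule summable_comparison_test')
    show "summable (\<lambda>m. cmod q ^ Suc m / (1 - cmod q) ^ 2)"
      using q by (intro summable_divide) (simp add: summable_mult summable_geometric)
    fix m
    have "cmod q ^ Suc m \<le> cmod q" using q by (simp add: mult_left_le power_le_one)
    hence "(1 - cmod q) ^ 2 \<le> (1 - cmod q ^ Suc m) ^ 2" using q by (intro power_mono) auto
    thus "norm (cmod q ^ Suc m / (1 - cmod q ^ Suc m) ^ 2) \<le> cmod q ^ Suc m / (1 - cmod q) ^ 2"
      using q by (simp del: power_Suc) (intro divide_left_mono, auto simp del: power_Suc simp: power_Suc_less_one intro!: mult_pos_pos)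
  qed
  hence "(\<lambda>m. \<Sum>r. cmod (f m r)) summable_on UNIV"
    unfolding val by (subst summable_on_UNIV_nonneg_real_iff) auto
  hence "(\<lambda>x. norm (case x of (m, r) \<Rightarrow> f m r)) summable_on UNIV \<times> UNIV"
    by (intro summable_on_SigmaI[where g = "\<lambda>m. \<Sum>r. cmod (f m r)"]) (use nrm in auto)
  then obtain S where S: "((\<lambda>(m, r). f m r) has_sum S) (UNIV \<times> UNIV)"
    using abs_summable_summable by (auto simp: summable_on_def)
  have 1: "((\<lambda>m. \<Sum>r. f m r) has_sum S) UNIV"
    by (rule has_sum_SigmaD[OF S]) (simp add: sf)
  \<comment> \<open>All indices are shifted by one: \<open>Suc m * Suc r\<close> is the new exponent
    \<open>Suc n\<close>, and \<open>Suc r\<close> is the divisor \<open>d\<close> of it.\<close>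
  have "((\<lambda>(m, r). f m r) has_sum S) (UNIV \<times> UNIV) =
      ((\<lambda>(n, d). of_nat d * q ^ Suc n) has_sum S) (SIGMA n:UNIV. {d. d dvd Suc n})"
  proof (rule has_sum_reindex_bij_witness[where j = "\<lambda>(m, r). (Suc m * Suc r - 1, Suc r)"
        and i = "\<lambda>(n, d). (Suc n div d - 1, d - 1)"])
    fix b assume "b \<in> (SIGMA n:UNIV. {d. d dvd Suc n})"
    then obtain n d where b: "b = (n, d)" "d dvd Suc n" by auto
    then obtain e where e: "Suc n = d * e" by auto
    hence "d > 0" "e > 0" by (auto intro: Nat.gr0I)
    moreover from this e have "n = d * e - 1" by simp
    ultimately show "(case case b of (n, d) \<Rightarrow> (Suc n div d - 1, d - 1) of (m, r) \<Rightarrow> (Suc m * Suc r - 1, Suc r)) = b"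
      using b e by (auto simp: mult.commute simp del: mult_Suc mult_Suc_right)
  qed (auto simp: f_def power_mult [symmetric] simp del: power_Suc of_nat_Suc mult_Suc mult_Suc_right intro: Nat.gr0I)
  with S have "((\<lambda>(n, d). of_nat d * q ^ Suc n) has_sum S) (SIGMA n:UNIV. {d. d dvd Suc n})" by simp
  hence "((\<lambda>n. of_nat (sigma_div 1 (Suc n)) * q ^ Suc n) has_sum S) UNIV"
  proof (rule has_sum_SigmaD)
    fix n
    have "((\<lambda>d. of_nat d * q ^ Suc n) has_sum (\<Sum>d | d dvd Suc n. of_nat d * q ^ Suc n)) {d. d dvd Suc n}"
      by (intro has_sum_finite) auto
    thus "((\<lambda>d. case (n, d) of (n, d) \<Rightarrow> of_nat d * q ^ Suc n) has_sum of_nat (sigma_div 1 (Suc n)) * q ^ Suc n)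
       {d. d dvd Suc n}"
      by (simp add: sigma_div_def sum_distrib_right)
  qed
  with 1 show ?thesis unfolding f_def by (auto dest: has_sum_imp_sums)
qed

text \<open>Lipschitz's formula at each multiple of z gives the Lambert series of \<open>E2\<close>,
  with -4 pi^2 (1 - E2) / 24 = pi^2 / 6 (E2 - 1).\<close>

lemma inverse_sin_squared_E2:
  assumes z: "Im z > 0"
  shows "(\<lambda>m. of_real pi ^ 2 / sin (of_real pi * (of_nat (Suc m) * z)) ^ 2) sums (of_real pi ^ 2 / 6 * (E2 z - 1))"
proof -
  have q: "cmod (qpar z) < 1" using z by (rule norm_qpar_less_1)
  from lambert_sums[OF q] obtain S where
    S: "(\<lambda>m. \<Sum>r. of_nat (Suc r) * (qpar z ^ Suc m) ^ Suc r) sums S"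
       "(\<lambda>n. of_nat (sigma_div 1 (Suc n)) * qpar z ^ Suc n) sums S" by blast
  have "of_real pi ^ 2 / sin (of_real pi * (of_nat (Suc m) * z)) ^ 2 =
     - 4 * of_real pi ^ 2 * (\<Sum>r. of_nat (Suc r) * (qpar z ^ Suc m) ^ Suc r)" for m
  proof -
    have im: "Im (of_nat (Suc m) * z) > 0" using z by (simp add: mult_pos_pos del: of_nat_Suc)
    have x: "(\<lambda>r. - 4 * of_real pi ^ 2 * (of_nat (Suc r) * (qpar z ^ Suc m) ^ Suc r)) sums
       (of_real pi ^ 2 / sin (of_real pi * (of_nat (Suc m) * z)) ^ 2)"
      using inverse_sin_squared_sums[OF im] unfolding qpar_of_nat_mult .
    have "(\<lambda>r. inverse (- 4 * of_real pi ^ 2) * (- 4 * of_real pi ^ 2 * (of_nat (Suc r) * (qpar z ^ Suc m) ^ Suc r))) sums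
       (inverse (- 4 * of_real pi ^ 2) * (of_real pi ^ 2 / sin (of_real pi * (of_nat (Suc m) * z)) ^ 2))"
      by (rule sums_mult[OF x])
    hence "(\<lambda>r. of_nat (Suc r) * (qpar z ^ Suc m) ^ Suc r) sums
       (inverse (- 4 * of_real pi ^ 2) * (of_real pi ^ 2 / sin (of_real pi * (of_nat (Suc m) * z)) ^ 2))"
      by (simp add: field_simps del: of_nat_Suc power_Suc)
    thus ?thesis by (simp add: sums_iff del: of_nat_Suc power_Suc)
  qed
  moreover have "S = (1 - E2 z) / 24"
    using S(2) by (simp add: E2_def sums_iff)
  moreover have "- 4 * of_real pi ^ 2 * S = of_real pi ^ 2 / 6 * (E2 z - 1)"
    unfolding calculation(2) by (simp add: field_simps)
  ultimately show ?thesis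
    using sums_mult[OF S(1), of "- 4 * of_real pi ^ 2"] by (simp only:)
qed

section \<open>The transformation law of the Eisenstein series E2\<close>

text \<open>
  Exchanging the sums in \<open>\<Sum>\<^sub>m \<Sum>\<^sub>n 1 / (m z + n)\<^sup>2\<close> is not allowed, as the double series converges only
  conditionally. Subtracting the terms \<open>1 / (m z + n - 1/2) - 1 / (m z + n + 1/2)\<close>, symmetrised in \<open>n\<close>, makes it
  absolutely convergent. The subtracted terms telescope in \<open>n\<close>; summed over \<open>m\<close> first they give
  cotangents, whose limit at \<open>- \<i> \<infinity>\<close> produces the anomaly of \<open>E2\<close>.
\<close>

lemma E2_S_transform:
  assumes z: "Im z > 0"
  shows "E2 (- 1 / z) = z ^ 2 * E2 z + 6 / (of_real pi * \<i>) * z"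
proof -
  have z0: "z \<noteq> 0" using z by auto
  define w where "w = - 1 / z"
  have w: "Im w > 0"
    using z z0 by (simp add: w_def Im_divide power2_eq_square complex_neq_0 sum_squares_gt_zero_iff
        divide_pos_pos complex_eq_iff)
  obtain \<delta> where \<delta>: "\<delta> > 0" "\<And>m x. real m * \<delta> \<le> cmod (of_nat m * z + of_real x)"
    "\<And>m x. \<bar>x\<bar> * \<delta> \<le> cmod (of_nat m * z + of_real x)"
    using norm_lattice_ge[OF z] by blast
  have nz: "of_nat (Suc m) * z + of_real x \<noteq> 0" for m x
    using z by (auto simp: complex_eq_iff simp del: of_nat_Suc)
  \<comment> \<open>This form serves both orders of summation: for fixed \<open>m\<close> it is 1 /
    (mz + x) - 1 / (mz - x) and tends to 0 in x, while for fixed x it is 1 / z times the m-th term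
    of the cotangent series at x / z.\<close>
  define g where "g m x = 2 * of_real x / (of_real x ^ 2 - of_nat (Suc m) ^ 2 * z ^ 2)" for m :: nat and x :: real
  define h where "h n = (real n + 1 / 2)" for n :: nat
  have hS: "h (Suc n) = real (Suc n) + 1/2" "h n = real (Suc n) - 1/2" for n by (simp_all add: h_def)
  define a where "a m n = 1 / (of_nat (Suc m) * z + of_nat (Suc n)) ^ 2 + 1 / (of_nat (Suc m) * z - of_nat (Suc n)) ^ 2" for m n :: nat
  define d where "d m n = a m n - (g m (h n) - g m (h (Suc n)))" for m n
  have geq: "g m x = 1 / (of_nat (Suc m) * z + of_real x) - 1 / (of_nat (Suc m) * z - of_real x)" for m x
  proof -
    define u where "u = of_nat (Suc m) * z"
    have "u + of_real x \<noteq> 0" "u - of_real x \<noteq> 0"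
      using nz[of m x] nz[of m "-x"] by (simp_all add: u_def)
    moreover have "of_real x ^ 2 - u ^ 2 = - ((u + of_real x) * (u - of_real x))"
      by (simp add: power2_eq_square algebra_simps)
    ultimately have "2 * of_real x / (of_real x ^ 2 - u ^ 2) = 1 / (u + of_real x) - 1 / (u - of_real x)"
      by (simp only:) (simp add: divide_simps)
    thus ?thesis by (simp add: g_def u_def power_mult_distrib)
  qed
  have dbound: "cmod (d m n) \<le> (1 / (2 * \<delta> ^ 4)) / (real (Suc m) ^ 2 * real (Suc n) ^ 2)" for m n
  proof -
    \<comment> \<open>The difference equals -1/4 divided by u^2 (u^2 - 1/4), so it decays like the
      fourth power of u. Each of the two quadratic factors is bounded below by M N.\<close>
    have one: "cmod (1 / u ^ 2 - (1 / (u - 1/2) - 1 / (u + 1/2))) \<le> (1 / (4 * \<delta> ^ 4)) / (real (Suc m) ^ 2 * real (Suc n) ^ 2)"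
      if u: "u = of_nat (Suc m) * z + of_real x" "\<bar>x\<bar> = real (Suc n)" for u x
    proof -
      define M N where "M = real (Suc m) * \<delta>" and "N = real (Suc n) * \<delta>"
      have MN: "M > 0" "N > 0" using \<delta>(1) by (auto simp: M_def N_def)
      have u1: "M \<le> cmod u" "N \<le> cmod u"
        using \<delta>(2)[of "Suc m" x] \<delta>(3)[of x "Suc m"] u by (auto simp: M_def N_def)
      have uM: "M \<le> cmod (u - 1/2)" "M \<le> cmod (u + 1/2)"
        using \<delta>(2)[of "Suc m" "x - 1/2"] \<delta>(2)[of "Suc m" "x + 1/2"] u by (auto simp: M_def algebra_simps)
      have uN: "\<bar>x - 1/2\<bar> * \<delta> \<le> cmod (u - 1/2)" "\<bar>x + 1/2\<bar> * \<delta> \<le> cmod (u + 1/2)"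
        using \<delta>(3)[of "x - 1/2" "Suc m"] \<delta>(3)[of "x + 1/2" "Suc m"] u by (auto simp: algebra_simps)
      \<comment> \<open>Of the two shifts by 1/2, the one directed away from 0 keeps the real
        coordinate at least \<open>Suc n\<close> in absolute value; that factor takes the bound N
        and the other one takes M.\<close>
      have u2: "M * N \<le> cmod ((u - 1/2) * (u + 1/2))"
      proof (cases "x \<ge> 0")
        case True
        have "N \<le> \<bar>x + 1/2\<bar> * \<delta>" unfolding N_def using True u \<delta>(1) by (intro mult_right_mono) auto
        hence "M * N \<le> cmod (u - 1/2) * cmod (u + 1/2)" using uM uN MN by (intro mult_mono) auto
        thus ?thesis by (simp add: norm_mult)
      next
        case False
        have "N \<le> \<bar>x - 1/2\<bar> * \<delta>" unfolding N_def using False u \<delta>(1) by (intro mult_right_mono) auto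
        hence "N * M \<le> cmod (u - 1/2) * cmod (u + 1/2)" using uM uN MN by (intro mult_mono) auto
        thus ?thesis by (simp add: norm_mult mult.commute)
      qed
      have u3: "M * N \<le> cmod (u ^ 2)"
        using mult_mono[OF u1] MN by (simp add: norm_mult power2_eq_square)
      have "y \<noteq> 0" if "M \<le> cmod y" for y :: complex using that MN by auto
      hence n0: "u \<noteq> 0" "u - 1/2 \<noteq> 0" "u + 1/2 \<noteq> 0" using u1(1) uM by blast+
      have "1 / u ^ 2 - (1 / (u - 1/2) - 1 / (u + 1/2)) = (- 1 / 4) / (u ^ 2 * ((u - 1/2) * (u + 1/2)))"
      proof -
        define v v' where "v = u - 1/2" and "v' = u + 1/2"
        have "1 / u ^ 2 - (1 / v - 1 / v') = (v * v' - u ^ 2 * (v' - v)) / (u ^ 2 * (v * v'))"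
          using n0 unfolding v_def [symmetric] v'_def [symmetric] by (simp add: divide_simps algebra_simps)
        also have "v * v' - u ^ 2 * (v' - v) = - 1 / 4"
          by (simp add: v_def v'_def power2_eq_square algebra_simps)
        finally show ?thesis by (simp add: v_def v'_def)
      qed
      hence "cmod (1 / u ^ 2 - (1 / (u - 1/2) - 1 / (u + 1/2))) = (1 / 4) / (cmod (u ^ 2) * cmod ((u - 1/2) * (u + 1/2)))"
        by (simp add: norm_divide norm_mult)
      also have "\<dots> \<le> (1 / 4) / ((M * N) * (M * N))"
        by (intro frac_le mult_mono u2 u3 mult_pos_pos MN) (use MN in simp_all)
      finally show ?thesis
        using \<delta>(1) by (simp add: M_def N_def field_simps eval_nat_numeral del: of_nat_Suc)
    qed
    have "d m n = (1 / (of_nat (Suc m) * z + of_real (real (Suc n))) ^ 2 -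
         (1 / (of_nat (Suc m) * z + of_real (real (Suc n)) - 1/2) - 1 / (of_nat (Suc m) * z + of_real (real (Suc n)) + 1/2)))
       + (1 / (of_nat (Suc m) * z + of_real (- real (Suc n))) ^ 2 -
         (1 / (of_nat (Suc m) * z + of_real (- real (Suc n)) - 1/2) - 1 / (of_nat (Suc m) * z + of_real (- real (Suc n)) + 1/2)))"
      unfolding d_def a_def geq hS(1)[of n] hS(2)[of n] by (simp add: algebra_simps del: of_nat_Suc)
    also have "cmod \<dots> \<le> (1 / (4 * \<delta> ^ 4)) / (real (Suc m) ^ 2 * real (Suc n) ^ 2) + (1 / (4 * \<delta> ^ 4)) / (real (Suc m) ^ 2 * real (Suc n) ^ 2)"
      by (intro norm_triangle_mono one[OF refl]) auto
    finally show ?thesis by (simp add: field_simps)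
  qed
  have dsum: "(\<lambda>(m, n). d m n) summable_on UNIV \<times> UNIV"
  proof -
    have "(\<lambda>x. norm (case x of (m, n) \<Rightarrow> d m n)) summable_on UNIV \<times> UNIV"
      by (rule summable_on_comparison_test[OF summable_on_inverse_squares_prod[of "1 / (2 * \<delta> ^ 4)"]])
        (use dbound in auto)
    thus ?thesis by (rule abs_summable_summable)
  qed
  define ps where "ps w = of_real pi ^ 2 / sin (of_real pi * w) ^ 2" for w :: complex
  \<comment> \<open>Row sums: the n = 0 term is removed from the sine formula because
    \<open>a\<close> starts at n = 1, and the telescoping part leaves its first value, at
    1/2.\<close>
  define r where "r m = ps (of_nat (Suc m) * z) - 1 / (of_nat (Suc m) * z) ^ 2 - g m (1/2)" for m
  have rsum: "d m sums r m" for m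
  proof -
    have im: "of_nat (Suc m) * z \<notin> \<int>" using z by (intro not_Ints_of_Im) (auto simp del: of_nat_Suc)
    have "(\<lambda>n. a m n) sums (ps (of_nat (Suc m) * z) - 1 / (of_nat (Suc m) * z) ^ 2)"
      using inverse_sin_squared_partial_fractions[OF im] by (simp add: a_def ps_def)
    moreover have "(\<lambda>n. g m (h n) - g m (h (Suc n))) sums (g m (h 0) - 0)"
    proof (rule telescope_sums')
      have hlim: "filterlim (\<lambda>n. of_real (h n) :: complex) at_infinity sequentially"
        unfolding h_def of_real_add of_real_of_nat_eq
        by (rule tendsto_add_filterlim_at_infinity'[OF tendsto_of_nat tendsto_const])
      have "(\<lambda>n. inverse (of_nat (Suc m) * z + of_real (h n)) + inverse (- (of_nat (Suc m) * z) + of_real (h n))) \<longlonglongrightarrow> 0 + 0"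
        by (intro tendsto_add filterlim_compose[OF tendsto_inverse_0] hlim
           tendsto_add_filterlim_at_infinity[OF tendsto_const])
      moreover have "inverse (- (of_nat (Suc m) * z) + of_real x) = - (1 / (of_nat (Suc m) * z - of_real x))" for x
        by (metis inverse_eq_divide inverse_minus_eq minus_diff_eq uminus_add_conv_diff)
      ultimately show "(\<lambda>n. g m (h n)) \<longlonglongrightarrow> 0" by (simp add: geq inverse_eq_divide del: of_nat_Suc)
    qed
    ultimately show ?thesis
      unfolding d_def r_def using sums_diff by (fastforce simp: h_def)
  qed
  define G where "G x = of_real pi / z * cot (of_real pi * (of_real x / z)) - 1 / of_real x" for x :: real
  have Gsum: "(\<lambda>m. g m x) sums G x" if "x > 0" for x
  proof -
    have im: "of_real x / z \<notin> \<int>"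
      using w that by (intro not_Ints_of_Im) (auto simp: w_def Im_divide)
    have "(\<lambda>m. 1 / z * (2 * (of_real x / z) / ((of_real x / z)\<^sup>2 - of_nat (Suc m) ^ 2))) sums
       (1 / z * (of_real pi * cot (of_real pi * (of_real x / z)) - 1 / (of_real x / z)))"
      by (intro sums_mult cot_partial_fractions im)
    moreover have "1 / z * (of_real pi * cot (of_real pi * (of_real x / z)) - 1 / (of_real x / z)) = G x"
      using z0 that by (simp add: G_def field_simps)
    moreover have "1 / z * (2 * (of_real x / z) / ((of_real x / z)\<^sup>2 - of_nat (Suc m) ^ 2)) = g m x" for m
    proof -
      have "(of_real x / z)\<^sup>2 - of_nat (Suc m) ^ 2 = (of_real x ^ 2 - of_nat (Suc m) ^ 2 * z ^ 2) / z ^ 2"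
        using z0 by (simp add: field_simps del: of_nat_Suc)
      thus ?thesis using z0 by (simp add: g_def power2_eq_square del: of_nat_Suc)
    qed
    ultimately show ?thesis by simp
  qed
  \<comment> \<open>Column sums: with w = -1 / z one has nw + m = (mz - n) / z, so the same sine
    formula applies at nw with a factor 1 / z^2.\<close>
  define c where "c n = (1 / z ^ 2) * (ps (of_nat (Suc n) * w) - 1 / (of_nat (Suc n) * w) ^ 2) - (G (h n) - G (h (Suc n)))" for n
  have csum: "(\<lambda>m. d m n) sums c n" for n
  proof -
    have im: "of_nat (Suc n) * w \<notin> \<int>" using w by (intro not_Ints_of_Im) (auto simp del: of_nat_Suc)
    have "(\<lambda>m. (1 / z ^ 2) * (1 / (of_nat (Suc n) * w + of_nat (Suc m)) ^ 2 + 1 / (of_nat (Suc n) * w - of_nat (Suc m)) ^ 2)) sums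
       ((1 / z ^ 2) * (ps (of_nat (Suc n) * w) - 1 / (of_nat (Suc n) * w) ^ 2))"
      unfolding ps_def by (intro sums_mult inverse_sin_squared_partial_fractions im)
    moreover have "(1 / z ^ 2) * (1 / (of_nat (Suc n) * w + of_nat (Suc m)) ^ 2 + 1 / (of_nat (Suc n) * w - of_nat (Suc m)) ^ 2) = a m n" for m
    proof -
      have "of_nat (Suc n) * w + of_nat (Suc m) = (of_nat (Suc m) * z - of_nat (Suc n)) / z"
        using z0 by (simp add: w_def field_simps del: of_nat_Suc)
      moreover have "of_nat (Suc n) * w - of_nat (Suc m) = - (of_nat (Suc m) * z + of_nat (Suc n)) / z"
        using z0 by (simp add: w_def field_simps del: of_nat_Suc)
      ultimately show ?thesis
        using z0 unfolding a_def
        by (simp add: power_divide distrib_left del: of_nat_Suc)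
          (metis add_uminus_conv_diff minus_add_distrib power2_minus)
    qed
    ultimately have "(\<lambda>m. a m n) sums ((1 / z ^ 2) * (ps (of_nat (Suc n) * w) - 1 / (of_nat (Suc n) * w) ^ 2))" by simp
    thus ?thesis unfolding d_def c_def by (intro sums_diff Gsum) (auto simp: h_def)
  qed
  obtain S where S: "r sums S" "c sums S" using double_sums_swap[OF dsum rsum csum] by blast
  have z2: "(\<lambda>n. 1 / of_nat (Suc n) ^ 2) sums (of_real pi ^ 2 / 6 :: complex)"
  proof -
    have "(\<lambda>n. complex_of_real (1 / (real n + 1)\<^sup>2)) sums of_real (pi\<^sup>2 / 6)"
      using inverse_squares_sums unfolding sums_of_real_iff by (simp add: add.commute)
    thus ?thesis by (simp add: add.commute)
  qed
  have "r sums (of_real pi ^ 2 / 6 * (E2 z - 1) - (1 / z ^ 2) * (of_real pi ^ 2 / 6) - G (1/2))"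
  proof -
    have "(\<lambda>m. ps (of_nat (Suc m) * z) - (1 / z ^ 2) * (1 / of_nat (Suc m) ^ 2) - g m (1/2)) sums
       (of_real pi ^ 2 / 6 * (E2 z - 1) - (1 / z ^ 2) * (of_real pi ^ 2 / 6) - G (1/2))"
      unfolding ps_def by (intro sums_diff sums_mult z2 Gsum inverse_sin_squared_E2 z) auto
    thus ?thesis by (simp add: r_def [abs_def] power_mult_distrib mult.commute del: of_nat_Suc)
  qed
  hence S1: "S = of_real pi ^ 2 / 6 * (E2 z - 1) - (1 / z ^ 2) * (of_real pi ^ 2 / 6) - G (1/2)"
    using S(1) sums_unique2 by blast
  have Glim: "(\<lambda>n. G (h n)) \<longlonglongrightarrow> of_real pi * \<i> / z"
  proof -
    have "(\<lambda>n. qpar (w / 2) * qpar w ^ n) \<longlonglongrightarrow> qpar (w / 2) * 0"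
      by (intro tendsto_mult tendsto_const LIMSEQ_power_zero norm_qpar_less_1 w)
    moreover have "qpar (w / 2) * qpar w ^ n = qpar (of_real (h n) * w)" for n
      unfolding qpar_of_nat_mult [symmetric] unfolding qpar_def by (simp add: h_def exp_add [symmetric] algebra_simps)
    ultimately have p: "(\<lambda>n. qpar (of_real (h n) * w)) \<longlonglongrightarrow> 0" by simp
    have "(\<lambda>n. of_real pi / z * (\<i> * (1 + qpar (of_real (h n) * w)) / (1 - qpar (of_real (h n) * w))) - 1 / of_real (h n))
      \<longlonglongrightarrow> of_real pi / z * (\<i> * (1 + 0) / (1 - 0)) - 0"
    proof (intro tendsto_intros p)
      have "(\<lambda>n. inverse (of_nat n + 1 / 2)) \<longlonglongrightarrow> (0 :: complex)"
        by (rule filterlim_compose[OF tendsto_inverse_0 tendsto_add_filterlim_at_infinity'[OF tendsto_of_nat tendsto_const]])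
      thus "(\<lambda>n. 1 / of_real (h n)) \<longlonglongrightarrow> (0 :: complex)" by (simp add: h_def inverse_eq_divide)
    qed auto
    moreover have "cot (of_real pi * (of_real (h n) / z)) = \<i> * (1 + qpar (of_real (h n) * w)) / (1 - qpar (of_real (h n) * w))" for n
    proof -
      have "of_real (h n) * w = - (of_real (h n) / z)" by (simp add: w_def)
      moreover have "Im (of_real (h n) * w) > 0" using w by (simp add: h_def)
      ultimately show ?thesis by (metis cot_qpar neg_0_less_iff_less uminus_complex.sel(2))
    qed
    ultimately show ?thesis by (simp add: G_def)
  qed
  have "c sums ((1 / z ^ 2) * (of_real pi ^ 2 / 6 * (E2 w - 1) - z ^ 2 * (of_real pi ^ 2 / 6)) - (G (h 0) - of_real pi * \<i> / z))"
  proof -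
    have "(\<lambda>n. (1 / z ^ 2) * (ps (of_nat (Suc n) * w) - z ^ 2 * (1 / of_nat (Suc n) ^ 2)) - (G (h n) - G (h (Suc n)))) sums
     ((1 / z ^ 2) * (of_real pi ^ 2 / 6 * (E2 w - 1) - z ^ 2 * (of_real pi ^ 2 / 6)) - (G (h 0) - of_real pi * \<i> / z))"
      unfolding ps_def by (intro sums_diff sums_mult z2 telescope_sums' Glim inverse_sin_squared_E2 w)
    moreover have "1 / (of_nat (Suc n) * w) ^ 2 = z ^ 2 * (1 / of_nat (Suc n) ^ 2)" for n
      using z0 by (simp add: w_def power_mult_distrib power_divide del: of_nat_Suc)
    ultimately show ?thesis by (simp add: c_def [abs_def] del: of_nat_Suc)
  qed
  hence S2: "S = (1 / z ^ 2) * (of_real pi ^ 2 / 6 * (E2 w - 1) - z ^ 2 * (of_real pi ^ 2 / 6)) - (G (h 0) - of_real pi * \<i> / z)"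
    using S(2) sums_unique2 by blast
  \<comment> \<open>\<open>G (h 0)\<close> is \<open>G (1/2)\<close>, which occurs in both
    evaluations of S and cancels; only the limit of the cotangents remains.\<close>
  have "of_real pi ^ 2 / 6 * (E2 z - 1) - (1 / z ^ 2) * (of_real pi ^ 2 / 6) =
     (1 / z ^ 2) * (of_real pi ^ 2 / 6 * (E2 w - 1) - z ^ 2 * (of_real pi ^ 2 / 6)) + of_real pi * \<i> / z"
    using S1 S2 by (simp add: h_def)
  moreover have "K * x = u * (K * y) + t" if "K * (x - 1) - u * K = u * (K * (y - 1) - v * K) + t" "u * v = 1"
    for K u v x y t :: complex
  proof -
    have "u * (K * (y - 1) - v * K) = u * (K * y) - u * K - K"
      using arg_cong[OF that(2), of "\<lambda>s. K * s"] by (simp add: algebra_simps)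
    with that(1) have "K * (x - 1) - u * K = u * (K * y) - u * K - K + t" by simp
    thus ?thesis by (simp add: right_diff_distrib)
  qed
  ultimately have "of_real pi ^ 2 / 6 * E2 z = (1 / z ^ 2) * (of_real pi ^ 2 / 6 * E2 w) + of_real pi * \<i> / z"
    using z0 nonzero_divide_mult_cancel_right[of "z ^ 2" 1] by (metis nonzero_eq_divide_eq power_not_zero)
  hence "(6 * z ^ 2 / of_real pi ^ 2) * (of_real pi ^ 2 / 6 * E2 z) =
      (6 * z ^ 2 / of_real pi ^ 2) * ((1 / z ^ 2) * (of_real pi ^ 2 / 6 * E2 w) + of_real pi * \<i> / z)"
    by (rule arg_cong)
  also have "\<dots> = E2 w + 6 * \<i> / of_real pi * z"
    using z0 by (simp add: distrib_left) (simp add: power2_eq_square field_simps)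
  finally have "E2 w = z ^ 2 * E2 z - 6 * \<i> / of_real pi * z"
    by simp
  also have "- (6 * \<i> / of_real pi * z) = 6 / (of_real pi * \<i>) * z"
    by (simp add: divide_simps)
  hence "z ^ 2 * E2 z - 6 * \<i> / of_real pi * z = z ^ 2 * E2 z + 6 / (of_real pi * \<i>) * z"
    by simp
  finally show ?thesis unfolding w_def .
qed

section \<open>Expansions in q\<close>

text \<open>Functions and formal series are carried along in pairs: modular identities are proved
  for functions, transferred to series by uniqueness, and the algebra and integrality are handled in
  the ring of series.\<close>

definition has_qexp :: "(complex \<Rightarrow> complex) \<Rightarrow> complex fps \<Rightarrow> bool" where
  "has_qexp f F \<longleftrightarrow> fps_conv_radius F \<ge> 1 \<and> (\<forall>z. Im z > 0 \<longrightarrow> f z = eval_fps F (qpar z))"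

definition fps_theta :: "'a :: comm_ring_1 fps \<Rightarrow> 'a fps" where
  "fps_theta F = fps_X * fps_deriv F"

definition theta :: "(complex \<Rightarrow> complex) \<Rightarrow> complex \<Rightarrow> complex" where
  "theta f z = deriv f z / (2 * of_real pi * \<i>)"

lemma fps_nth_theta [simp]: "fps_theta F $ n = of_nat n * F $ n"
  by (cases n) (simp_all add: fps_theta_def)

lemma fps_theta_add [simp]: "fps_theta (F + G) = fps_theta F + fps_theta G"
  by (simp add: fps_theta_def algebra_simps)

lemma fps_theta_diff [simp]: "fps_theta (F - G) = fps_theta F - fps_theta G"
  by (simp add: fps_theta_def algebra_simps)

lemma fps_theta_mult: "fps_theta (F * G) = fps_theta F * G + F * fps_theta G"
  by (simp add: fps_theta_def algebra_simps)

lemma fps_theta_const_mult [simp]: "fps_theta (fps_const c * F) = fps_const c * fps_theta F"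
  by (simp add: fps_theta_def algebra_simps)

lemma fps_theta_power: "fps_theta (F ^ Suc n) = of_nat (Suc n) * F ^ n * fps_theta F"
  by (induction n) (simp_all add: fps_theta_mult algebra_simps)

text \<open>Convergence at the points \<open>qpar z\<close> already gives the radius, since every r
  in (0, 1) is the modulus of \<open>qpar\<close> at a purely imaginary point.\<close>

lemma has_qexpI:
  assumes "\<And>z. Im z > 0 \<Longrightarrow> (\<lambda>n. F $ n * qpar z ^ n) sums f z"
  shows "has_qexp f F"
proof -
  have "fps_conv_radius F \<ge> 1"
    unfolding fps_conv_radius_def
  proof (rule conv_radius_geI_ex)
    fix r :: real assume r: "r > 0" "ereal r < 1"
    define z where "z = Complex 0 (- ln r / (2 * pi))"
    have z: "Im z > 0" using r by (simp add: z_def divide_neg_pos)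
    have "cmod (qpar z) = r" using r by (simp add: norm_qpar z_def)
    with assms[OF z] show "\<exists>z. cmod z = r \<and> summable (\<lambda>n. F $ n * z ^ n)"
      by (auto simp: sums_iff)
  qed
  thus ?thesis using assms by (auto simp: has_qexp_def eval_fps_def sums_iff)
qed

lemma qpar_in_radius: "fps_conv_radius F \<ge> 1 \<Longrightarrow> Im z > 0 \<Longrightarrow> ereal (cmod (qpar z)) < fps_conv_radius F"
  using norm_qpar_less_1[of z] by (metis ereal_less(3) less_le_trans)

lemma has_qexp_const: "has_qexp (\<lambda>_. c) (fps_const c)"
  by (simp add: has_qexp_def)

lemma has_qexp_add: "has_qexp f F \<Longrightarrow> has_qexp g G \<Longrightarrow> has_qexp (\<lambda>z. f z + g z) (F + G)"
  using fps_conv_radius_add[of F G]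
  by (auto simp: has_qexp_def eval_fps_add qpar_in_radius intro: order_trans[rotated])

lemma has_qexp_diff: "has_qexp f F \<Longrightarrow> has_qexp g G \<Longrightarrow> has_qexp (\<lambda>z. f z - g z) (F - G)"
  using fps_conv_radius_diff[of F G]
  by (auto simp: has_qexp_def eval_fps_diff qpar_in_radius intro: order_trans[rotated])

lemma has_qexp_mult: "has_qexp f F \<Longrightarrow> has_qexp g G \<Longrightarrow> has_qexp (\<lambda>z. f z * g z) (F * G)"
  using fps_conv_radius_mult[of F G]
  by (auto simp: has_qexp_def eval_fps_mult qpar_in_radius intro: order_trans[rotated])

lemma has_qexp_cmult: "has_qexp f F \<Longrightarrow> has_qexp (\<lambda>z. c * f z) (fps_const c * F)"
  by (intro has_qexp_mult has_qexp_const)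

lemma has_qexp_power: "has_qexp f F \<Longrightarrow> has_qexp (\<lambda>z. f z ^ n) (F ^ n)"
  by (induction n) (use has_qexp_const[of 1] in \<open>auto intro!: has_qexp_mult\<close>)

lemma has_qexp_cong: "(\<And>z. Im z > 0 \<Longrightarrow> f z = g z) \<Longrightarrow> has_qexp f F = has_qexp g F"
  by (auto simp: has_qexp_def)

lemma open_upper_half_plane: "open {z. Im z > 0}"
  by (simp add: open_halfspace_Im_gt)

lemma qpar_has_derivative: "(qpar has_field_derivative (2 * of_real pi * \<i> * qpar z)) (at z)"
  unfolding qpar_def by (auto intro!: derivative_eq_intros)

lemma has_qexp_derivative:
  assumes f: "has_qexp f F" and z: "Im z > 0"
  shows "(f has_field_derivative (2 * of_real pi * \<i> * eval_fps (fps_theta F) (qpar z))) (at z)"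
proof -
  have r: "fps_conv_radius F \<ge> 1" using f by (simp add: has_qexp_def)
  have r': "fps_conv_radius (fps_deriv F) \<ge> 1" using r fps_conv_radius_deriv[of F] by (rule order_trans)
  have "((\<lambda>z. eval_fps F (qpar z)) has_field_derivative
      eval_fps (fps_deriv F) (qpar z) * (2 * of_real pi * \<i> * qpar z)) (at z)"
    by (rule DERIV_chain2[OF has_field_derivative_eval_fps qpar_has_derivative])
      (rule qpar_in_radius[OF r z])
  moreover have "eval_fps (fps_theta F) (qpar z) = qpar z * eval_fps (fps_deriv F) (qpar z)"
    unfolding fps_theta_def using qpar_in_radius[OF r' z] by (subst eval_fps_mult) auto
  moreover have "eventually (\<lambda>w. w \<in> {z. Im z > 0}) (nhds z)"
    using z by (intro eventually_nhds_in_open open_upper_half_plane) auto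
  hence "eventually (\<lambda>w. f w = eval_fps F (qpar w)) (nhds z)"
    by eventually_elim (use f in \<open>auto simp: has_qexp_def\<close>)
  ultimately show ?thesis by (subst DERIV_cong_ev) (auto simp: mult_ac)
qed

lemma has_qexp_deriv:
  assumes "has_qexp f F" "Im z > 0"
  shows "(f has_field_derivative (2 * of_real pi * \<i> * theta f z)) (at z)"
proof -
  have "deriv f z = 2 * of_real pi * \<i> * eval_fps (fps_theta F) (qpar z)"
    by (rule DERIV_imp_deriv[OF has_qexp_derivative[OF assms]])
  thus ?thesis using has_qexp_derivative[OF assms] by (simp add: theta_def)
qed

lemma has_qexp_theta:
  assumes f: "has_qexp f F"
  shows "has_qexp (theta f) (fps_theta F)"
proof -
  have r: "fps_conv_radius F \<ge> 1" using f by (simp add: has_qexp_def)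
  have "fps_conv_radius (fps_theta F) \<ge> min (fps_conv_radius (fps_X :: complex fps)) (fps_conv_radius (fps_deriv F))"
    unfolding fps_theta_def by (rule fps_conv_radius_mult)
  moreover have "fps_conv_radius (fps_deriv F) \<ge> 1" using r fps_conv_radius_deriv[of F] by (rule order_trans)
  ultimately have "fps_conv_radius (fps_theta F) \<ge> 1" by simp
  moreover have "theta f z = eval_fps (fps_theta F) (qpar z)" if "Im z > 0" for z
    using DERIV_imp_deriv[OF has_qexp_derivative[OF f that]] by (simp add: theta_def)
  ultimately show ?thesis by (simp add: has_qexp_def)
qed

lemma has_qexp_holomorphic: "has_qexp f F \<Longrightarrow> f holomorphic_on {z. Im z > 0}"
  using has_qexp_derivative by (subst holomorphic_on_open[OF open_upper_half_plane]) blast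

lemma qpar_plus_1: "qpar (z + 1) = qpar z"
proof -
  have "qpar (z + 1) = qpar z * exp (2 * of_real pi * \<i>)"
    unfolding qpar_def by (simp add: distrib_left exp_add)
  thus ?thesis by (simp add: exp_two_pi_i)
qed

lemma has_qexp_periodic: "has_qexp f F \<Longrightarrow> Im z > 0 \<Longrightarrow> f (z + 1) = f z"
  by (simp add: has_qexp_def qpar_plus_1)

lemma has_qexp_bounded:
  assumes f: "has_qexp f F"
  shows "\<exists>B. \<forall>z. Im z \<ge> 1 \<longrightarrow> cmod (f z) \<le> B"
proof -
  have r: "fps_conv_radius F \<ge> 1" using f by (simp add: has_qexp_def)
  have e: "exp (- 2 * pi) < (1 :: real)" by simp
  have "continuous_on (cball 0 (exp (- 2 * pi))) (eval_fps F)"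
  proof (rule continuous_on_subset[OF continuous_on_eval_fps], safe)
    fix q :: complex assume "q \<in> cball 0 (exp (- 2 * pi))"
    hence "cmod q \<le> exp (- 2 * pi)" by simp
    with e have "cmod q < 1" by linarith
    hence "ereal (cmod q) < 1" by simp
    from less_le_trans[OF this r] show "q \<in> eball 0 (fps_conv_radius F)" by simp
  qed
  hence "bounded (eval_fps F ` cball 0 (exp (- 2 * pi)))"
    by (intro compact_imp_bounded compact_continuous_image) auto
  then obtain B where B: "\<And>q. q \<in> cball 0 (exp (- 2 * pi)) \<Longrightarrow> cmod (eval_fps F q) \<le> B"
    unfolding bounded_iff by blast
  have "cmod (f z) \<le> B" if "Im z \<ge> 1" for z
  proof -
    have "qpar z \<in> cball 0 (exp (- 2 * pi))" using that by (simp add: dist_norm norm_qpar)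
    thus ?thesis using B f that by (auto simp: has_qexp_def)
  qed
  thus ?thesis by blast
qed

text \<open>\<open>qpar\<close> maps the segment from \<i> to 1 + \<i> onto the circle of radius exp
  (-2 pi), so the defining integral is Cauchy's formula for the n-th Taylor coefficient.\<close>

lemma fourier_coeff_has_qexp:
  assumes f: "has_qexp f F"
  shows "fourier_coeff f n = F $ n"
proof -
  have r: "fps_conv_radius F \<ge> 1" using f by (simp add: has_qexp_def)
  hence r0: "fps_conv_radius F > 0" by (rule less_le_trans[rotated]) simp
  have sub: "cball (0 :: complex) (exp (- 2 * pi)) \<subseteq> eball 0 (fps_conv_radius F)"
  proof
    fix q :: complex assume "q \<in> cball 0 (exp (- 2 * pi))"
    hence "cmod q \<le> exp (- 2 * pi)" by simp
    also have "exp (- 2 * pi) < (1 :: real)" by simp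
    finally have "ereal (cmod q) < 1" by simp
    from less_le_trans[OF this r] show "q \<in> eball 0 (fps_conv_radius F)" by simp
  qed
  have C: "((\<lambda>u. eval_fps F u / (u - 0) ^ Suc n) has_contour_integral
      ((2 * pi * \<i>) / fact n * (deriv ^^ n) (eval_fps F) 0)) (circlepath 0 (exp (- 2 * pi)))"
    using sub ball_subset_cball by (intro Cauchy_has_contour_integral_higher_derivative_circlepath
        continuous_on_subset[OF continuous_on_eval_fps] holomorphic_on_eval_fps) auto
  have q: "circlepath 0 (exp (- 2 * pi)) x = qpar (of_real x + \<i>)" for x
    by (simp add: circlepath qpar_def exp_of_real [symmetric] exp_add [symmetric] algebra_simps)
  have "((\<lambda>x. eval_fps F (qpar (of_real x + \<i>)) / qpar (of_real x + \<i>) ^ Suc n * (2 * pi * \<i> * qpar (of_real x + \<i>)))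
     has_integral (2 * pi * \<i>) * F $ n) {0..1}"
  proof -
    have vd: "vector_derivative (circlepath 0 (exp (- 2 * pi))) (at x) = 2 * pi * \<i> * qpar (of_real x + \<i>)" for x
      unfolding vector_derivative_circlepath q[symmetric] by (simp add: circlepath)
    have "(2 * pi * \<i>) / fact n * (deriv ^^ n) (eval_fps F) 0 = (2 * pi * \<i>) * F $ n"
      using fps_nth_conv_deriv[OF r0, of n] by simp
    thus ?thesis
      using C unfolding has_contour_integral vd q diff_zero by simp
  qed
  hence I: "((\<lambda>x. (1 / (2 * pi * \<i>)) * (eval_fps F (qpar (of_real x + \<i>)) / qpar (of_real x + \<i>) ^ Suc n * (2 * pi * \<i> * qpar (of_real x + \<i>))))
     has_integral (1 / (2 * pi * \<i>)) * ((2 * pi * \<i>) * F $ n)) {0..1}"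
    by (rule has_integral_mult_right)
  have eq: "(1 / (2 * pi * \<i>)) * (eval_fps F (qpar (of_real x + \<i>)) / qpar (of_real x + \<i>) ^ Suc n * (2 * pi * \<i> * qpar (of_real x + \<i>)))
       = f (of_real x + \<i>) * exp (- 2 * of_real pi * \<i> * of_nat n * (of_real x + \<i>))" for x
  proof -
    have "exp (- 2 * of_real pi * \<i> * of_nat n * (of_real x + \<i>)) = 1 / qpar (of_real x + \<i>) ^ n"
      by (simp add: qpar_def exp_of_nat_mult [symmetric] exp_minus [symmetric] inverse_eq_divide [symmetric] algebra_simps)
    moreover have "qpar (of_real x + \<i>) \<noteq> 0" by (simp add: qpar_def)
    ultimately show ?thesis
      using f by (simp add: has_qexp_def)
  qed
  have "((\<lambda>x. f (of_real x + \<i>) * exp (- 2 * of_real pi * \<i> * of_nat n * (of_real x + \<i>))) has_integral F $ n) {0..1}"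
    using I unfolding eq by simp
  thus ?thesis unfolding fourier_coeff_def by (rule integral_unique)
qed

lemma has_qexp_unique:
  assumes "has_qexp f F" "has_qexp g G" "\<And>z. Im z > 0 \<Longrightarrow> f z = g z"
  shows "F = G"
proof (rule fps_ext)
  fix n
  have "has_qexp g F" using assms(1,3) by (auto simp: has_qexp_def)
  thus "F $ n = G $ n" using assms(2) by (metis fourier_coeff_has_qexp)
qed

section \<open>Existence of q-expansions\<close>

lemma periodic_of_int:
  assumes per: "\<And>z. Im z > 0 \<Longrightarrow> f (z + 1) = f z" and z: "Im z > 0"
  shows "f (z + of_int k) = f z"
proof (induction k rule: int_induct[where k = 0])
  case (step1 i)
  thus ?case using per[of "z + of_int i"] z by (simp add: add_ac)
next
  case (step2 i)
  thus ?case using per[of "z + of_int (i - 1)"] z by (simp add: add_ac)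
qed auto

text \<open>By periodicity f factors through the punctured unit disc; boundedness near the cusp
  makes the singularity at 0 removable, and the Taylor series of the extension is the
  expansion.\<close>

lemma has_qexp_exists:
  assumes hol: "f holomorphic_on {z. Im z > 0}"
      and per: "\<And>z. Im z > 0 \<Longrightarrow> f (z + 1) = f z"
      and bdd: "\<And>z. Im z \<ge> 1 \<Longrightarrow> cmod (f z) \<le> B"
  shows "\<exists>F. has_qexp f F"
proof -
  define L where "L q = Ln q / (2 * of_real pi * \<i>)" for q
  define g where "g q = f (L q)" for q
  have qL: "qpar (L q) = q" if "q \<noteq> 0" for q using that by (simp add: qpar_def L_def)
  have ImL: "Im (L q) = - ln (cmod q) / (2 * pi)" if "q \<noteq> 0" for q
    using that by (simp add: L_def Im_divide power2_eq_square)
  have g: "g (qpar z) = f z" if "Im z > 0" for z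
  proof -
    have "qpar z \<noteq> 0" by (simp add: qpar_def)
    hence "qpar (L (qpar z)) = qpar z" by (rule qL)
    then obtain k :: int where "2 * of_real pi * \<i> * L (qpar z) = 2 * of_real pi * \<i> * z + of_int (2 * k) * pi * \<i>"
      by (auto simp: qpar_def exp_eq)
    hence "2 * of_real pi * \<i> * L (qpar z) = 2 * of_real pi * \<i> * (z + of_int k)"
      by (simp add: algebra_simps)
    hence "L (qpar z) = z + of_int k" by simp
    thus ?thesis using periodic_of_int[of f z k] per that by (simp add: g_def)
  qed
  have "\<exists>f'. (g has_field_derivative f') (at q0)" if q0: "q0 \<in> ball 0 1" "q0 \<noteq> 0" for q0
  proof -
    \<comment> \<open>A local branch of the logarithm around \<open>q0\<close>: the principal branch
      in \<open>L\<close> is discontinuous on the negative axis, whereas q / q0 stays near 1.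
      Periodicity makes the choice of branch irrelevant for f.\<close>
    define h where "h q = Ln (q / q0) / (2 * of_real pi * \<i>) + L q0" for q
    have L0: "Im (L q0) > 0" using q0 by (simp add: ImL divide_neg_pos)
    have h0: "h q0 = L q0" using q0 by (simp add: h_def)
    have hd: "(h has_field_derivative (1 / q0 / (2 * of_real pi * \<i>))) (at q0)"
      unfolding h_def using q0 by (auto intro!: derivative_eq_intros)
    have "f field_differentiable at (L q0)"
      using hol L0 by (auto intro: holomorphic_on_imp_differentiable_at open_upper_half_plane)
    then obtain D where "(f has_field_derivative D) (at (h q0))" by (auto simp: field_differentiable_def h0)
    hence "((\<lambda>q. f (h q)) has_field_derivative (D * (1 / q0 / (2 * of_real pi * \<i>)))) (at q0)"
      by (rule DERIV_chain2[OF _ hd])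
    moreover have ev: "eventually (\<lambda>q. f (h q) = g q) (nhds q0)"
    proof -
      have "isCont h q0" using hd by (rule DERIV_isCont)
      hence "eventually (\<lambda>q. h q \<in> {z. Im z > 0}) (nhds q0)"
        using L0 h0 by (intro topological_tendstoD[OF _ open_upper_half_plane])
          (auto simp: isCont_def tendsto_nhds_iff)
      moreover have "eventually (\<lambda>q. q \<in> - {0}) (nhds q0)"
        using q0 by (intro eventually_nhds_in_open) auto
      ultimately show ?thesis
      proof eventually_elim
        case (elim q)
        have "qpar (h q) = exp (Ln (q / q0)) * qpar (L q0)"
          unfolding qpar_def h_def by (simp add: exp_add [symmetric] algebra_simps)
        also have "\<dots> = q" using elim q0 by (simp add: qL)
        finally show ?case using g[of "h q"] elim by simp
      qed
    qed
    ultimately show ?thesis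
      using DERIV_cong_ev[OF refl ev refl] by blast
  qed
  hence hol': "g holomorphic_on ball 0 1 - {0}" by (subst holomorphic_on_open) auto
  have "eventually (\<lambda>q. cmod (g q) \<le> B) (at 0)"
  proof -
    have "eventually (\<lambda>q. q \<in> ball 0 (exp (- 2 * pi)) - {0}) (at (0 :: complex))"
      by (rule eventually_at_in_open) auto
    thus ?thesis
    proof eventually_elim
      case (elim q)
      hence "ln (cmod q) < ln (exp (- 2 * pi))" by (subst ln_less_cancel_iff) auto
      hence "Im (L q) \<ge> 1" using elim by (simp add: ImL field_simps)
      thus ?case using bdd by (simp add: g_def)
    qed
  qed
  hence "\<exists>G. G holomorphic_on ball 0 1 \<and> (\<forall>q\<in>ball 0 1 - {0}. G q = g q)"
    by (subst holomorphic_on_extend_bounded[OF hol']) auto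
  then obtain G where G: "G holomorphic_on ball 0 1" "\<And>q. q \<in> ball 0 1 - {0} \<Longrightarrow> G q = g q" by blast
  have e: "G holomorphic_on eball 0 1" using G(1) by (metis eball_ereal one_ereal_def)
  have "has_qexp f (fps_expansion G 0)"
    unfolding has_qexp_def
  proof (intro conjI allI impI)
    show "fps_conv_radius (fps_expansion G 0) \<ge> 1" by (rule conv_radius_fps_expansion[OF e])
    fix z assume z: "Im z > 0"
    have "cmod (qpar z) < 1" "qpar z \<noteq> 0" using norm_qpar_less_1[OF z] by (auto simp: qpar_def)
    thus "f z = eval_fps (fps_expansion G 0) (qpar z)"
      using eval_fps_expansion'[OF e, of "qpar z"] G(2)[of "qpar z"] g[OF z] by simp
  qed
  thus ?thesis by blast
qed

section \<open>Modular forms and their expansions\<close>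

text \<open>
  The weight is an integer, so that the weight \<open>w - 2\<close> of the second component of a depth one form is not truncated.
\<close>

definition mf :: "int \<Rightarrow> (complex \<Rightarrow> complex) \<Rightarrow> complex fps \<Rightarrow> bool" where
  "mf k f F \<longleftrightarrow> has_qexp f F \<and> (\<forall>z. Im z > 0 \<longrightarrow> f (- 1 / z) = z powi k * f z)"

lemma Im_S_pos: "Im z > 0 \<Longrightarrow> Im (- 1 / z) > 0"
  by (auto simp: Im_divide power2_eq_square sum_squares_gt_zero_iff divide_pos_pos)

lemma mf_qexp: "mf k f F \<Longrightarrow> has_qexp f F"
  by (simp add: mf_def)

lemma mf_S: "mf k f F \<Longrightarrow> Im z > 0 \<Longrightarrow> f (- 1 / z) = z powi k * f z"
  by (simp add: mf_def)

lemma mf_0: "mf k (\<lambda>_. 0) 0"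
  using has_qexp_const[of 0] by (simp add: mf_def)

lemma mf_const: "mf 0 (\<lambda>_. c) (fps_const c)"
  by (simp add: mf_def has_qexp_const)

lemma mf_add: "mf k f F \<Longrightarrow> mf k g G \<Longrightarrow> mf k (\<lambda>z. f z + g z) (F + G)"
  by (auto simp: mf_def has_qexp_add algebra_simps)

lemma mf_diff: "mf k f F \<Longrightarrow> mf k g G \<Longrightarrow> mf k (\<lambda>z. f z - g z) (F - G)"
  by (auto simp: mf_def has_qexp_diff algebra_simps)

lemma mf_mult: "mf k f F \<Longrightarrow> mf l g G \<Longrightarrow> mf (k + l) (\<lambda>z. f z * g z) (F * G)"
proof -
  have "z \<noteq> 0" if "Im z > 0" for z using that by auto
  thus "mf k f F \<Longrightarrow> mf l g G \<Longrightarrow> mf (k + l) (\<lambda>z. f z * g z) (F * G)"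
    by (auto simp: mf_def has_qexp_mult power_int_add)
qed

lemma mf_cmult: "mf k f F \<Longrightarrow> mf k (\<lambda>z. c * f z) (fps_const c * F)"
  using mf_mult[OF mf_const] by fastforce

lemma mf_power: "mf k f F \<Longrightarrow> mf (int n * k) (\<lambda>z. f z ^ n) (F ^ n)"
proof (induction n)
  case 0
  thus ?case using mf_const[of 1] by simp
next
  case (Suc n)
  have "mf (k + int n * k) (\<lambda>z. f z * f z ^ n) (F * F ^ n)" by (intro mf_mult Suc)
  thus ?case by (simp add: algebra_simps)
qed

lemma modform_imp_mf:
  assumes "modform k f"
  shows "\<exists>F. mf (int k) f F"
proof -
  have f: "f holomorphic_on {z. Im z > 0}" "\<And>z. Im z > 0 \<Longrightarrow> f (z + 1) = f z"
    using assms by (auto simp: modform_def)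
  moreover obtain B where B: "\<And>z. Im z \<ge> 1 \<Longrightarrow> cmod (f z) \<le> B"
    using assms by (auto simp: modform_def)
  ultimately obtain F where "has_qexp f F" using has_qexp_exists by blast
  thus ?thesis using assms by (auto simp: mf_def modform_def)
qed

text \<open>Mediates between \<open>modform\<close>, which prescribes the value 0 outside the upper
  half plane, and \<open>mf\<close>, which ignores the values there.\<close>

definition restrict_uhp :: "(complex \<Rightarrow> complex) \<Rightarrow> complex \<Rightarrow> complex" where
  "restrict_uhp f z = (if Im z > 0 then f z else 0)"

lemma mf_imp_modform:
  assumes "mf (int k) f F"
  shows "modform k (restrict_uhp f)"
proof -
  have "mf (int k) (restrict_uhp f) F"
    using assms Im_S_pos by (auto simp: mf_def has_qexp_def restrict_uhp_def)
  hence q: "has_qexp (restrict_uhp f) F" and S: "\<And>z. Im z > 0 \<Longrightarrow> restrict_uhp f (- 1 / z) = z ^ k * restrict_uhp f z"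
    by (auto simp: mf_def)
  show ?thesis unfolding modform_def
    using has_qexp_holomorphic[OF q] has_qexp_periodic[OF q] has_qexp_bounded[OF q] S
    by (auto simp: restrict_uhp_def)
qed

section \<open>Eisenstein series and the discriminant\<close>

definition P_fps :: "complex fps" where
  "P_fps = Abs_fps (\<lambda>n. if n = 0 then 1 else - 24 * of_nat (sigma_div 1 n))"

lemma sigma_div_1_0 [simp]: "sigma_div (Suc 0) 0 = 0"
  by (simp add: sigma_div_def)

lemma has_qexp_E2: "has_qexp E2 P_fps"
proof (rule has_qexpI)
  fix z assume z: "Im z > 0"
  from lambert_sums[OF norm_qpar_less_1[OF z]]
  have "summable (\<lambda>n. of_nat (sigma_div 1 (Suc n)) * qpar z ^ Suc n)" by (auto simp: sums_iff)
  hence "(\<lambda>n. - 24 * (of_nat (sigma_div 1 (Suc n)) * qpar z ^ Suc n)) sums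
     (- 24 * (\<Sum>n. of_nat (sigma_div 1 (Suc n)) * qpar z ^ Suc n))"
    by (intro sums_mult summable_sums)
  also have "- 24 * (\<Sum>n. of_nat (sigma_div 1 (Suc n)) * qpar z ^ Suc n) = E2 z - 1"
    by (simp add: E2_def)
  finally have "(\<lambda>n. P_fps $ Suc n * qpar z ^ Suc n) sums (E2 z - 1)"
    by (simp add: P_fps_def mult_ac)
  from sums_Suc[OF this] show "(\<lambda>n. P_fps $ n * qpar z ^ n) sums E2 z"
    by (simp add: P_fps_def)
qed

lemma DERIV_S_transform:
  assumes f: "has_qexp f F" and z: "Im z > 0"
  shows "((\<lambda>z. f (- 1 / z)) has_field_derivative 2 * of_real pi * \<i> * theta f (- 1 / z) / z ^ 2) (at z)"
proof -
  have z0: "z \<noteq> 0" using z by auto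
  have "((\<lambda>z. - 1 / z) has_field_derivative 1 / z ^ 2) (at z)"
    using z0 by (auto intro!: derivative_eq_intros simp: power2_eq_square)
  from DERIV_chain2[OF has_qexp_deriv[OF f Im_S_pos[OF z]] this] show ?thesis by simp
qed

lemma theta_S_transform:
  assumes f: "has_qexp f F" and z: "Im z > 0"
    and eq: "\<And>w. Im w > 0 \<Longrightarrow> f (- 1 / w) = g w" and g: "(g has_field_derivative g') (at z)"
  shows "theta f (- 1 / z) = z ^ 2 * g' / (2 * of_real pi * \<i>)"
proof -
  have z0: "z \<noteq> 0" using z by auto
  have "eventually (\<lambda>w. w \<in> {z. Im z > 0}) (nhds z)"
    using z by (intro eventually_nhds_in_open open_upper_half_plane) auto
  hence ev: "eventually (\<lambda>w. f (- 1 / w) = g w) (nhds z)"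
    by eventually_elim (use eq in simp)
  have "(g has_field_derivative 2 * of_real pi * \<i> * theta f (- 1 / z) / z ^ 2) (at z)"
    using DERIV_S_transform[OF f z] DERIV_cong_ev[OF refl ev refl] by blast
  from DERIV_unique[OF g this] show ?thesis using z0 by simp
qed

text \<open>Differentiating the law of f produces the extra term k / (2 pi \<i>) z^(k+1) f. The
  anomaly 6 / (pi \<i>) z of \<open>E2\<close>, multiplied by k / 12, is exactly the same and
  cancels it.\<close>

lemma mf_serre_derivative:
  assumes f: "mf k f F"
  shows "mf (k + 2) (\<lambda>z. theta f z - of_int k / 12 * (E2 z * f z)) (fps_theta F - fps_const (of_int k / 12) * (P_fps * F))"
proof -
  note q = mf_qexp[OF f]
  have "theta f (- 1 / z) - of_int k / 12 * (E2 (- 1 / z) * f (- 1 / z)) =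
      z powi (k + 2) * (theta f z - of_int k / 12 * (E2 z * f z))" if z: "Im z > 0" for z
  proof -
    have z0: "z \<noteq> 0" using z by auto
    have "((\<lambda>w. w powi k * f w) has_field_derivative
        (of_int k * z powi (k - 1) * f z + z powi k * (2 * of_real pi * \<i> * theta f z))) (at z)"
      using z0 by (auto intro!: derivative_eq_intros has_qexp_deriv[OF q z])
    from theta_S_transform[OF q z mf_S[OF f] this]
    have "theta f (- 1 / z) = z ^ 2 * (of_int k * z powi (k - 1) * f z + z powi k * (2 * of_real pi * \<i> * theta f z)) / (2 * of_real pi * \<i>)" .
    also have "z powi (k - 1) = z powi k / z" using z0 by (simp add: power_int_diff)
    also have "z ^ 2 * (of_int k * (z powi k / z) * f z + z powi k * (2 * of_real pi * \<i> * theta f z)) / (2 * of_real pi * \<i>)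
       = z powi k * (of_int k / (2 * of_real pi * \<i>) * z * f z + z ^ 2 * theta f z)"
      using z0 by (simp add: field_simps power2_eq_square)
    finally have t: "theta f (- 1 / z) = z powi k * (of_int k / (2 * of_real pi * \<i>) * z * f z + z ^ 2 * theta f z)" .
    have "z powi (k + 2) = z powi k * z ^ 2" using z0 by (simp add: power_int_add)
    thus ?thesis unfolding t mf_S[OF f z] E2_S_transform[OF z] using z0 by (simp add: field_simps)
  qed
  thus ?thesis unfolding mf_def
    by (intro conjI allI impI has_qexp_diff has_qexp_theta has_qexp_cmult has_qexp_mult has_qexp_E2 q)
qed

text \<open>Q and R are Ramanujan's identities for theta P and theta Q solved for the new series.
  Modularity thus reduces to the law of \<open>E2\<close>, and integrality of Q to that of
  P.\<close>

definition Q_fps :: "complex fps" where "Q_fps = P_fps ^ 2 - 12 * fps_theta P_fps"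
definition E4 :: "complex \<Rightarrow> complex" where "E4 z = E2 z ^ 2 - 12 * theta E2 z"
definition R_fps :: "complex fps" where "R_fps = P_fps * Q_fps - 3 * fps_theta Q_fps"
definition E6 :: "complex \<Rightarrow> complex" where "E6 z = E2 z * E4 z - 3 * theta E4 z"

text \<open>With anomaly cz, squaring \<open>E2\<close> yields the extra terms 2 c z^3 E2 + c^2 z^2;
  differentiating its law yields the same ones after multiplication by 12, since c = 12 / (2 pi
  \<i>).\<close>

lemma mf_E4: "mf 4 E4 Q_fps"
proof -
  have "has_qexp (\<lambda>z. E2 z ^ 2 - 12 * theta E2 z) (P_fps ^ 2 - fps_const 12 * fps_theta P_fps)"
    by (intro has_qexp_diff has_qexp_theta has_qexp_cmult has_qexp_power has_qexp_E2)
  hence "has_qexp E4 Q_fps" by (simp add: E4_def [abs_def] Q_fps_def numeral_fps_const)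
  moreover have "E4 (- 1 / z) = z powi 4 * E4 z" if z: "Im z > 0" for z
  proof -
    define c where "c = 6 / (of_real pi * \<i>)"
    have c: "12 / (2 * of_real pi * \<i>) = c" by (simp add: c_def)
    have "((\<lambda>w. w ^ 2 * E2 w + c * w) has_field_derivative
        (2 * z * E2 z + z ^ 2 * (2 * of_real pi * \<i> * theta E2 z) + c)) (at z)"
      by (auto intro!: derivative_eq_intros has_qexp_deriv[OF has_qexp_E2 z])
    from theta_S_transform[OF has_qexp_E2 z E2_S_transform this[unfolded c_def]]
    have t: "theta E2 (- 1 / z) = z ^ 2 * (2 * z * E2 z + z ^ 2 * (2 * of_real pi * \<i> * theta E2 z) + c) / (2 * of_real pi * \<i>)"
      by (simp add: c_def)
    have "12 * theta E2 (- 1 / z) = 12 / (2 * of_real pi * \<i>) * (z ^ 2 * (2 * z * E2 z + c)) + 12 * z ^ 4 * theta E2 z"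
      unfolding t by (simp add: field_simps power_numeral_reduce)
    also have "\<dots> = c * (z ^ 2 * (2 * z * E2 z + c)) + 12 * z ^ 4 * theta E2 z"
      unfolding c ..
    finally have t': "12 * theta E2 (- 1 / z) = \<dots>" .
    have "E4 (- 1 / z) = (z ^ 2 * E2 z + c * z) ^ 2 - 12 * theta E2 (- 1 / z)"
      unfolding E4_def E2_S_transform[OF z] c_def ..
    also have "\<dots> = z ^ 4 * E4 z"
      unfolding t' E4_def by (simp add: algebra_simps power_numeral_reduce power2_eq_square)
    finally show ?thesis by simp
  qed
  ultimately show ?thesis by (simp add: mf_def)
qed

lemma mf_E6: "mf 6 E6 R_fps"
proof -
  have "mf 6 (\<lambda>z. - 3 * (theta E4 z - of_int 4 / 12 * (E2 z * E4 z)))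
     (fps_const (-3) * (fps_theta Q_fps - fps_const (of_int 4 / 12) * (P_fps * Q_fps)))"
    using mf_cmult[OF mf_serre_derivative[OF mf_E4], of "-3"] by simp
  moreover have "(\<lambda>z. - 3 * (theta E4 z - of_int 4 / 12 * (E2 z * E4 z))) = E6"
    by (auto simp: E6_def algebra_simps)
  moreover have "fps_const (-3) * (fps_theta Q_fps - fps_const (of_int 4 / 12) * (P_fps * Q_fps)) = R_fps"
    by (rule fps_ext) (simp add: R_fps_def right_diff_distrib)
  ultimately show ?thesis by simp
qed

text \<open>
  Defining \<open>\<Delta>\<close> as the exponential of a power series makes it evidently zero-free, and its logarithmic
  derivative is \<open>P\<close>. The constant coefficient is \<open>0 / 0 = 0\<close>.
\<close>

definition lnDelta_fps :: "complex fps" where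
  "lnDelta_fps = Abs_fps (\<lambda>n. - 24 * of_nat (sigma_div 1 n) / of_nat n)"

lemma theta_lnDelta_fps: "fps_theta lnDelta_fps = P_fps - 1"
  by (rule fps_ext) (simp add: lnDelta_fps_def P_fps_def)

lemma conv_radius_lnDelta: "fps_conv_radius lnDelta_fps \<ge> 1"
proof -
  have "has_qexp (\<lambda>z. eval_fps lnDelta_fps (qpar z)) lnDelta_fps"
  proof (rule has_qexpI)
    fix z assume z: "Im z > 0"
    have "summable (\<lambda>n. norm (P_fps $ n * qpar z ^ n))"
      using has_qexp_E2 qpar_in_radius[OF _ z] by (intro norm_summable_fps) (auto simp: has_qexp_def)
    moreover have "norm (lnDelta_fps $ n * qpar z ^ n) \<le> norm (P_fps $ n * qpar z ^ n)" for n
    proof (cases "n = 0")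
      case False
      hence "real (sigma_div 1 n) / real n \<le> real (sigma_div 1 n)" by (simp add: divide_le_eq mult_le_cancel_left1)
      hence "24 * (real (sigma_div 1 n) / real n) * cmod (qpar z ^ n) \<le> 24 * real (sigma_div 1 n) * cmod (qpar z ^ n)"
        by (intro mult_right_mono) auto
      thus ?thesis using False
        by (simp add: lnDelta_fps_def P_fps_def norm_mult norm_divide)
    qed (simp add: lnDelta_fps_def)
    ultimately have "summable (\<lambda>n. lnDelta_fps $ n * qpar z ^ n)"
      by (rule summable_comparison_test'[of _ 0])
    thus "(\<lambda>n. lnDelta_fps $ n * qpar z ^ n) sums eval_fps lnDelta_fps (qpar z)"
      unfolding eval_fps_def by (rule summable_sums)
  qed
  thus ?thesis by (simp add: has_qexp_def)
qed

definition Delta :: "complex \<Rightarrow> complex" where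
  "Delta z = qpar z * exp (eval_fps lnDelta_fps (qpar z))"

definition Delta0_fps :: "complex fps" where
  "Delta0_fps = fps_expansion (\<lambda>q. exp (eval_fps lnDelta_fps q)) 0"

text \<open>The expansion of \<open>qpar z / Delta z\<close>; it supplies the division by powers of
  \<open>Delta\<close> in the order bound.\<close>

definition Delta0inv_fps :: "complex fps" where
  "Delta0inv_fps = fps_expansion (\<lambda>q. exp (- eval_fps lnDelta_fps q)) 0"

definition Delta_fps :: "complex fps" where
  "Delta_fps = fps_X * Delta0_fps"

lemma has_qexp_fps_expansion:
  assumes "g holomorphic_on eball 0 1"
  shows "has_qexp (\<lambda>z. g (qpar z)) (fps_expansion g 0)"
  unfolding has_qexp_def
proof (intro conjI allI impI)
  show "fps_conv_radius (fps_expansion g 0) \<ge> 1" by (rule conv_radius_fps_expansion[OF assms])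
  fix z assume "Im z > 0"
  thus "g (qpar z) = eval_fps (fps_expansion g 0) (qpar z)"
    using eval_fps_expansion'[OF assms, of "qpar z"] norm_qpar_less_1[of z] by simp
qed

lemma lnDelta_holomorphic: "eval_fps lnDelta_fps holomorphic_on eball 0 1"
  by (intro holomorphic_on_eval_fps eball_mono conv_radius_lnDelta)

lemma has_qexp_Delta0: "has_qexp (\<lambda>z. exp (eval_fps lnDelta_fps (qpar z))) Delta0_fps"
  unfolding Delta0_fps_def
  by (intro has_qexp_fps_expansion[of "\<lambda>q. exp (eval_fps lnDelta_fps q)"] holomorphic_intros lnDelta_holomorphic)

lemma has_qexp_Delta0inv: "has_qexp (\<lambda>z. exp (- eval_fps lnDelta_fps (qpar z))) Delta0inv_fps"
  unfolding Delta0inv_fps_def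
  by (intro has_qexp_fps_expansion[of "\<lambda>q. exp (- eval_fps lnDelta_fps q)"] holomorphic_intros lnDelta_holomorphic)

lemma has_qexp_qpar: "has_qexp qpar fps_X"
  by (simp add: has_qexp_def)

lemma has_qexp_Delta: "has_qexp Delta Delta_fps"
  unfolding Delta_def [abs_def] Delta_fps_def by (intro has_qexp_mult has_qexp_qpar has_qexp_Delta0)

lemma Delta_nonzero: "Delta z \<noteq> 0"
  by (simp add: Delta_def qpar_def)

lemma theta_Delta:
  assumes z: "Im z > 0"
  shows "theta Delta z = E2 z * Delta z"
proof -
  have l: "has_qexp (\<lambda>z. eval_fps lnDelta_fps (qpar z)) lnDelta_fps"
    using conv_radius_lnDelta by (simp add: has_qexp_def)
  have "theta (\<lambda>z. eval_fps lnDelta_fps (qpar z)) z = eval_fps (P_fps - 1) (qpar z)"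
    using has_qexp_theta[OF l] z by (simp add: has_qexp_def theta_lnDelta_fps)
  also have "\<dots> = E2 z - 1"
    using has_qexp_diff[OF has_qexp_E2 has_qexp_const[of 1]] z by (simp add: has_qexp_def)
  finally have th: "theta (\<lambda>z. eval_fps lnDelta_fps (qpar z)) z = E2 z - 1" .
  define l where "l z = eval_fps lnDelta_fps (qpar z)" for z
  have "(l has_field_derivative (2 * of_real pi * \<i> * (E2 z - 1))) (at z)"
    using has_qexp_deriv[OF l z] unfolding th l_def [abs_def] .
  from DERIV_mult[OF qpar_has_derivative DERIV_chain2[OF DERIV_exp this]]
  have "((\<lambda>z. qpar z * exp (l z)) has_field_derivative
      2 * of_real pi * \<i> * qpar z * exp (l z) + exp (l z) * (2 * of_real pi * \<i> * (E2 z - 1)) * qpar z) (at z)" .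
  also have "2 * of_real pi * \<i> * qpar z * exp (l z) + exp (l z) * (2 * of_real pi * \<i> * (E2 z - 1)) * qpar z =
      2 * of_real pi * \<i> * (E2 z * (qpar z * exp (l z)))"
    by (simp add: algebra_simps)
  finally have "((\<lambda>z. qpar z * exp (l z)) has_field_derivative (2 * of_real pi * \<i> * (E2 z * (qpar z * exp (l z))))) (at z)" .
  hence "(Delta has_field_derivative (2 * of_real pi * \<i> * (E2 z * Delta z))) (at z)"
    unfolding Delta_def [abs_def] l_def .
  from DERIV_imp_deriv[OF this] show ?thesis by (simp add: theta_def)
qed

lemma theta_Delta_fps: "fps_theta Delta_fps = P_fps * Delta_fps"
  by (rule has_qexp_unique[OF has_qexp_theta[OF has_qexp_Delta] has_qexp_mult[OF has_qexp_E2 has_qexp_Delta]])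
    (rule theta_Delta)

text \<open>Delta(-1/z) and z^12 Delta(z) have the same logarithmic derivative \<open>a\<close>,
  because the anomaly of \<open>E2\<close> contributes 12 / z. Their quotient is constant, and it is
  1 at the fixed point \<i> of S.\<close>

lemma mf_Delta: "mf 12 Delta Delta_fps"
proof -
  define h where "h z = Delta (- 1 / z) / (z ^ 12 * Delta z)" for z
  have "(h has_field_derivative 0) (at z)" if z: "Im z > 0" for z
  proof -
    have z0: "z \<noteq> 0" using z by auto
    define a where "a = 2 * of_real pi * \<i> * E2 z + 12 / z"
    have "((\<lambda>z. Delta (- 1 / z)) has_field_derivative
        2 * of_real pi * \<i> * (E2 (- 1 / z) * Delta (- 1 / z)) / z ^ 2) (at z)"
      using DERIV_S_transform[OF has_qexp_Delta z] theta_Delta[OF Im_S_pos[OF z]] by simp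
    also have "2 * of_real pi * \<i> * (E2 (- 1 / z) * Delta (- 1 / z)) / z ^ 2 = a * Delta (- 1 / z)"
      unfolding E2_S_transform[OF z] a_def using z0 by (simp add: field_simps power2_eq_square)
    finally have d1: "((\<lambda>z. Delta (- 1 / z)) has_field_derivative a * Delta (- 1 / z)) (at z)" .
    have "((\<lambda>z. z ^ 12 * Delta z) has_field_derivative
        (of_nat 12 * z ^ 11 * Delta z + z ^ 12 * (2 * of_real pi * \<i> * (E2 z * Delta z)))) (at z)"
      using has_qexp_deriv[OF has_qexp_Delta z] unfolding theta_Delta[OF z]
      by (auto intro!: derivative_eq_intros)
    also have "of_nat 12 * z ^ 11 * Delta z + z ^ 12 * (2 * of_real pi * \<i> * (E2 z * Delta z)) = a * (z ^ 12 * Delta z)"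
    proof -
      have "12 / z * z ^ 12 = 12 * z ^ 11" using z0 by (simp add: power_Suc [of z 11, simplified] del: power_Suc)
      hence "a * z ^ 12 = 2 * of_real pi * \<i> * E2 z * z ^ 12 + 12 * z ^ 11"
        by (simp add: a_def distrib_right)
      thus ?thesis by (simp add: mult.assoc [symmetric]) (simp add: algebra_simps)
    qed
    finally have d2: "((\<lambda>z. z ^ 12 * Delta z) has_field_derivative a * (z ^ 12 * Delta z)) (at z)" .
    have "z ^ 12 * Delta z \<noteq> 0" using z0 Delta_nonzero by simp
    from DERIV_divide[OF d1 d2 this] show ?thesis unfolding h_def [abs_def] by (simp add: mult_ac)
  qed
  hence "\<exists>c. \<forall>z\<in>{z. Im z > 0}. h z = c"
    by (intro has_field_derivative_zero_constant convex_halfspace_Im_gt)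
      (auto intro: has_field_derivative_at_within)
  then obtain c where c: "\<And>z. Im z > 0 \<Longrightarrow> h z = c" by auto
  have "\<i> ^ 12 = 1" using power_mult[of \<i> 2 6] by simp
  hence "h \<i> = 1" using Delta_nonzero by (simp add: h_def)
  with c[of \<i>] have "c = 1" by simp
  have "Delta (- 1 / z) = z ^ 12 * Delta z" if z: "Im z > 0" for z
  proof -
    have "z \<noteq> 0" using z by auto
    thus ?thesis using c[OF z] \<open>c = 1\<close> Delta_nonzero[of z] by (simp add: h_def divide_eq_eq)
  qed
  thus ?thesis unfolding mf_def using has_qexp_Delta by simp
qed

section \<open>Vanishing order at infinity\<close>

text \<open>A weak form of reduction to the fundamental domain. After translation to \<bar>Re
  w\<bar> \<le> 1/2, a point with Im w < 1/2 satisfies \<bar>w\<bar>^2 \<le> 1/2, so S at least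
  doubles the imaginary part; n counts the doublings still available.\<close>

lemma uhp_reduction:
  assumes T: "\<And>z. Im z > 0 \<Longrightarrow> f (z + 1) = f z" and S: "\<And>z. Im z > 0 \<Longrightarrow> f (- 1 / z) = f z"
  assumes "Im z > 0"
  shows "\<exists>w. Im w \<ge> 1 / 2 \<and> f w = f z"
proof -
  obtain n where n: "(1 / 2) ^ n < Im z" using assms(3) real_arch_pow_inv[of "Im z" "1/2"] by auto
  show ?thesis using assms(3) n
  proof (induction n arbitrary: z)
    case 0
    thus ?case by (intro exI[of _ z]) auto
  next
    case (Suc n)
    define w where "w = z + of_int (- round (Re z))"
    have w: "f w = f z" unfolding w_def by (rule periodic_of_int[of f z, OF T Suc.prems(1)])
    have Imw: "Im w = Im z" by (simp add: w_def)
    have "\<bar>Re w\<bar> \<le> 1 / 2" using of_int_round_abs_le[of "Re z"] by (simp add: w_def abs_minus_commute)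
    hence Re: "(Re w)\<^sup>2 \<le> (1 / 2)\<^sup>2" by (subst abs_le_square_iff [symmetric]) simp
    show ?case
    proof (cases "Im z \<ge> 1 / 2")
      case False
      have "(Im w)\<^sup>2 \<le> (1 / 2)\<^sup>2" using False Suc.prems(1) by (intro power_mono) (auto simp: Imw)
      with Re have le: "(Re w)\<^sup>2 + (Im w)\<^sup>2 \<le> 1 / 2" by (simp add: power2_eq_square)
      have pos: "(Re w)\<^sup>2 + (Im w)\<^sup>2 > 0" using Suc.prems(1) Imw by (simp add: sum_power2_gt_zero_iff)
      have "Im (- 1 / w) = Im z / ((Re w)\<^sup>2 + (Im w)\<^sup>2)"
        by (simp add: Im_divide Imw)
      also have "\<dots> \<ge> Im z / (1 / 2)"
        using le pos Suc.prems(1) by (intro divide_left_mono) auto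
      finally have ge: "Im (- 1 / w) \<ge> 2 * Im z" by simp
      have "\<exists>v. Im v \<ge> 1 / 2 \<and> f v = f (- 1 / w)"
        using ge Suc.prems by (intro Suc.IH) auto
      thus ?thesis using S[of w] Suc.prems(1) Imw w by auto
    qed auto
  qed
qed

text \<open>By \<open>uhp_reduction\<close> every value off q = 0 is attained in the compact disc of
  radius exp (-pi), that is Im \<ge> 1/2. Hence the modulus has an interior maximum on the open unit
  disc.\<close>

lemma mf_0_const:
  assumes g: "mf 0 g G" and z: "Im z > 0"
  shows "g z = G $ 0"
proof -
  note q = mf_qexp[OF g]
  have r: "fps_conv_radius G \<ge> 1" using q by (simp add: has_qexp_def)
  define K :: "complex set" where "K = cball 0 (exp (- pi))"
  have e1: "exp (- pi) < 1" by simp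
  have sub: "ball 0 1 \<subseteq> eball 0 (fps_conv_radius G)"
    using eball_mono[OF r, of 0] by (metis eball_ereal one_ereal_def)
  have hol: "eval_fps G holomorphic_on ball 0 1" by (rule holomorphic_on_eval_fps[OF sub])
  have Ksub: "K \<subseteq> ball 0 1"
  proof
    fix x assume "x \<in> K"
    hence "cmod x \<le> exp (- pi)" by (simp add: K_def)
    with e1 have "cmod x < 1" by linarith
    thus "x \<in> ball 0 1" by simp
  qed
  have "\<exists>p\<in>K. \<forall>x\<in>K. cmod (eval_fps G x) \<le> cmod (eval_fps G p)"
  proof (rule continuous_attains_sup)
    show "compact K" "K \<noteq> {}" by (auto simp: K_def)
    show "continuous_on K (\<lambda>x. cmod (eval_fps G x))"
      using continuous_on_subset[OF continuous_on_eval_fps] Ksub sub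
      by (intro continuous_on_norm) blast
  qed
  then obtain p where p: "p \<in> K" "\<And>x. x \<in> K \<Longrightarrow> cmod (eval_fps G x) \<le> cmod (eval_fps G p)" by blast
  have "eval_fps G constant_on ball 0 1"
  proof (rule maximum_modulus_principle[OF hol])
    show "p \<in> ball 0 1" using p Ksub by auto
    fix x :: complex assume x: "x \<in> ball 0 1"
    show "cmod (eval_fps G x) \<le> cmod (eval_fps G p)"
    proof (cases "x = 0")
      case True
      thus ?thesis using p(2)[of 0] by (simp add: K_def)
    next
      case False
      define w where "w = Ln x / (2 * of_real pi * \<i>)"
      have w: "qpar w = x" using False by (simp add: w_def qpar_def)
      have "Im w > 0" using False x by (simp add: w_def Im_divide power2_eq_square divide_neg_pos)
      then obtain v where v: "Im v \<ge> 1 / 2" "g v = g w"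
        using uhp_reduction[of g w] has_qexp_periodic[OF q] mf_S[OF g] by auto
      have "qpar v \<in> K" using v by (simp add: K_def norm_qpar)
      moreover have "eval_fps G (qpar v) = eval_fps G (qpar w)"
        using q v \<open>Im w > 0\<close> by (simp add: has_qexp_def)
      ultimately show ?thesis using p(2) w by metis
    qed
  qed auto
  then obtain c where c: "\<And>x. x \<in> ball 0 1 \<Longrightarrow> eval_fps G x = c" by (auto simp: constant_on_def)
  have "g z = eval_fps G (qpar z)" using q z by (simp add: has_qexp_def)
  also have "\<dots> = eval_fps G 0" using c norm_qpar_less_1[OF z] by simp
  finally show ?thesis by (simp add: eval_fps_at_0)
qed

lemma fps_split_order:
  fixes F :: "'a :: comm_ring_1 fps"
  assumes "\<And>i. i < r \<Longrightarrow> F $ i = 0"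
  shows "F = fps_X ^ r * fps_shift r F"
proof (rule fps_ext)
  fix n show "F $ n = (fps_X ^ r * fps_shift r F) $ n"
    using assms[of n] by (simp add: fps_X_power_mult_nth)
qed

text \<open>
  The quotient \<open>f\<^sup>1\<^sup>2 / \<Delta>\<^sup>k\<close> has weight 0, hence is constant, and vanishes at infinity.
\<close>

lemma mf_order_bound:
  assumes f: "mf (int k) f F" and r: "\<And>i. i < r \<Longrightarrow> F $ i = 0" and k: "k < 12 * r"
  shows "F = 0" and "Im z > 0 \<Longrightarrow> f z = 0"
proof -
  define F' where "F' = fps_shift r F"
  \<comment> \<open>f^12 has order at least 12r and Delta^k has order k; the exponent 12r - k is
    positive by assumption, which makes the constant term vanish.\<close>
  define G where "G = fps_X ^ (12 * r - k) * (F' ^ 12 * Delta0inv_fps ^ k)"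
  define g where "g z = f z ^ 12 / Delta z ^ k" for z
  have F: "F = fps_X ^ r * F'" unfolding F'_def by (rule fps_split_order[OF r])
  have FR: "fps_conv_radius F \<ge> 1" using f by (simp add: mf_def has_qexp_def)
  hence FR': "fps_conv_radius F' \<ge> 1" by (simp add: F'_def)
  define f' where "f' z = eval_fps F' (qpar z)" for z
  have qf': "has_qexp f' F'" using FR' by (simp add: has_qexp_def f'_def)
  have fz: "f z = qpar z ^ r * f' z" if "Im z > 0" for z
  proof -
    have "has_qexp (\<lambda>z. qpar z ^ r * f' z) F"
      unfolding F by (intro has_qexp_mult has_qexp_power has_qexp_qpar qf')
    thus ?thesis using that f by (simp add: mf_def has_qexp_def)
  qed
  have "has_qexp (\<lambda>z. qpar z ^ (12 * r - k) * (f' z ^ 12 * exp (- eval_fps lnDelta_fps (qpar z)) ^ k)) G"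
    unfolding G_def by (intro has_qexp_mult has_qexp_power has_qexp_qpar qf' has_qexp_Delta0inv)
  moreover have "qpar z ^ (12 * r - k) * (f' z ^ 12 * exp (- eval_fps lnDelta_fps (qpar z)) ^ k) = g z" if "Im z > 0" for z
  proof -
    have q0: "qpar z \<noteq> 0" by (simp add: qpar_def)
    have "qpar z ^ (12 * r) = qpar z ^ (12 * r - k) * qpar z ^ k" using k by (simp add: power_add [symmetric])
    thus ?thesis using q0 unfolding g_def fz[OF that] Delta_def
      by (simp add: power_mult_distrib power_mult [symmetric] exp_minus power_inverse mult.commute[of r] divide_inverse)
  qed
  ultimately have qg: "has_qexp g G" using has_qexp_cong by (metis (no_types, lifting))
  have "g (- 1 / z) = g z" if z: "Im z > 0" for z
  proof -
    have z0: "z \<noteq> 0" using z by auto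
    have "f (- 1 / z) = z ^ k * f z" "Delta (- 1 / z) = z ^ 12 * Delta z"
      using mf_S[OF f z] mf_S[OF mf_Delta z] by auto
    thus ?thesis using z0 by (simp add: g_def power_mult_distrib power_mult [symmetric] mult.commute[of 12])
  qed
  hence mg: "mf 0 g G" using qg by (simp add: mf_def)
  have G0: "G $ 0 = 0" unfolding G_def using k by simp
  have f0: "f z = 0" if "Im z > 0" for z
    using mf_0_const[OF mg that] G0 Delta_nonzero[of z] by (simp add: g_def)
  thus "Im z > 0 \<Longrightarrow> f z = 0" .
  show "F = 0"
    using has_qexp_unique[OF mf_qexp[OF f] has_qexp_const[of 0]] f0 by simp
qed

section \<open>Ramanujan's identities and the order bound for depth one\<close>

lemma P_fps_0 [simp]: "P_fps $ 0 = 1"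
  by (simp add: P_fps_def)

lemma sigma_div_1_1 [simp]: "sigma_div (Suc 0) (Suc 0) = 1"
  by (simp add: sigma_div_def)

lemma P_fps_1 [simp]: "P_fps $ Suc 0 = - 24"
  by (simp add: P_fps_def)

lemma fps_nth_1_mult: "(F * G) $ Suc 0 = F $ 0 * G $ Suc 0 + F $ Suc 0 * (G $ 0 :: 'a :: comm_ring_1)"
  by (simp add: fps_mult_nth)

lemma Q_fps_0 [simp]: "Q_fps $ 0 = 1"
  by (simp add: Q_fps_def power2_eq_square)

lemma Q_fps_1 [simp]: "Q_fps $ Suc 0 = 240"
  by (simp add: Q_fps_def power2_eq_square fps_nth_1_mult)

lemma R_fps_0 [simp]: "R_fps $ 0 = 1"
  by (simp add: R_fps_def)

lemma R_fps_1 [simp]: "R_fps $ Suc 0 = - 504"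
  by (simp add: R_fps_def fps_nth_1_mult)

lemma Delta0_fps_0 [simp]: "Delta0_fps $ 0 = 1"
  by (simp add: Delta0_fps_def fps_expansion_def eval_fps_at_0 lnDelta_fps_def)

lemma Delta_fps_0 [simp]: "Delta_fps $ 0 = 0"
  by (simp add: Delta_fps_def)

lemma Delta_fps_1 [simp]: "Delta_fps $ Suc 0 = 1"
  by (simp add: Delta_fps_def)

lemma ramanujan_P: "12 * fps_theta P_fps = P_fps ^ 2 - Q_fps"
  by (simp add: Q_fps_def)

lemma ramanujan_Q: "3 * fps_theta Q_fps = P_fps * Q_fps - R_fps"
  by (simp add: R_fps_def)

text \<open>The difference of the two sides is, via the Serre derivative of \<open>E6\<close>, a
  modular form of weight 8 < 12 with constant term 0.\<close>

lemma ramanujan_R: "2 * fps_theta R_fps = P_fps * R_fps - Q_fps ^ 2"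
proof -
  define F where "F = fps_const 2 * (fps_theta R_fps - fps_const (of_int 6 / 12) * (P_fps * R_fps)) + Q_fps ^ 2"
  define f where "f z = 2 * (theta E6 z - of_int 6 / 12 * (E2 z * E6 z)) + E4 z ^ 2" for z
  have "mf (6 + 2) (\<lambda>z. 2 * (theta E6 z - of_int 6 / 12 * (E2 z * E6 z)))
       (fps_const 2 * (fps_theta R_fps - fps_const (of_int 6 / 12) * (P_fps * R_fps)))"
    by (intro mf_cmult mf_serre_derivative mf_E6)
  moreover have "mf (int 2 * 4) (\<lambda>z. E4 z ^ 2) (Q_fps ^ 2)" by (intro mf_power mf_E4)
  ultimately have "mf (int 8) f F"
    unfolding f_def [abs_def] F_def using mf_add by force
  moreover have "F $ i = 0" if "i < 1" for i
    using that by (simp add: F_def power2_eq_square)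
  ultimately have "F = 0" using mf_order_bound(1)[of 8 f F 1] by simp
  moreover have "fps_const 2 * (fps_const (of_int 6 / 12) * (P_fps * R_fps)) = P_fps * R_fps"
    by (simp add: mult.assoc [symmetric])
  ultimately show ?thesis
    by (simp add: F_def right_diff_distrib numeral_fps_const algebra_simps)
qed

text \<open>Weight 12 requires two coefficients: the constant terms cancel, and 3 * 240 + 2 * 504 =
  1728.\<close>

lemma Q_cubed_minus_R_squared: "Q_fps ^ 3 - R_fps ^ 2 = 1728 * Delta_fps"
proof -
  define F where "F = Q_fps ^ 3 - R_fps ^ 2 - fps_const 1728 * Delta_fps"
  have "mf (int 3 * 4) (\<lambda>z. E4 z ^ 3) (Q_fps ^ 3)" "mf (int 2 * 6) (\<lambda>z. E6 z ^ 2) (R_fps ^ 2)"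
    by (intro mf_power mf_E4 mf_E6)+
  hence "mf (int 12) (\<lambda>z. E4 z ^ 3 - E6 z ^ 2 - 1728 * Delta z) F"
    unfolding F_def by (intro mf_diff mf_cmult) (use mf_Delta in auto)
  moreover have "F $ i = 0" if "i < 2" for i
  proof -
    have "i = 0 \<or> i = Suc 0" using that by auto
    thus ?thesis
      by (auto simp: F_def power2_eq_square power3_eq_cube fps_nth_1_mult)
  qed
  ultimately have "F = 0" using mf_order_bound(1)[of 12 _ F 2] by simp
  thus ?thesis by (simp add: F_def numeral_fps_const)
qed

section \<open>Quasimodular forms of depth at most one\<close>

definition qmf :: "int \<Rightarrow> (complex \<Rightarrow> complex) \<Rightarrow> complex fps \<Rightarrow> bool" where
  "qmf w f F \<longleftrightarrow> (\<exists>f0 F0 f1 F1. mf w f0 F0 \<and> mf (w - 2) f1 F1 \<and>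
     f = (\<lambda>z. f0 z + E2 z * f1 z) \<and> F = F0 + P_fps * F1)"

lemma qmfI:
  assumes "mf w f0 F0" "mf (w - 2) f1 F1"
  shows "qmf w (\<lambda>z. f0 z + E2 z * f1 z) (F0 + P_fps * F1)"
  using assms unfolding qmf_def by blast

lemma qmf_qexp: "qmf w f F \<Longrightarrow> has_qexp f F"
  by (auto simp: qmf_def mf_def intro!: has_qexp_add has_qexp_mult has_qexp_E2)

lemma mf_imp_qmf: "mf w f F \<Longrightarrow> qmf w f F"
  using qmfI[OF _ mf_0, of w f F] by simp

lemma qmf_mult_mf:
  assumes "qmf w f F" "mf k g G"
  shows "qmf (w + k) (\<lambda>z. f z * g z) (F * G)"
proof -
  obtain f0 F0 f1 F1 where *: "mf w f0 F0" "mf (w - 2) f1 F1" "f = (\<lambda>z. f0 z + E2 z * f1 z)" "F = F0 + P_fps * F1"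
    using assms(1) by (auto simp: qmf_def)
  have "mf (w - 2 + k) (\<lambda>z. f1 z * g z) (F1 * G)" by (intro mf_mult * assms)
  hence "mf (w + k - 2) (\<lambda>z. f1 z * g z) (F1 * G)" by (simp add: algebra_simps)
  from qmfI[OF mf_mult[OF *(1) assms(2)] this] show ?thesis
    by (simp add: * algebra_simps)
qed

lemma qmf_add:
  assumes "qmf w f F" "qmf w g G"
  shows "qmf w (\<lambda>z. f z + g z) (F + G)"
proof -
  obtain f0 F0 f1 F1 where *: "mf w f0 F0" "mf (w - 2) f1 F1" "f = (\<lambda>z. f0 z + E2 z * f1 z)" "F = F0 + P_fps * F1"
    using assms(1) by (auto simp: qmf_def)
  obtain g0 G0 g1 G1 where **: "mf w g0 G0" "mf (w - 2) g1 G1" "g = (\<lambda>z. g0 z + E2 z * g1 z)" "G = G0 + P_fps * G1"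
    using assms(2) by (auto simp: qmf_def)
  from qmfI[OF mf_add[OF *(1) **(1)] mf_add[OF *(2) **(2)]] show ?thesis
    by (simp add: * ** algebra_simps)
qed

lemma qmf_cmult:
  assumes "qmf w f F"
  shows "qmf w (\<lambda>z. c * f z) (fps_const c * F)"
  using qmf_mult_mf[OF assms mf_const[of c]] by (simp add: mult.commute)

lemma qmf_diff:
  assumes "qmf w f F" "qmf w g G"
  shows "qmf w (\<lambda>z. f z - g z) (F - G)"
  using qmf_add[OF assms(1) qmf_cmult[OF assms(2), of "-1"]] by (simp add: fps_const_neg [symmetric] del: fps_const_neg)

lemma qmf_sum:
  assumes "\<And>i. i \<in> A \<Longrightarrow> qmf w (f i) (F i)"
  shows "qmf w (\<lambda>z. \<Sum>i\<in>A. f i z) (\<Sum>i\<in>A. F i)"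
  using assms by (induction A rule: infinite_finite_induct) (auto intro: qmf_add mf_imp_qmf mf_0)

text \<open>Applying S to the relation reproduces it up to the anomaly of \<open>E2\<close>, which
  is a nonzero multiple of z f1(z); hence f1 vanishes.\<close>

lemma E2_not_quotient:
  assumes f0: "mf w f0 F0" and f1: "mf (w - 2) f1 F1"
      and 0: "\<And>z. Im z > 0 \<Longrightarrow> f0 z + E2 z * f1 z = 0" and z: "Im z > 0"
  shows "f0 z = 0" "f1 z = 0"
proof -
  have z0: "z \<noteq> 0" using z by auto
  have "z powi w = z powi (w - 2) * z ^ 2" using z0 by (simp add: power_int_diff)
  hence "0 = z powi (w - 2) * (z ^ 2 * (f0 z + E2 z * f1 z) + 6 / (of_real pi * \<i>) * z * f1 z)"
    using 0[OF Im_S_pos[OF z]] unfolding mf_S[OF f0 z] mf_S[OF f1 z] E2_S_transform[OF z]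
    by (simp add: algebra_simps)
  thus "f1 z = 0" using 0[OF z] z0 by simp
  with 0[OF z] show "f0 z = 0" by simp
qed

lemma fps_mult_nth_add:
  fixes F G :: "'a :: comm_ring_1 fps"
  assumes "\<And>i. i < a \<Longrightarrow> F $ i = 0" "\<And>i. i < b \<Longrightarrow> G $ i = 0"
  shows "(F * G) $ (a + b) = F $ a * G $ b" and "i < a + b \<Longrightarrow> (F * G) $ i = 0"
proof -
  have "F * G = (fps_X ^ a * fps_shift a F) * (fps_X ^ b * fps_shift b G)"
    using fps_split_order[OF assms(1)] fps_split_order[OF assms(2)] by simp
  also have "\<dots> = fps_X ^ (a + b) * (fps_shift a F * fps_shift b G)"
    by (simp add: power_add mult_ac)
  finally have *: "F * G = \<dots>" .
  show "(F * G) $ (a + b) = F $ a * G $ b" unfolding * by (simp add: fps_X_power_mult_nth)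
  show "i < a + b \<Longrightarrow> (F * G) $ i = 0" unfolding * by (simp add: fps_X_power_mult_nth)
qed

text \<open>
  The leading coefficient of the Wronskian is proportional to the difference of the orders of \<open>F\<close> and \<open>G\<close>,
  and \<open>F\<^sup>2\<close> only contributes to higher order.
\<close>

lemma fps_wronskian_nonzero:
  fixes F G :: "complex fps"
  assumes W: "12 * (F * fps_theta G - G * fps_theta F) + F ^ 2 = 0"
      and G: "G \<noteq> 0" and le: "\<And>i. i \<le> subdegree G \<Longrightarrow> F $ i = 0"
  shows "F = 0"
proof (rule ccontr)
  assume F: "F \<noteq> 0"
  define a b where "a = subdegree F" and "b = subdegree G"
  have ab: "b < a" using le[of a] F by (auto simp: a_def b_def not_less [symmetric])
  have z: "\<And>i. i < a \<Longrightarrow> F $ i = 0" "\<And>i. i < b \<Longrightarrow> G $ i = 0"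
    by (auto simp: a_def b_def)
  have zt: "\<And>i. i < a \<Longrightarrow> fps_theta F $ i = 0" "\<And>i. i < b \<Longrightarrow> fps_theta G $ i = 0"
    using z by auto
  have "(F * fps_theta G) $ (a + b) = F $ a * fps_theta G $ b"
       "(G * fps_theta F) $ (b + a) = G $ b * fps_theta F $ a"
    by (rule fps_mult_nth_add(1); use z zt in blast)+
  moreover have "(F * F) $ (a + b) = 0"
    by (rule fps_mult_nth_add(2)[of a F a F]) (use z ab in auto)
  ultimately have "(12 * (F * fps_theta G - G * fps_theta F) + F ^ 2) $ (a + b) =
      12 * (F $ a * (of_nat b * G $ b) - G $ b * (of_nat a * F $ a)) + 0"
    by (simp add: power2_eq_square add.commute[of b a])
  also have "\<dots> = 12 * F $ a * G $ b * (of_nat b - of_nat a)" by (simp add: algebra_simps)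
  finally have "12 * F $ a * G $ b * (of_nat b - of_nat a) = 0" unfolding W by simp
  moreover have "F $ a \<noteq> 0" "G $ b \<noteq> 0" using F G by (auto simp: a_def b_def)
  ultimately show False using ab by simp
qed

text \<open>The Wronskian expression W has weight 2w < 12 (n + 1) and vanishes through order n, so W
  = 0. To conclude F = 0 from this, F must have larger order than F1; the order bound for the
  modular form f1 gives b \<le> n.\<close>

lemma qmf_order_bound:
  assumes f0: "mf (int w) f0 F0" and f1: "mf (int w - 2) f1 F1" and w: "w \<ge> 2"
      and n: "w < 6 * Suc n" and van: "\<And>i. i \<le> n \<Longrightarrow> (F0 + P_fps * F1) $ i = 0" and z: "Im z > 0"
  shows "f0 z = 0" "f1 z = 0"
proof -
  define F where "F = F0 + P_fps * F1"
  have "F = 0"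
  proof (cases "F1 = 0")
    case True
    have "F0 $ i = 0" if "i < Suc n" for i using van[of i] that True by simp
    hence "F0 = 0" by (rule mf_order_bound(1)[OF f0, of "Suc n"]) (use n in simp_all)
    thus ?thesis using True by (simp add: F_def)
  next
    case False
    define b where "b = subdegree F1"
    have f1': "mf (int (w - 2)) f1 F1" using f1 w by (simp add: of_nat_diff)
    have "\<not> w - 2 < 12 * b"
    proof
      assume "w - 2 < 12 * b"
      moreover have "F1 $ i = 0" if "i < b" for i using that unfolding b_def by (rule nth_less_subdegree_zero)
      ultimately have "F1 = 0" using mf_order_bound(1)[OF f1'] by blast
      with False show False by simp
    qed
    hence bn: "b \<le> n" using n by simp
    define e :: "complex fps" where "e = fps_const (1 / 12)"
    have e: "12 * e = 1" by (simp add: e_def numeral_fps_const)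
    define k where "k = (of_int (int w) :: complex fps)"
    \<comment> \<open>Serre derivatives in place of \<open>fps_theta\<close> exhibit W as a modular
      form; \<open>W2\<close> then identifies it with the expression in F and F1 alone.\<close>
    define W where "W = 12 * (F0 * (fps_theta F1 - (k - 2) * e * (P_fps * F1)) - F1 * (fps_theta F0 - k * e * (P_fps * F0)))
        + Q_fps * F1 ^ 2 + F0 ^ 2"
    define S0 S1 where "S0 = fps_theta F0 - fps_const (of_int (int w) / 12) * (P_fps * F0)"
      and "S1 = fps_theta F1 - fps_const (of_int (int w - 2) / 12) * (P_fps * F1)"
    have k1: "fps_const (of_int (int w) / 12) = k * e" "fps_const (of_int (int w - 2) / 12) = (k - 2) * e"
      by (simp_all add: k_def e_def fps_of_int [symmetric] numeral_fps_const)
    obtain s0 s1 where s: "mf (int w + 2) s0 S0" "mf (int w - 2 + 2) s1 S1"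
      using mf_serre_derivative[OF f0] mf_serre_derivative[OF f1] unfolding S0_def S1_def by blast
    define g where "g z = 12 * (f0 z * s1 z - f1 z * s0 z) + E4 z * f1 z ^ 2 + f0 z ^ 2" for z
    have "mf (int (2 * w)) g W"
    proof -
      have "mf (int w + (int w - 2 + 2)) (\<lambda>z. f0 z * s1 z) (F0 * S1)" by (intro mf_mult f0 s)
      moreover have "mf (int w - 2 + (int w + 2)) (\<lambda>z. f1 z * s0 z) (F1 * S0)" by (intro mf_mult f1 s)
      moreover have "mf (4 + int 2 * (int w - 2)) (\<lambda>z. E4 z * f1 z ^ 2) (Q_fps * F1 ^ 2)" by (intro mf_mult mf_power f1 mf_E4)
      moreover have "mf (int 2 * int w) (\<lambda>z. f0 z ^ 2) (F0 ^ 2)" by (intro mf_power f0)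
      ultimately have "mf (int (2 * w)) g (fps_const 12 * (F0 * S1 - F1 * S0) + Q_fps * F1 ^ 2 + F0 ^ 2)"
        unfolding g_def [abs_def] by (intro mf_add mf_cmult mf_diff) (simp_all add: algebra_simps)
      thus ?thesis by (simp only: W_def S0_def S1_def k1 numeral_fps_const)
    qed
    have W2: "W = 12 * (F * fps_theta F1 - F1 * fps_theta F) + F ^ 2"
    proof -
      have "12 * (F * fps_theta F1 - F1 * fps_theta F) = 12 * (F0 * fps_theta F1 - F1 * fps_theta F0) - F1 ^ 2 * (12 * fps_theta P_fps)"
        by (simp add: F_def fps_theta_mult algebra_simps power2_eq_square)
      also have "12 * fps_theta P_fps = P_fps ^ 2 - Q_fps" by (rule ramanujan_P)
      finally have 1: "12 * (F * fps_theta F1 - F1 * fps_theta F) + F ^ 2 =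
         12 * (F0 * fps_theta F1 - F1 * fps_theta F0) + 2 * (P_fps * F0 * F1) + Q_fps * F1 ^ 2 + F0 ^ 2"
        by (simp add: F_def algebra_simps power2_eq_square)
      have "W = 12 * (F0 * fps_theta F1 - F1 * fps_theta F0) + (12 * e) * (2 * (P_fps * F0 * F1)) + Q_fps * F1 ^ 2 + F0 ^ 2"
        unfolding W_def by (simp add: algebra_simps)
      with 1 show ?thesis by (simp add: e)
    qed
    have Fn: "F $ i = 0" if "i < Suc n" for i using van that by (simp add: F_def)
    have "W $ i = 0" if "i < Suc n" for i
    proof -
      have "fps_theta F $ j = 0" if "j < Suc n" for j using Fn[OF that] by simp
      thus ?thesis unfolding W2 power2_eq_square
        using fps_mult_nth_add(2)[of "Suc n" F 0 "fps_theta F1" i] fps_mult_nth_add(2)[of "Suc n" F 0 F i]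
          fps_mult_nth_add(2)[of 0 F1 "Suc n" "fps_theta F" i] Fn that by simp
    qed
    from mf_order_bound(1)[OF \<open>mf (int (2 * w)) g W\<close> this, of "Suc n"] n have "W = 0" by simp
    thus "F = 0" using W2 False Fn bn
      by (intro fps_wronskian_nonzero[of F F1]) (auto simp: b_def)
  qed
  have "has_qexp (\<lambda>z. f0 z + E2 z * f1 z) F"
    unfolding F_def by (intro has_qexp_add has_qexp_mult has_qexp_E2 mf_qexp[OF f0] mf_qexp[OF f1])
  hence 0: "\<And>z. Im z > 0 \<Longrightarrow> f0 z + E2 z * f1 z = 0"
    using \<open>F = 0\<close> by (simp add: has_qexp_def)
  show "f0 z = 0" by (rule E2_not_quotient(1)[OF f0 f1 0 z])
  show "f1 z = 0" by (rule E2_not_quotient(2)[OF f0 f1 0 z])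
qed

section \<open>Characterisation of the extremal forms\<close>

lemma has_qexp_restrict: "has_qexp (restrict_uhp f) F = has_qexp f F"
  by (rule has_qexp_cong) (simp add: restrict_uhp_def)

lemma has_qexp_sum:
  assumes "\<And>i. i \<in> A \<Longrightarrow> has_qexp (f i) (F i)"
  shows "has_qexp (\<lambda>z. \<Sum>i\<in>A. f i z) (\<Sum>i\<in>A. F i)"
  using assms has_qexp_const[of 0]
  by (induction A rule: infinite_finite_induct) (auto intro: has_qexp_add)

lemma qm_decomp_restrict:
  assumes "mf (int w) f0 F0" "mf (int w - 2) f1 F1" "w \<ge> 2"
  shows "qm_decomp w (restrict_uhp (\<lambda>z. f0 z + E2 z * f1 z)) (restrict_uhp f0) (restrict_uhp f1)"
proof -
  have "mf (int (w - 2)) f1 F1" using assms(2,3) by (simp add: of_nat_diff)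
  with assms(1) show ?thesis
    unfolding qm_decomp_def by (auto intro!: mf_imp_modform simp: restrict_uhp_def fun_eq_iff)
qed

lemma qm_decomp_imp_mf:
  assumes "qm_decomp w f f0 f1" "w \<ge> 2"
  obtains F0 F1 where "mf (int w) f0 F0" "mf (int w - 2) f1 F1" "f = (\<lambda>z. f0 z + E2 z * f1 z)"
    "f = restrict_uhp f" "qmf (int w) f (F0 + P_fps * F1)"
proof -
  have m: "modform w f0" "modform (w - 2) f1" and f: "f = (\<lambda>z. f0 z + E2 z * f1 z)"
    using assms(1) by (auto simp: qm_decomp_def)
  obtain F0 F1 where F: "mf (int w) f0 F0" "mf (int (w - 2)) f1 F1"
    using modform_imp_mf[OF m(1)] modform_imp_mf[OF m(2)] by blast
  hence F1: "mf (int w - 2) f1 F1" using assms(2) by (simp add: of_nat_diff)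
  have "f = restrict_uhp f" using m unfolding f by (auto simp: modform_def restrict_uhp_def fun_eq_iff)
  thus ?thesis using that F(1) F1 f qmfI[OF F(1) F1] by blast
qed

lemma QM1_eq: "w \<ge> 2 \<Longrightarrow> QM1 w = {f. f = restrict_uhp f \<and> (\<exists>F. qmf (int w) f F)}"
proof (intro equalityI subsetI)
  fix f assume w: "w \<ge> 2" and "f \<in> QM1 w"
  thus "f \<in> {f. f = restrict_uhp f \<and> (\<exists>F. qmf (int w) f F)}"
    unfolding QM1_def using qm_decomp_imp_mf[OF _ w] by blast
next
  fix f assume w: "w \<ge> 2" and "f \<in> {f. f = restrict_uhp f \<and> (\<exists>F. qmf (int w) f F)}"
  then obtain F where f: "f = restrict_uhp f" "qmf (int w) f F" by auto
  then obtain f0 F0 f1 F1 where "mf (int w) f0 F0" "mf (int w - 2) f1 F1" "f = (\<lambda>z. f0 z + E2 z * f1 z)"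
    by (auto simp: qmf_def)
  thus "f \<in> QM1 w" using qm_decomp_restrict[of w f0 F0 f1 F1] w f(1) unfolding QM1_def by auto
qed

lemma qmf_eq_0:
  assumes f: "qmf (int w) f F" and w: "w \<ge> 2" "w < 6 * Suc n" and van: "\<And>i. i \<le> n \<Longrightarrow> F $ i = 0" and z: "Im z > 0"
  shows "f z = 0"
proof -
  obtain f0 F0 f1 F1 where *: "mf (int w) f0 F0" "mf (int w - 2) f1 F1" "f = (\<lambda>z. f0 z + E2 z * f1 z)" "F = F0 + P_fps * F1"
    using f by (auto simp: qmf_def)
  show ?thesis
    using qmf_order_bound[OF *(1,2) w van[unfolded *(4)] z] by (simp add: *(3))
qed

interpretation cfun: vector_space "\<lambda>(c :: complex) (f :: complex \<Rightarrow> complex) z. c * f z"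
  by unfold_locales (auto simp: fun_eq_iff algebra_simps)

lemma sum_fun_apply: "(\<Sum>i\<in>A. f i) z = (\<Sum>i\<in>A. f i z :: complex)"
  by (induction A rule: infinite_finite_induct) auto

text \<open>Gaussian elimination on a family in echelon form: for fixed j the coefficients after the
  j-th are cleared one at a time, and the inner induction on r counts those already cleared.\<close>

lemma qmf_dual_basis:
  assumes fam: "\<And>j. j \<le> n \<Longrightarrow> \<exists>f F. qmf w f F \<and> (\<forall>i<j. F $ i = 0) \<and> F $ j = 1"
  shows "\<exists>e E. \<forall>j\<le>n. qmf w (e j) (E j) \<and> (\<forall>i\<le>n. E j $ i = (if i = j then 1 else 0))"
proof -
  have "\<exists>f F. qmf w f F \<and> (\<forall>i\<le>n. F $ i = (if i = j then 1 else 0))" if j: "j \<le> n" for j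
  proof -
    have "\<exists>f F. qmf w f F \<and> (\<forall>i. i < j + Suc r \<and> i \<le> n \<longrightarrow> F $ i = (if i = j then 1 else 0))" for r
    proof (induction r)
      case 0
      from fam[OF j] obtain f F where "qmf w f F" "\<forall>i<j. F $ i = 0" "F $ j = 1" by blast
      thus ?case by (intro exI[of _ f] exI[of _ F]) (auto simp: less_Suc_eq)
    next
      case (Suc r)
      then obtain f F where f: "qmf w f F" "\<And>i. i < j + Suc r \<Longrightarrow> i \<le> n \<Longrightarrow> F $ i = (if i = j then 1 else 0)" by blast
      show ?case
      proof (cases "j + Suc r \<le> n")
        case True
        from fam[OF this] obtain g G where g: "qmf w g G" "\<forall>i<j + Suc r. G $ i = 0" "G $ (j + Suc r) = 1" by blast
        define c where "c = F $ (j + Suc r)"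
        have "qmf w (\<lambda>z. f z - c * g z) (F - fps_const c * G)" by (intro qmf_diff qmf_cmult f g)
        moreover have "(F - fps_const c * G) $ i = (if i = j then 1 else 0)" if "i < j + Suc (Suc r)" "i \<le> n" for i
        proof (cases "i = j + Suc r")
          case True
          thus ?thesis using g by (simp add: c_def)
        next
          case False
          thus ?thesis using that g f(2)[of i] by simp
        qed
        ultimately show ?thesis by blast
      next
        case False
        thus ?thesis using f by (intro exI[of _ f] exI[of _ F]) auto
      qed
    qed
    from this[of n] show ?thesis by (metis add_Suc_right le_imp_less_Suc trans_le_add2)
  qed
  thus ?thesis by metis
qed

text \<open>The coefficients 0, ..., n are coordinates: the dual basis realises them independently,
  and a form on which all of them vanish is 0 by the order bound.\<close>

lemma qm_dim_eq:
  assumes w: "w \<ge> 2" "w < 6 * Suc n"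
    and fam: "\<And>j. j \<le> n \<Longrightarrow> \<exists>f F. qmf (int w) f F \<and> (\<forall>i<j. F $ i = 0) \<and> F $ j = 1"
  shows "qm_dim w = Suc n"
proof -
  obtain e E where eE: "\<forall>j\<le>n. qmf (int w) (e j) (E j) \<and> (\<forall>i\<le>n. E j $ i = (if i = j then 1 else 0))"
    using qmf_dual_basis[of n "int w"] fam by metis
  have e: "\<And>j. j \<le> n \<Longrightarrow> qmf (int w) (e j) (E j)"
    and E: "\<And>i j. j \<le> n \<Longrightarrow> i \<le> n \<Longrightarrow> E j $ i = (if i = j then 1 else 0)"
    using eE by simp_all
  define b where "b j = restrict_uhp (e j)" for j
  have bq: "has_qexp (b j) (E j)" if "j \<le> n" for j
    using qmf_qexp[OF e[OF that]] by (simp add: b_def has_qexp_restrict)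
  have bQM: "b j \<in> QM1 w" if j: "j \<le> n" for j
  proof -
    obtain f0 F0 f1 F1 where *: "mf (int w) f0 F0" "mf (int w - 2) f1 F1" "e j = (\<lambda>z. f0 z + E2 z * f1 z)"
      using e[OF j] by (auto simp: qmf_def)
    show ?thesis using qm_decomp_restrict[OF *(1,2) w(1)] unfolding QM1_def b_def *(3) by blast
  qed
  have comb: "fourier_coeff (\<lambda>z. \<Sum>j\<le>n. u j * b j z) i = u i" if "i \<le> n" for u i
  proof -
    have "has_qexp (\<lambda>z. \<Sum>j\<le>n. u j * b j z) (\<Sum>j\<le>n. fps_const (u j) * E j)"
      by (intro has_qexp_sum has_qexp_cmult bq) auto
    hence "fourier_coeff (\<lambda>z. \<Sum>j\<le>n. u j * b j z) i = (\<Sum>j\<le>n. fps_const (u j) * E j) $ i"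
      by (rule fourier_coeff_has_qexp)
    also have "\<dots> = (\<Sum>j\<le>n. if i = j then u j else 0)"
      unfolding fps_sum_nth by (intro sum.cong) (use that in \<open>auto simp: E\<close>)
    also have "\<dots> = u i" using that by simp
    finally show ?thesis .
  qed
  have inj: "inj_on b {..n}"
  proof (rule inj_onI)
    fix i j assume ij: "i \<in> {..n}" "j \<in> {..n}" "b i = b j"
    have "E i $ i = E j $ i"
      using fourier_coeff_has_qexp[OF bq[of i], of i] fourier_coeff_has_qexp[OF bq[of j], of i] ij by simp
    thus "i = j" using ij E by (auto split: if_splits)
  qed
  have "cfun.dim (QM1 w) = Suc n"
  proof (rule cfun.dim_unique)
    show "b ` {..n} \<subseteq> QM1 w" using bQM by auto
    show "card (b ` {..n}) = Suc n" using card_image[OF inj] by simp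
    show "cfun.independent (b ` {..n})"
    proof (subst cfun.dependent_finite, simp, safe)
      fix u i assume i: "u (b i) \<noteq> 0" "i \<le> n" and s: "(\<Sum>v\<in>b ` {..n}. (\<lambda>z. u v * v z)) = 0"
      have "(\<Sum>j\<le>n. (\<lambda>z. u (b j) * b j z)) = 0"
        using s by (subst (asm) sum.reindex[OF inj]) (simp add: o_def)
      hence "(\<lambda>z. \<Sum>j\<le>n. u (b j) * b j z) = (\<lambda>_. 0)"
        by (auto simp: fun_eq_iff sum_fun_apply zero_fun_def)
      hence "u (b i) = fourier_coeff (\<lambda>_. 0) i" using comb[OF i(2), of "\<lambda>j. u (b j)"] by simp
      also have "\<dots> = 0" using fourier_coeff_has_qexp[OF has_qexp_const[of 0], of i] by simp
      finally show False using i by simp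
    qed
    show "QM1 w \<subseteq> cfun.span (b ` {..n})"
    proof
      fix f assume "f \<in> QM1 w"
      then obtain F where f: "f = restrict_uhp f" "qmf (int w) f F" using QM1_eq[OF w(1)] by auto
      have d: "qmf (int w) (\<lambda>z. f z - (\<Sum>j\<le>n. F $ j * e j z)) (F - (\<Sum>j\<le>n. fps_const (F $ j) * E j))"
        by (intro qmf_diff qmf_sum qmf_cmult f e) auto
      have "(\<Sum>j\<le>n. fps_const (F $ j) * E j) $ i = F $ i" if "i \<le> n" for i
      proof -
        have "(\<Sum>j\<le>n. fps_const (F $ j) * E j) $ i = (\<Sum>j\<le>n. if i = j then F $ j else 0)"
          unfolding fps_sum_nth by (intro sum.cong) (use that in \<open>auto simp: E\<close>)
        thus ?thesis using that by simp
      qed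
      hence "f z - (\<Sum>j\<le>n. F $ j * e j z) = 0" if "Im z > 0" for z
        using qmf_eq_0[OF d w _ that] by simp
      hence "f = (\<Sum>j\<le>n. (\<lambda>z. F $ j * b j z))"
        by (subst f(1)) (auto simp: fun_eq_iff sum_fun_apply b_def restrict_uhp_def)
      also have "\<dots> \<in> cfun.span (b ` {..n})"
        by (intro cfun.span_sum cfun.span_scale cfun.span_base) auto
      finally show "f \<in> cfun.span (b ` {..n})" .
    qed
  qed
  thus ?thesis by (simp add: qm_dim_def)
qed

text \<open>The candidate itself completes the family at j = n. The last assumption guarantees f1
  \<noteq> 0: a modular form of weight w < 12n cannot have order n, and in weight 2 the
  decomposition is known outright.\<close>

lemma G1_eqI:
  assumes w: "w \<ge> 2" "w < 6 * Suc n"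
    and fam: "\<And>j. j < n \<Longrightarrow> \<exists>f F. qmf (int w) f F \<and> (\<forall>i<j. F $ i = 0) \<and> F $ j = 1"
    and g: "mf (int w) g0 K0" "mf (int w - 2) g1 K1"
    and G: "G = K0 + P_fps * K1" "\<And>i. i < n \<Longrightarrow> G $ i = 0" "G $ n = 1" and nz: "w < 12 * n \<or> (w = 2 \<and> K0 = 0)"
  shows "has_qexp (G1 w) G"
proof -
  define g where "g = restrict_uhp (\<lambda>z. g0 z + E2 z * g1 z)"
  have qg: "qmf (int w) (\<lambda>z. g0 z + E2 z * g1 z) G" unfolding G(1) using qmfI[OF g] .
  have gq: "has_qexp g G" unfolding g_def has_qexp_restrict by (rule qmf_qexp[OF qg])
  have dim: "qm_dim w - 1 = n"
  proof -
    have "\<exists>f F. qmf (int w) f F \<and> (\<forall>i<j. F $ i = 0) \<and> F $ j = 1" if "j \<le> n" for j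
      using fam[of j] qg G(2,3) that by (cases "j = n") (blast, simp)
    thus ?thesis using qm_dim_eq[OF w] by simp
  qed
  have "(\<exists>f0 f1. qm_decomp w f f0 f1 \<and> f1 \<noteq> (\<lambda>_. 0)) \<and> (\<forall>i < n. fourier_coeff f i = 0) \<and> fourier_coeff f n = 1
      \<longleftrightarrow> f = g" for f
  proof
    assume "f = g"
    have "restrict_uhp g1 \<noteq> (\<lambda>_. 0)"
    proof
      assume "restrict_uhp g1 = (\<lambda>_. 0)"
      hence "g1 z = 0" if "Im z > 0" for z using that by (metis restrict_uhp_def)
      hence "K1 = 0" using has_qexp_unique[OF mf_qexp[OF g(2)] has_qexp_const[of 0]] by simp
      hence GG: "G = K0" using G by simp
      show False
      proof (cases "w < 12 * n")
        case True
        from mf_order_bound(1)[OF g(1) G(2)[unfolded GG] True] have "K0 = 0" .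
        thus False using GG G(3) by simp
      next
        case False
        thus False using nz GG G(3) by auto
      qed
    qed
    thus "(\<exists>f0 f1. qm_decomp w f f0 f1 \<and> f1 \<noteq> (\<lambda>_. 0)) \<and> (\<forall>i < n. fourier_coeff f i = 0) \<and> fourier_coeff f n = 1"
      using qm_decomp_restrict[OF g w(1)] G(2,3) fourier_coeff_has_qexp[OF gq] unfolding \<open>f = g\<close> g_def by auto
  next
    assume f: "(\<exists>f0 f1. qm_decomp w f f0 f1 \<and> f1 \<noteq> (\<lambda>_. 0)) \<and> (\<forall>i < n. fourier_coeff f i = 0) \<and> fourier_coeff f n = 1"
    then obtain f0 f1 where "qm_decomp w f f0 f1" by blast
    then obtain F where F: "qmf (int w) f F" "f = restrict_uhp f" using qm_decomp_imp_mf[OF _ w(1)] by metis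
    note fc = fourier_coeff_has_qexp[OF qmf_qexp[OF F(1)]]
    have "(F - G) $ i = 0" if "i \<le> n" for i
      using f that G(2,3) by (cases "i = n") (auto simp: fc)
    from qmf_eq_0[OF qmf_diff[OF F(1) qg] w this]
    have "f z = g0 z + E2 z * g1 z" if "Im z > 0" for z using that by simp
    thus "f = g" by (subst F(2)) (auto simp: g_def restrict_uhp_def fun_eq_iff)
  qed
  hence "G1 w = g" unfolding G1_def dim using w(1) by auto
  thus ?thesis using gq by simp
qed

section \<open>The hypergeometric coefficients\<close>

text \<open>The product of binomials shows integrality, and at n = 2m and n = 2m + 1 it is literally
  the factor in the theorem.\<close>

definition hyp_coeff :: "nat \<Rightarrow> nat" where
  "hyp_coeff n = ((3 * n) choose n) * ((6 * n) choose (3 * n))"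

lemma hyp_coeff_0 [simp]: "hyp_coeff 0 = 1"
  by (simp add: hyp_coeff_def)

lemma hyp_coeff_pos: "hyp_coeff n > 0"
  by (simp add: hyp_coeff_def)

lemma hyp_coeff_fact: "(of_nat (hyp_coeff n) :: complex) = fact (6 * n) / (fact (3 * n) * fact (2 * n) * fact n)"
  by (simp add: hyp_coeff_def binomial_fact)

text \<open>The ratio of consecutive coefficients is 432 (n + 1/6) (n + 5/6) / (n + 1)^2, so the
  generating series is 2F1(1/6, 5/6; 1; 432 t). This is the origin of 432.\<close>

lemma hyp_coeff_Suc:
  "(of_nat (Suc n)) ^ 2 * (of_nat (hyp_coeff (Suc n)) :: complex) =
     12 * of_nat ((6 * n + 1) * (6 * n + 5)) * of_nat (hyp_coeff n)"
proof -
  define x :: complex where "x = of_nat n"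
  have f6: "fact (6 * Suc n) = (6*x+6) * (6*x+5) * (6*x+4) * (6*x+3) * (6*x+2) * (6*x+1) * (fact (6 * n) :: complex)"
    by (simp add: x_def eval_nat_numeral algebra_simps)
  have f3: "fact (3 * Suc n) = (3*x+3) * (3*x+2) * (3*x+1) * (fact (3 * n) :: complex)"
    by (simp add: x_def eval_nat_numeral algebra_simps)
  have f2: "fact (2 * Suc n) = (2*x+2) * (2*x+1) * (fact (2 * n) :: complex)"
    by (simp add: x_def eval_nat_numeral algebra_simps)
  have f1: "fact (Suc n) = (x+1) * (fact n :: complex)"
    by (simp add: x_def)
  have nz: "x + 1 \<noteq> 0" "2 * x + 1 \<noteq> 0" "3 * x + 1 \<noteq> 0" "3 * x + 2 \<noteq> 0"
  proof -
    have e: "x + 1 = of_nat (Suc n)" "2 * x + 1 = of_nat (Suc (2 * n))" "3 * x + 1 = of_nat (Suc (3 * n))"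
      "3 * x + 2 = of_nat (Suc (Suc (3 * n)))" by (simp_all add: x_def)
    show "x + 1 \<noteq> 0" "2 * x + 1 \<noteq> 0" "3 * x + 1 \<noteq> 0" "3 * x + 2 \<noteq> 0"
      unfolding e of_nat_eq_0_iff by simp_all
  qed
  have p: "(6*x+6) * (6*x+5) * (6*x+4) * (6*x+3) * (6*x+2) * (6*x+1) =
      (12 * ((6*x+1) * (6*x+5))) * (((3*x+3) * (3*x+2) * (3*x+1)) * (2 * (2*x+1)))"
    by (simp add: algebra_simps)
  have "of_nat (hyp_coeff (Suc n)) * (x+1)^2 = (12 * ((6*x+1) * (6*x+5))) * of_nat (hyp_coeff n)"
    unfolding hyp_coeff_fact f6 f3 f2 f1 p
  proof -
    define u where "u = (3*x+3) * (3*x+2) * (3*x+1)"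
    have "3 * x + 3 \<noteq> 0" using nz(1) distrib_left[of 3 x 1] by (metis mult.right_neutral mult_eq_0_iff zero_neq_numeral)
    hence u: "u \<noteq> 0" using nz by (simp add: u_def)
    have v: "2 * x + 2 = 2 * (x + 1)" by simp
    have gen: "C * (u * (2 * B)) * F6 / (u * F3 * ((2 * A) * B * F2) * (A * F1)) * A\<^sup>2 = C * (F6 / (F3 * F2 * F1))"
      if "A \<noteq> 0" "B \<noteq> 0" "F1 \<noteq> 0" "F2 \<noteq> 0" "F3 \<noteq> 0" for A B C F6 F3 F2 F1 :: complex
      using u that by (simp add: divide_simps power2_eq_square)
    show "12 * ((6 * x + 1) * (6 * x + 5)) * ((3 * x + 3) * (3 * x + 2) * (3 * x + 1) * (2 * (2 * x + 1))) * fact (6 * n) /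
      ((3 * x + 3) * (3 * x + 2) * (3 * x + 1) * fact (3 * n) * ((2 * x + 2) * (2 * x + 1) * fact (2 * n)) * ((x + 1) * fact n)) * (x + 1)\<^sup>2 =
      12 * ((6 * x + 1) * (6 * x + 5)) * (fact (6 * n) / (fact (3 * n) * fact (2 * n) * fact n))"
      unfolding u_def [symmetric] v by (rule gen) (use nz in auto)
  qed
  moreover have "x + 1 = of_nat (Suc n)" "(6*x+1) * (6*x+5) = of_nat ((6 * n + 1) * (6 * n + 5))"
    by (simp_all add: x_def algebra_simps)
  ultimately show ?thesis by (simp only: mult.commute)
qed

text \<open>The n-th Hasse derivative of the hypergeometric series \<open>phi 0\<close>; division by
  n! keeps small integral coefficients.\<close>

definition phi :: "nat \<Rightarrow> complex fps" where
  "phi n = Abs_fps (\<lambda>i. of_nat (((n + i) choose n) * hyp_coeff (n + i)))"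

lemma phi_nth_0 [simp]: "phi n $ 0 = of_nat (hyp_coeff n)"
  by (simp add: phi_def)

lemma fps_deriv_phi: "fps_deriv (phi n) = of_nat (Suc n) * phi (Suc n)"
proof (rule fps_ext)
  fix i
  have "Suc i * ((n + Suc i) choose n) = (n + Suc i) * ((n + i) choose n)"
    using binomial_absorb_comp[of "n + Suc i" n] by simp
  also have "\<dots> = Suc n * ((n + Suc i) choose Suc n)"
    using binomial_absorption[of n "n + Suc i"] by simp
  finally have "of_nat (Suc i * ((n + Suc i) choose n)) = (of_nat (Suc n * ((n + Suc i) choose Suc n)) :: complex)" by (rule arg_cong)
  hence "of_nat (Suc i) * of_nat ((n + Suc i) choose n) = (of_nat (Suc n) * of_nat ((n + Suc i) choose Suc n) :: complex)"
    unfolding of_nat_mult .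
  moreover have "fps_deriv (phi n) $ i = (of_nat (Suc i) * of_nat ((n + Suc i) choose n)) * of_nat (hyp_coeff (n + Suc i))"
    by (simp add: phi_def del: binomial_Suc_Suc)
  moreover have "(of_nat (Suc n) * phi (Suc n)) $ i = (of_nat (Suc n) * of_nat ((n + Suc i) choose Suc n)) * of_nat (hyp_coeff (n + Suc i))"
    unfolding fps_of_nat [symmetric] fps_mult_left_const_nth by (simp add: phi_def del: binomial_Suc_Suc of_nat_Suc)
  ultimately show "fps_deriv (phi n) $ i = (of_nat (Suc n) * phi (Suc n)) $ i" by simp
qed

text \<open>For n = 0 this is the hypergeometric equation, checked by \<open>hyp_coeff_Suc\<close>;
  each induction step differentiates the identity once.\<close>

lemma phi_ode:
  "of_nat (n + 2) * of_nat (n + 1) * (fps_X - 432 * fps_X ^ 2) * phi (n + 2) + of_nat (n + 1) ^ 2 * (1 - 864 * fps_X) * phi (n + 1) =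
     12 * of_nat ((6 * n + 1) * (6 * n + 5)) * phi n"
proof (induction n)
  case 0
  have d: "fps_deriv (phi (Suc 0)) = 2 * phi (Suc (Suc 0))" using fps_deriv_phi[of 1] by simp
  have "(fps_X - 432 * fps_X ^ 2) * fps_deriv (phi 1) + (1 - 864 * fps_X) * phi 1 =
      fps_theta (phi 1) - fps_const 432 * (fps_X * fps_theta (phi 1)) + phi 1 - fps_const 864 * (fps_X * phi 1)"
    by (simp add: fps_theta_def numeral_fps_const algebra_simps power2_eq_square)
  also have "\<dots> = fps_const 60 * phi 0"
  proof (rule fps_ext)
    fix i
    show "(fps_theta (phi 1) - fps_const 432 * (fps_X * fps_theta (phi 1)) + phi 1 - fps_const 864 * (fps_X * phi 1)) $ i = (fps_const 60 * phi 0) $ i"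
    proof (cases i)
      case 0
      thus ?thesis using hyp_coeff_Suc[of 0] by simp
    next
      case (Suc j)
      have "(fps_theta (phi 1) - fps_const 432 * (fps_X * fps_theta (phi 1)) + phi 1 - fps_const 864 * (fps_X * phi 1)) $ i
         = of_nat (Suc i) ^ 2 * of_nat (hyp_coeff (Suc i)) - (432 * of_nat j * of_nat i + 864 * of_nat i) * of_nat (hyp_coeff i)"
        by (simp add: Suc phi_def algebra_simps power2_eq_square)
      also have "\<dots> = 60 * of_nat (hyp_coeff i)"
        unfolding hyp_coeff_Suc by (simp add: Suc algebra_simps)
      finally show ?thesis by (simp add: phi_def)
    qed
  qed
  finally show ?case using d by (simp add: numeral_fps_const algebra_simps)
next
  case (Suc n)
  define x :: "complex fps" where "x = of_nat n"
  define p0 p1 p2 p3 where "p0 = phi n" and "p1 = phi (n + 1)" and "p2 = phi (n + 2)" and "p3 = phi (n + 3)"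
  have d: "fps_deriv p0 = (x + 1) * p1" "fps_deriv p1 = (x + 2) * p2" "fps_deriv p2 = (x + 3) * p3"
    using fps_deriv_phi[of n] fps_deriv_phi[of "n + 1"] fps_deriv_phi[of "n + 2"]
    by (simp_all add: x_def p0_def p1_def p2_def p3_def add_ac eval_nat_numeral)
  have dx: "fps_deriv x = 0" by (simp add: x_def)
  have IH: "(x + 2) * (x + 1) * (fps_X - 432 * fps_X ^ 2) * p2 + (x + 1) ^ 2 * (1 - 864 * fps_X) * p1 =
     12 * ((6 * x + 1) * (6 * x + 5)) * p0"
  proof -
    have e: "of_nat ((6 * n + 1) * (6 * n + 5)) = (6 * x + 1) * (6 * x + 5)" "of_nat (n + 2) = x + 2" "of_nat (n + 1) = x + 1"
      by (simp_all add: x_def algebra_simps)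
    show ?thesis using Suc.IH unfolding e p0_def p1_def p2_def .
  qed
  have "fps_deriv ((x + 2) * (x + 1) * (fps_X - 432 * fps_X ^ 2) * p2 + (x + 1) ^ 2 * (1 - 864 * fps_X) * p1) =
     fps_deriv (12 * ((6 * x + 1) * (6 * x + 5)) * p0)" using IH by (rule arg_cong)
  hence "(x + 2) * (x + 1) * ((1 - 864 * fps_X) * p2 + (fps_X - 432 * fps_X ^ 2) * ((x + 3) * p3))
      + (x + 1) ^ 2 * ((1 - 864 * fps_X) * ((x + 2) * p2) - 864 * p1) =
     12 * ((6 * x + 1) * (6 * x + 5)) * ((x + 1) * p1)"
    by (simp add: d dx power2_eq_square algebra_simps)
  \<comment> \<open>The common factor appears because 12 (6x + 1)(6x + 5) + 864 (x + 1) = 12 (6x +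
    7)(6x + 11).\<close>
  hence "(x + 1) * ((x + 3) * (x + 2) * (fps_X - 432 * fps_X ^ 2) * p3 + (x + 2) ^ 2 * (1 - 864 * fps_X) * p2) =
     (x + 1) * (12 * ((6 * x + 7) * (6 * x + 11)) * p1)"
    by (simp add: power2_eq_square algebra_simps)
  moreover have "x + 1 \<noteq> 0" unfolding x_def by (metis of_nat_Suc add.commute of_nat_neq_0)
  ultimately have "(x + 3) * (x + 2) * (fps_X - 432 * fps_X ^ 2) * p3 + (x + 2) ^ 2 * (1 - 864 * fps_X) * p2 =
     12 * ((6 * x + 7) * (6 * x + 11)) * p1" by simp
  moreover have "of_nat ((6 * Suc n + 1) * (6 * Suc n + 5)) = (6 * x + 7) * (6 * x + 11)"
    "of_nat (Suc n + 2) = x + 3" "of_nat (Suc n + 1) = x + 2" "Suc n + 2 = n + 3" "Suc n + 1 = n + 2" "phi (n + 1) = phi (Suc n)"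
    by (simp_all add: x_def algebra_simps)
  ultimately show ?case unfolding p1_def p2_def p3_def by (simp only:)
qed

section \<open>Expansion in the hypergeometric parameter\<close>

text \<open>The function argument of \<open>fps_radical\<close> selects 1 as the fourth root of the
  constant coefficient.\<close>

definition psi :: "complex fps" where
  "psi = fps_radical (\<lambda>_ _. 1) 4 Q_fps"

lemma psi_power_4: "psi ^ 4 = Q_fps"
  using power_radical[of Q_fps "\<lambda>_ _. 1" 3] by (simp add: psi_def)

lemma psi_0 [simp]: "psi $ 0 = 1"
  by (simp add: psi_def)

lemma psi_nonzero [simp]: "psi \<noteq> 0"
  using psi_0 by (metis fps_zero_nth zero_neq_one)

definition psi_inv :: "complex fps" where "psi_inv = inverse psi"

lemma psi_psi_inv [simp]: "psi * psi_inv = 1"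
  by (simp add: psi_inv_def inverse_mult_eq_1')

lemma psi_inv_0 [simp]: "psi_inv $ 0 = 1"
  by (simp add: psi_inv_def)

lemma psi_inv_psi_power: "psi ^ n * psi_inv ^ n = 1"
  by (simp add: power_mult_distrib [symmetric])

definition s_fps :: "complex fps" where "s_fps = R_fps * psi_inv ^ 6"
definition t_fps :: "complex fps" where "t_fps = fps_const (1 / 864) * (1 - s_fps)"
definition T_fps :: "complex fps" where "T_fps = Delta_fps * psi_inv ^ 12"

lemma R_eq: "R_fps = s_fps * psi ^ 6"
  using psi_inv_psi_power[of 6] by (simp add: s_fps_def mult.assoc mult.commute[of "psi_inv ^ 6"])

lemma Delta_eq: "Delta_fps = T_fps * psi ^ 12"
  using psi_inv_psi_power[of 12] by (simp add: T_fps_def mult.assoc mult.commute[of "psi_inv ^ 12"])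

lemma s_eq: "s_fps = 1 - 864 * t_fps"
  by (simp add: t_fps_def numeral_fps_const mult.assoc [symmetric])

lemma s_squared: "s_fps ^ 2 = 1 - 1728 * T_fps"
proof -
  have "R_fps ^ 2 = s_fps ^ 2 * psi ^ 12" "Q_fps ^ 3 = psi ^ 12"
    by (simp_all add: R_eq power_mult_distrib power_mult [symmetric] psi_power_4 [symmetric])
  hence "psi ^ 12 * (1 - s_fps ^ 2) = psi ^ 12 * (1728 * T_fps)"
    using Q_cubed_minus_R_squared by (simp add: Delta_eq algebra_simps)
  hence "1 - s_fps ^ 2 = 1728 * T_fps" unfolding mult_cancel_left by simp
  thus ?thesis by (simp add: algebra_simps)
qed

text \<open>Since 864^2 = 1728 * 432, substituting s = 1 - 864 t into s^2 = 1 - 1728 T leaves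
  exactly this quadratic.\<close>

lemma T_eq: "T_fps = t_fps - 432 * t_fps ^ 2"
proof -
  have "1728 * T_fps = 1 - s_fps ^ 2" using s_squared by simp
  also have "\<dots> = 1728 * (t_fps - 432 * t_fps ^ 2)"
    unfolding s_eq by (simp add: power2_eq_square algebra_simps)
  finally show ?thesis unfolding mult_cancel_left by simp
qed

lemma s_0 [simp]: "s_fps $ 0 = 1" by (simp add: s_fps_def fps_nth_power_0)
lemma t_0 [simp]: "t_fps $ 0 = 0" by (simp add: t_fps_def fps_nth_power_0)
lemma T_0 [simp]: "T_fps $ 0 = 0" by (simp add: T_fps_def fps_nth_power_0)
lemma T_1 [simp]: "T_fps $ Suc 0 = 1" by (simp add: T_fps_def fps_nth_1_mult fps_nth_power_0)

lemma fps_theta_numeral_mult [simp]: "fps_theta (numeral n * F) = numeral n * fps_theta F"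
  by (simp add: numeral_fps_const)

lemma theta_psi: "12 * fps_theta psi = P_fps * psi - s_fps * psi ^ 3"
proof -
  have "fps_theta Q_fps = 4 * psi ^ 3 * fps_theta psi"
    using fps_theta_power[of psi 3] by (simp add: psi_power_4 [symmetric])
  hence "12 * psi ^ 3 * fps_theta psi = P_fps * psi ^ 4 - s_fps * psi ^ 6"
    using ramanujan_Q by (simp add: psi_power_4 R_eq mult.assoc)
  hence "psi ^ 3 * (12 * fps_theta psi) = psi ^ 3 * (P_fps * psi - s_fps * psi ^ 3)"
    by (simp add: algebra_simps power_numeral_reduce)
  thus ?thesis unfolding mult_cancel_left by simp
qed

text \<open>P drops out because s has weight 0, and Q^3 - R^2 = 1728 Delta in the form of
  \<open>s_squared\<close> rewrites the remainder.\<close>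

lemma theta_s: "fps_theta s_fps = - 864 * (T_fps * psi ^ 2)"
proof -
  have "fps_theta R_fps = fps_theta s_fps * psi ^ 6 + s_fps * (6 * psi ^ 5 * fps_theta psi)"
    using fps_theta_power[of psi 5] by (simp add: R_eq fps_theta_mult)
  hence "2 * fps_theta s_fps * psi ^ 6 + s_fps * psi ^ 5 * (12 * fps_theta psi) = P_fps * (s_fps * psi ^ 6) - (psi ^ 4) ^ 2"
    using ramanujan_R by (simp add: R_eq psi_power_4 algebra_simps)
  hence "psi ^ 6 * (2 * fps_theta s_fps) = psi ^ 6 * ((s_fps ^ 2 - 1) * psi ^ 2)"
    unfolding theta_psi by (simp add: algebra_simps power_numeral_reduce power2_eq_square)
  hence "2 * fps_theta s_fps = (s_fps ^ 2 - 1) * psi ^ 2" unfolding mult_cancel_left by simp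
  hence "2 * fps_theta s_fps = 2 * (- 864 * (T_fps * psi ^ 2))" unfolding s_squared by simp
  thus ?thesis unfolding mult_cancel_left by simp
qed

lemma theta_t: "fps_theta t_fps = T_fps * psi ^ 2"
proof -
  have "864 * fps_theta t_fps = 864 * (T_fps * psi ^ 2)"
    using theta_s unfolding s_eq by (simp add: fps_theta_def)
  thus ?thesis unfolding mult_cancel_left by simp
qed

lemma theta_T: "fps_theta T_fps = s_fps * (T_fps * psi ^ 2)"
proof -
  have "fps_theta (s_fps ^ 2) = 2 * (s_fps * fps_theta s_fps)"
    using fps_theta_power[of s_fps 1] by (simp add: numeral_2_eq_2 [symmetric] mult.assoc)
  moreover have "fps_theta (1 :: complex fps) = 0" by (simp add: fps_theta_def)
  ultimately have "1728 * fps_theta T_fps = 1728 * (s_fps * (T_fps * psi ^ 2))"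
    unfolding s_squared theta_s by simp
  thus ?thesis unfolding mult_cancel_left by simp
qed

definition Phi :: "nat \<Rightarrow> complex fps" where
  "Phi n = phi n oo t_fps"

lemma Phi_0 [simp]: "Phi n $ 0 = of_nat (hyp_coeff n)"
  by (simp add: Phi_def)

lemma fps_of_nat_compose: "(of_nat k :: complex fps) oo b = of_nat k"
  unfolding fps_of_nat [symmetric] by simp

lemma theta_Phi: "fps_theta (Phi n) = of_nat (Suc n) * Phi (Suc n) * (T_fps * psi ^ 2)"
proof -
  have "fps_theta (Phi n) = ((of_nat (Suc n) * phi (Suc n)) oo t_fps) * fps_theta t_fps"
    by (simp add: fps_theta_def Phi_def fps_compose_deriv fps_deriv_phi mult_ac del: of_nat_Suc)
  thus ?thesis unfolding theta_t Phi_def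
    by (simp add: fps_compose_mult_distrib fps_of_nat_compose del: of_nat_Suc)
qed

text \<open>Substituting t turns X - 432 X^2 into T and its derivative 1 - 864 X into s, so the
  coefficients of the equation become modular.\<close>

lemma Phi_ode:
  "of_nat (n + 2) * of_nat (n + 1) * T_fps * Phi (n + 2) + of_nat (n + 1) ^ 2 * s_fps * Phi (n + 1) =
     12 * of_nat ((6 * n + 1) * (6 * n + 5)) * Phi n"
proof -
  have X: "(fps_X - 432 * (fps_X * fps_X)) oo t_fps = T_fps" "(1 - 864 * fps_X) oo t_fps = s_fps"
    unfolding T_eq s_eq
    by (simp_all add: fps_compose_sub_distrib fps_compose_mult_distrib power2_eq_square)
  show ?thesis
    using arg_cong[OF phi_ode[of n], of "\<lambda>F. F oo t_fps"]
    unfolding fps_compose_add_distrib fps_compose_mult_distrib[OF t_0] fps_of_nat_compose X Phi_def [symmetric]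
      numeral_compose power2_eq_square .
qed

text \<open>
  At the order \<open>a\<close> of \<open>y\<close> the left hand side has coefficient \<open>a\<^sup>2 y\<^sub>a\<close>, whereas the right hand side vanishes.
\<close>

lemma theta_ode_unique:
  assumes y: "fps_theta (psi_inv ^ 2 * fps_theta y) = 60 * (T_fps * (psi ^ 2 * y))" and y0: "y $ 0 = 0"
  shows "y = 0"
proof (rule ccontr)
  assume nz: "y \<noteq> 0"
  define a where "a = subdegree y"
  have ya: "y $ a \<noteq> 0" using nz by (simp add: a_def)
  have lt: "y $ i = 0" if "i < a" for i using that unfolding a_def by (rule nth_less_subdegree_zero)
  have a0: "a > 0" using ya y0 by (cases a) auto
  have "(psi_inv ^ 2 * fps_theta y) $ (0 + a) = (psi_inv ^ 2) $ 0 * fps_theta y $ a"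
    by (rule fps_mult_nth_add(1)) (use lt in auto)
  hence 1: "fps_theta (psi_inv ^ 2 * fps_theta y) $ a = of_nat a ^ 2 * y $ a"
    by (simp add: power2_eq_square)
  have "(psi ^ 2 * y) $ i = 0" if "i < 0 + a" for i
    by (rule fps_mult_nth_add(2)[OF _ _ that]) (use lt in auto)
  hence "(T_fps * (psi ^ 2 * y)) $ a = 0"
    by (intro fps_mult_nth_add(2)[of 1 T_fps a]) auto
  hence "(60 * (T_fps * (psi ^ 2 * y))) $ a = 0" by simp
  with 1 ya a0 show False unfolding y by simp
qed

text \<open>Both series have constant term 1 and solve the same second order equation:
  \<open>Phi 0\<close> by the hypergeometric equation, \<open>psi\<close> by Ramanujan's
  identities.\<close>

lemma Phi_0_eq_psi: "Phi 0 = psi"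
proof -
  have 1: "fps_theta (psi_inv ^ 2 * fps_theta (Phi 0)) = 60 * (T_fps * (psi ^ 2 * Phi 0))"
  proof -
    have "psi_inv ^ 2 * fps_theta (Phi 0) = (psi ^ 2 * psi_inv ^ 2) * (T_fps * Phi 1)"
      using theta_Phi[of 0] by (simp add: mult_ac)
    hence *: "psi_inv ^ 2 * fps_theta (Phi 0) = T_fps * Phi 1" by (simp only: psi_inv_psi_power mult_1)
    have "fps_theta (T_fps * Phi 1) = T_fps * psi ^ 2 * (2 * T_fps * Phi 2 + s_fps * Phi 1)"
      using theta_Phi[of 1] by (simp add: fps_theta_mult theta_T algebra_simps numeral_2_eq_2)
    also have "2 * T_fps * Phi 2 + s_fps * Phi 1 = 60 * Phi 0"
      using Phi_ode[of 0] by (simp add: numeral_2_eq_2)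
    finally show ?thesis unfolding * by (simp add: mult_ac)
  qed
  have 2: "fps_theta (psi_inv ^ 2 * fps_theta psi) = 60 * (T_fps * (psi ^ 2 * psi))"
  proof -
    have "psi_inv ^ 2 * fps_theta psi + (psi * psi_inv) * fps_theta psi_inv = psi_inv * fps_theta (psi * psi_inv)"
      unfolding fps_theta_mult by (simp add: power2_eq_square distrib_left mult_ac del: psi_psi_inv)
    hence "psi_inv ^ 2 * fps_theta psi + fps_theta psi_inv = 0" by (simp add: fps_theta_def)
    hence ti: "fps_theta psi_inv = - (psi_inv ^ 2 * fps_theta psi)" by (simp add: add_eq_0_iff)
    have "12 * (psi_inv ^ 2 * fps_theta psi) = psi_inv ^ 2 * (12 * fps_theta psi)" by (simp add: mult_ac)
    also have "\<dots> = P_fps * psi_inv * (psi * psi_inv) - s_fps * psi * (psi ^ 2 * psi_inv ^ 2)"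
      unfolding theta_psi by (simp add: power_numeral_reduce algebra_simps del: psi_psi_inv)
    finally have u: "12 * (psi_inv ^ 2 * fps_theta psi) = P_fps * psi_inv - s_fps * psi"
      by (simp only: psi_psi_inv psi_inv_psi_power mult_1_right)
    \<comment> \<open>The terms with P cancel. The contribution 12 * 864 = 10368 of theta s and the
      -1728 hidden in s^2 combine to 8640 = 144 * 60.\<close>
    have "12 * (12 * fps_theta (psi_inv ^ 2 * fps_theta psi)) = 12 * fps_theta (P_fps * psi_inv - s_fps * psi)"
      unfolding u [symmetric] by simp
    also have "\<dots> = (12 * fps_theta P_fps) * psi_inv - P_fps * (12 * (psi_inv ^ 2 * fps_theta psi))
        - 12 * fps_theta s_fps * psi - s_fps * (12 * fps_theta psi)"
      by (simp add: fps_theta_mult ti algebra_simps)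
    also have "\<dots> = (P_fps ^ 2 - psi ^ 4) * psi_inv - P_fps * (P_fps * psi_inv - s_fps * psi)
        + 10368 * (T_fps * psi ^ 2) * psi - s_fps * (P_fps * psi - s_fps * psi ^ 3)"
      unfolding ramanujan_P u theta_psi theta_s psi_power_4 by simp
    also have "\<dots> = - (psi ^ 3 * (psi * psi_inv)) + 10368 * T_fps * psi ^ 3 + s_fps ^ 2 * psi ^ 3"
      by (simp add: power2_eq_square power_numeral_reduce algebra_simps del: psi_psi_inv)
    also have "\<dots> = 12 * (12 * (60 * (T_fps * (psi ^ 2 * psi))))"
      unfolding s_squared psi_psi_inv by (simp add: power_numeral_reduce algebra_simps)
    finally show ?thesis unfolding mult_cancel_left by simp
  qed
  have "Phi 0 - psi = 0"
    by (rule theta_ode_unique) (simp_all add: right_diff_distrib 1 2)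
  thus ?thesis by simp
qed

section \<open>The series of weight 6n\<close>

text \<open>The exponent 6n - 1 of psi is split by means of \<open>psi_inv\<close>, because it is
  negative for n = 0.\<close>

definition H_fps :: "nat \<Rightarrow> complex fps" where
  "H_fps n = psi_inv * psi ^ (6 * n) * T_fps ^ n * Phi n"

lemma H_fps_0: "H_fps 0 = 1"
  by (simp add: H_fps_def Phi_0_eq_psi mult.commute)

text \<open>\<open>H_fps 1\<close> is psi^3 theta psi, a quarter of theta Q. It is the second
  initial value of the recurrence.\<close>

lemma H_fps_1: "12 * H_fps 1 = P_fps * Q_fps - R_fps"
proof -
  have "fps_theta psi = Phi 1 * (T_fps * psi ^ 2)"
    using theta_Phi[of 0] by (simp add: Phi_0_eq_psi)
  hence "psi ^ 3 * (12 * fps_theta psi) = 12 * (psi ^ 5 * T_fps * Phi 1)"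
    by (simp add: power_numeral_reduce mult_ac)
  hence "12 * (psi ^ 5 * T_fps * Phi 1) = P_fps * psi ^ 4 - s_fps * psi ^ 6"
    unfolding theta_psi by (simp add: power_numeral_reduce algebra_simps)
  moreover have "H_fps 1 = (psi * psi_inv) * (psi ^ 5 * T_fps * Phi 1)"
    by (simp add: H_fps_def power_numeral_reduce mult_ac)
  ultimately show ?thesis by (simp add: psi_power_4 R_eq)
qed

text \<open>The multiplier \<open>a\<close> of \<open>Phi_ode\<close> is chosen so that T psi^12 =
  Delta and s psi^6 = R absorb all surplus powers, leaving holomorphic modular coefficients.\<close>

lemma H_fps_rec:
  "of_nat (n + 2) * of_nat (n + 1) * H_fps (n + 2) =
     12 * of_nat ((6 * n + 1) * (6 * n + 5)) * (H_fps n * Delta_fps) - of_nat (n + 1) ^ 2 * (H_fps (n + 1) * R_fps)"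
proof -
  define a where "a = psi_inv * psi ^ (6 * n + 12) * T_fps ^ (n + 1)"
  have "of_nat (n + 2) * of_nat (n + 1) * H_fps (n + 2) = a * (of_nat (n + 2) * of_nat (n + 1) * T_fps * Phi (n + 2))"
    by (simp add: H_fps_def a_def algebra_simps)
  also have "of_nat (n + 2) * of_nat (n + 1) * T_fps * Phi (n + 2) =
      12 * of_nat ((6 * n + 1) * (6 * n + 5)) * Phi n - of_nat (n + 1) ^ 2 * s_fps * Phi (n + 1)"
    using Phi_ode[of n] by (simp only: eq_diff_eq)
  also have "a * \<dots> = 12 * of_nat ((6 * n + 1) * (6 * n + 5)) * (a * Phi n) - of_nat (n + 1) ^ 2 * (a * s_fps * Phi (n + 1))"
    by (simp only: right_diff_distrib mult_ac)
  also have "a * Phi n = H_fps n * Delta_fps"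
    by (simp add: a_def H_fps_def Delta_eq power_add mult_ac)
  also have "a * s_fps * Phi (n + 1) = H_fps (n + 1) * R_fps"
    by (simp add: a_def H_fps_def R_eq power_add mult_ac)
  finally show ?thesis .
qed

lemma fps_power_nth_order:
  fixes F :: "'a :: comm_ring_1 fps"
  assumes "F $ 0 = 0"
  shows "i < n \<Longrightarrow> (F ^ n) $ i = 0" and "(F ^ n) $ n = (F $ 1) ^ n"
proof -
  have "(\<forall>i<n. (F ^ n) $ i = 0) \<and> (F ^ n) $ n = (F $ 1) ^ n"
  proof (induction n)
    case (Suc n)
    have F: "\<And>i. i < 1 \<Longrightarrow> F $ i = 0" using assms by simp
    have "(F * F ^ n) $ (1 + n) = F $ 1 * (F ^ n) $ n" by (rule fps_mult_nth_add(1)[OF F]) (use Suc in auto)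
    moreover have "(F * F ^ n) $ i = 0" if "i < 1 + n" for i
      by (rule fps_mult_nth_add(2)[OF F _ that]) (use Suc in auto)
    ultimately show ?case using Suc by simp
  qed auto
  thus "i < n \<Longrightarrow> (F ^ n) $ i = 0" "(F ^ n) $ n = (F $ 1) ^ n" by auto
qed

lemma H_fps_nth:
  shows "i < n \<Longrightarrow> H_fps n $ i = 0" and "H_fps n $ n = of_nat (hyp_coeff n)"
proof -
  have H: "H_fps n = T_fps ^ n * (psi_inv * psi ^ (6 * n) * Phi n)" by (simp add: H_fps_def mult_ac)
  show "i < n \<Longrightarrow> H_fps n $ i = 0"
    unfolding H by (rule fps_mult_nth_add(2)[of n _ 0]) (auto simp: fps_power_nth_order)
  have "H_fps n $ (n + 0) = (T_fps ^ n) $ n * (psi_inv * psi ^ (6 * n) * Phi n) $ 0"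
    unfolding H by (rule fps_mult_nth_add(1)) (auto simp: fps_power_nth_order)
  thus "H_fps n $ n = of_nat (hyp_coeff n)" by (simp add: fps_power_nth_order fps_nth_power_0)
qed

section \<open>Integrality\<close>

definition integral_fps :: "complex fps \<Rightarrow> bool" where
  "integral_fps F \<longleftrightarrow> (\<forall>n. F $ n \<in> \<int>)"

lemma integral_fps_add: "integral_fps F \<Longrightarrow> integral_fps G \<Longrightarrow> integral_fps (F + G)"
  by (simp add: integral_fps_def)

lemma integral_fps_diff: "integral_fps F \<Longrightarrow> integral_fps G \<Longrightarrow> integral_fps (F - G)"
  by (simp add: integral_fps_def)

lemma integral_fps_mult: "integral_fps F \<Longrightarrow> integral_fps G \<Longrightarrow> integral_fps (F * G)"
  by (auto simp: integral_fps_def fps_mult_nth intro!: Ints_sum Ints_mult)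

lemma integral_fps_1: "integral_fps 1"
  by (simp add: integral_fps_def)

lemma integral_fps_numeral: "integral_fps (numeral n)"
  by (simp add: integral_fps_def numeral_fps_const)

lemma integral_fps_of_nat: "integral_fps (of_nat n)"
  by (simp add: integral_fps_def fps_of_nat [symmetric])

lemma integral_fps_X: "integral_fps fps_X"
  by (simp add: integral_fps_def fps_X_def)

lemma integral_fps_power: "integral_fps F \<Longrightarrow> integral_fps (F ^ n)"
  by (induction n) (auto intro: integral_fps_mult integral_fps_1)

lemma integral_fps_prod: "(\<And>i. i \<in> A \<Longrightarrow> integral_fps (F i)) \<Longrightarrow> integral_fps (\<Prod>i\<in>A. F i)"
  by (induction A rule: infinite_finite_induct) (auto intro: integral_fps_mult integral_fps_1)

lemma integral_fps_theta: "integral_fps F \<Longrightarrow> integral_fps (fps_theta F)"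
  by (simp add: integral_fps_def)

lemma integral_fps_compose: "integral_fps F \<Longrightarrow> integral_fps G \<Longrightarrow> integral_fps (F oo G)"
  using integral_fps_power[of G] unfolding integral_fps_def fps_compose_nth
  by (auto intro!: Ints_sum Ints_mult)

lemmas integral_fps_intros = integral_fps_add integral_fps_diff integral_fps_mult integral_fps_1 integral_fps_numeral
  integral_fps_of_nat integral_fps_X integral_fps_power integral_fps_theta integral_fps_compose

lemma integral_fps_inverse:
  assumes F: "integral_fps F" "F $ 0 = 1" and FG: "F * G = 1"
  shows "integral_fps G"
  unfolding integral_fps_def
proof
  fix n show "G $ n \<in> \<int>"
  proof (induction n rule: less_induct)
    case (less n)
    have "(F * G) $ n = F $ 0 * G $ n + (\<Sum>i=1..n. F $ i * G $ (n - i))"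
      by (simp add: fps_mult_nth sum.atLeast_Suc_atMost[of 0 n])
    hence "G $ n = (1 :: complex fps) $ n - (\<Sum>i=1..n. F $ i * G $ (n - i))"
      using F(2) by (simp add: FG)
    moreover have "(\<Sum>i=1..n. F $ i * G $ (n - i)) \<in> \<int>"
      using F(1) less by (intro Ints_sum Ints_mult) (auto simp: integral_fps_def)
    ultimately show ?case by simp
  qed
qed

lemma P_fps_integral: "integral_fps P_fps"
  by (simp add: integral_fps_def P_fps_def)

lemma Q_fps_integral: "integral_fps Q_fps"
  unfolding Q_fps_def by (intro integral_fps_intros P_fps_integral)

text \<open>
  Integrality of \<open>\<Delta>\<close>: the \<open>N\<close>-th partial product of \<open>q \<Prod> (1 - q\<^sup>n)\<^sup>2\<^sup>4\<close> satisfies the same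
  differential equation up to order \<open>N\<close>, which determines the coefficients up to \<open>N\<close>.
\<close>

definition Delta_prod :: "nat \<Rightarrow> complex fps" where
  "Delta_prod N = fps_X * (\<Prod>n=1..N. (1 - fps_X ^ n) ^ 24)"

text \<open>The expansion of n q^n / (1 - q^n).\<close>

definition lambert_fps :: "nat \<Rightarrow> complex fps" where
  "lambert_fps n = Abs_fps (\<lambda>k. if 0 < k \<and> n dvd k then of_nat n else 0)"

lemma lambert_fps_mult:
  assumes "n > 0"
  shows "(1 - fps_X ^ n) * lambert_fps n = of_nat n * fps_X ^ n"
proof (rule fps_ext)
  fix k
  have "lambert_fps n $ k - (if k < n then 0 else lambert_fps n $ (k - n)) = (if k = n then of_nat n else 0)"
    using assms by (auto simp: lambert_fps_def dvd_minus_self dest: dvd_imp_le)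
  thus "((1 - fps_X ^ n) * lambert_fps n) $ k = (of_nat n * fps_X ^ n) $ k"
    unfolding fps_of_nat [symmetric] by (simp add: left_diff_distrib fps_X_power_mult_nth)
qed

lemma theta_Delta_prod: "fps_theta (Delta_prod N) = Delta_prod N * (1 - 24 * (\<Sum>n=1..N. lambert_fps n))"
proof (induction N)
  case 0
  show ?case by (simp add: Delta_prod_def fps_theta_def)
next
  case (Suc N)
  define u :: "complex fps" where "u = 1 - fps_X ^ Suc N"
  have "fps_theta u = - (of_nat (Suc N) * fps_X ^ Suc N)"
    by (rule fps_ext) (auto simp: u_def fps_of_nat [symmetric] simp del: of_nat_Suc)
  also have "\<dots> = - (u * lambert_fps (Suc N))" unfolding u_def by (subst lambert_fps_mult) auto
  finally have "fps_theta u = - (u * lambert_fps (Suc N))" .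
  hence u: "fps_theta (u ^ 24) = - (24 * (u ^ 24 * lambert_fps (Suc N)))"
    using fps_theta_power[of u 23] by (simp add: power_Suc2 [symmetric] mult.assoc [symmetric] del: power_Suc)
  have D: "Delta_prod (Suc N) = Delta_prod N * u ^ 24"
    by (simp add: Delta_prod_def u_def mult.assoc)
  show ?case unfolding D fps_theta_mult Suc.IH u by (simp add: algebra_simps)
qed

text \<open>As F has constant term 1, the k-th coefficient of the equation reads (k - 1) A_k =
  combination of earlier ones. The recursion degenerates at k = 1, hence the second initial
  condition.\<close>

lemma theta_linear_ode_unique:
  fixes A B :: "complex fps"
  assumes A: "fps_theta A = F * A" and B: "fps_theta B = G * B"
    and FG: "\<And>i. i \<le> N \<Longrightarrow> F $ i = G $ i" and F0: "F $ 0 = 1"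
    and init: "A $ 0 = B $ 0" "A $ 1 = B $ 1" and k: "k \<le> N"
  shows "A $ k = B $ k"
  using k
proof (induction k rule: less_induct)
  case (less k)
  show ?case
  proof (cases "k \<le> 1")
    case True
    hence "k = 0 \<or> k = 1" by auto
    thus ?thesis using init by auto
  next
    case False
    have *: "(of_nat k - 1) * C $ k = (\<Sum>i=1..k. E $ i * C $ (k - i))"
      if "fps_theta C = E * C" "E $ 0 = 1" for C E :: "complex fps"
    proof -
      have "of_nat k * C $ k = (E * C) $ k" using that(1) by (metis fps_nth_theta)
      also have "\<dots> = C $ k + (\<Sum>i=1..k. E $ i * C $ (k - i))"
        using that(2) by (simp add: fps_mult_nth sum.atLeast_Suc_atMost[of 0 k])
      finally show ?thesis by (simp add: algebra_simps)
    qed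
    have "G $ 0 = 1" using FG[of 0] F0 by simp
    have "(of_nat k - 1) * A $ k = (of_nat k - 1) * B $ k"
      unfolding *[OF A F0] *[OF B \<open>G $ 0 = 1\<close>]
      using less FG by (intro sum.cong) auto
    moreover have "of_nat k - 1 \<noteq> (0 :: complex)" using False by simp
    ultimately show ?thesis by simp
  qed
qed

lemma Delta_fps_integral: "integral_fps Delta_fps"
  unfolding integral_fps_def
proof
  fix N
  have "Delta_fps $ N = Delta_prod N $ N"
  proof (rule theta_linear_ode_unique[OF theta_Delta_fps])
    show "fps_theta (Delta_prod N) = (1 - 24 * (\<Sum>n=1..N. lambert_fps n)) * Delta_prod N"
      by (subst theta_Delta_prod) (rule mult.commute)
    show "P_fps $ k = (1 - 24 * (\<Sum>n=1..N. lambert_fps n)) $ k" if "k \<le> N" for k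
    proof (cases "k = 0")
      case True
      thus ?thesis by (simp add: fps_sum_nth lambert_fps_def)
    next
      case False
      have "(\<Sum>n=1..N. lambert_fps n $ k) = (\<Sum>n\<in>{n. n dvd k}. of_nat n)"
        using False that by (intro sum.mono_neutral_cong_right)
          (auto simp: lambert_fps_def Suc_le_eq intro: dvd_pos_nat order_trans[OF dvd_imp_le])
      thus ?thesis using False by (simp add: fps_sum_nth P_fps_def sigma_div_def)
    qed
    have "(\<Prod>n=1..N. (1 - fps_X ^ n) ^ 24) $ 0 = (1 :: complex)"
      by (induction N) (auto simp: fps_nth_power_0)
    thus "Delta_fps $ 1 = Delta_prod N $ 1"
      by (simp add: Delta_prod_def)
  qed (auto simp: Delta_prod_def)
  moreover have "integral_fps (Delta_prod N)"
    unfolding Delta_prod_def by (intro integral_fps_intros integral_fps_prod)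
  ultimately show "Delta_fps $ N \<in> \<int>" by (simp add: integral_fps_def)
qed

text \<open>T = Delta / Q^3 contains only integral powers of Q, so its integrality precedes that of
  psi and there is no circularity.\<close>

lemma T_fps_integral: "integral_fps T_fps"
proof -
  have "Q_fps * psi_inv ^ 4 = 1" using psi_inv_psi_power[of 4] by (simp add: psi_power_4)
  hence "integral_fps (psi_inv ^ 4)" by (intro integral_fps_inverse[OF Q_fps_integral]) auto
  hence "integral_fps (Delta_fps * (psi_inv ^ 4) ^ 3)" by (intro integral_fps_mult[OF Delta_fps_integral] integral_fps_power[of "psi_inv ^ 4"])
  thus ?thesis by (simp add: T_fps_def power_mult [symmetric])
qed

text \<open>The definition of t divides by 864, but t = T + 432 t^2 with t_0 = 0 determines its
  coefficients recursively over the integers.\<close>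

lemma t_fps_integral: "integral_fps t_fps"
  unfolding integral_fps_def
proof
  fix n show "t_fps $ n \<in> \<int>"
  proof (induction n rule: less_induct)
    case (less n)
    have "t_fps = T_fps + fps_const 432 * (t_fps * t_fps)"
      by (simp add: T_eq power2_eq_square numeral_fps_const)
    hence t: "t_fps $ n = T_fps $ n + 432 * (\<Sum>i=0..n. t_fps $ i * t_fps $ (n - i))"
      by (metis fps_add_nth fps_mult_left_const_nth fps_mult_nth)
    have "t_fps $ i * t_fps $ (n - i) \<in> \<int>" if "i \<le> n" for i
    proof (cases "i = 0 \<or> i = n")
      case False
      thus ?thesis using that by (intro Ints_mult less) auto
    qed auto
    hence "(\<Sum>i=0..n. t_fps $ i * t_fps $ (n - i)) \<in> \<int>" by (intro Ints_sum) auto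
    thus ?case using T_fps_integral unfolding t by (simp add: integral_fps_def)
  qed
qed

lemma Phi_integral: "integral_fps (Phi n)"
  unfolding Phi_def by (intro integral_fps_compose t_fps_integral) (simp add: integral_fps_def phi_def)

text \<open>A fourth root of an integral series could have denominators; the expansion in powers of
  t with coefficients \<open>hyp_coeff\<close> excludes them.\<close>

lemma psi_integral: "integral_fps psi"
  using Phi_integral[of 0] by (simp add: Phi_0_eq_psi)

lemma psi_inv_integral: "integral_fps psi_inv"
  by (rule integral_fps_inverse[OF psi_integral]) auto

lemma H_fps_integral: "integral_fps (H_fps n)"
  unfolding H_fps_def by (intro integral_fps_intros psi_integral psi_inv_integral T_fps_integral Phi_integral)

section \<open>The Serre derivative and divisibility by 6n - 1\<close>

text \<open>Twelve times the Serre derivative taken with the number 6n - 1, weight minus depth,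
  which is what preserves depth one.\<close>

definition L_fps :: "nat \<Rightarrow> complex fps" where
  "L_fps n = 12 * fps_theta (H_fps n) - of_int (6 * int n - 1) * (P_fps * H_fps n)"

text \<open>Differentiating T^(n+1) reproduces the left side of \<open>Phi_ode\<close>; its right
  side supplies the factor 6n + 5 = 6 (n + 1) - 1.\<close>

lemma theta_T_power_Phi:
  "of_nat (n + 1) * fps_theta (T_fps ^ (n + 1) * Phi (n + 1)) =
     of_nat (6 * n + 5) * (12 * of_nat (6 * n + 1) * (psi ^ 2 * T_fps ^ (n + 1) * Phi n))"
proof -
  have "fps_theta (T_fps ^ (n + 1) * Phi (n + 1)) =
     of_nat (n + 1) * T_fps ^ n * (s_fps * (T_fps * psi ^ 2)) * Phi (n + 1) + T_fps ^ (n + 1) * (of_nat (n + 2) * Phi (n + 2) * (T_fps * psi ^ 2))"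
    using fps_theta_power[of T_fps n] theta_Phi[of "n + 1"] by (simp add: fps_theta_mult theta_T)
  hence "of_nat (n + 1) * fps_theta (T_fps ^ (n + 1) * Phi (n + 1)) =
     psi ^ 2 * T_fps ^ (n + 1) * (of_nat (n + 2) * of_nat (n + 1) * T_fps * Phi (n + 2) + of_nat (n + 1) ^ 2 * s_fps * Phi (n + 1))"
    by (simp add: power2_eq_square algebra_simps)
  thus ?thesis unfolding Phi_ode of_nat_mult[of "6 * n + 1"] by (simp only: mult_ac)
qed

text \<open>
  With \<open>A = T\<^sup>n \<Phi>\<^sub>n\<close> and \<open>d = 6n - 1\<close>, the integral series \<open>n \<theta>A\<close> is divisible by \<open>d\<close>, hence so is \<open>\<theta>A\<close>, since
  \<open>d\<close> and \<open>n\<close> are coprime.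
\<close>

lemma L_fps_divisible:
  assumes "n > 0"
  shows "\<exists>K. integral_fps K \<and> L_fps n = of_int (6 * int n - 1) * K"
proof -
  obtain k where n: "n = k + 1" using assms by (cases n) auto
  define A where "A = T_fps ^ n * Phi n"
  define Z where "Z = 12 * of_nat (6 * k + 1) * (psi ^ 2 * T_fps ^ n * Phi k)"
  define d :: "complex fps" where "d = of_nat (6 * k + 5)"
  \<comment> \<open>The Bezout relation 6n - d = 1: theta A = 6n theta A - d theta A, and n theta A
    = d Z.\<close>
  define Y where "Y = 6 * Z - fps_theta A"
  have d: "d = of_int (6 * int n - 1)" by (simp add: d_def n)
  have d2: "d = 6 * of_nat n - 1" by (simp add: d_def n)
  have "of_nat n * fps_theta A = d * Z"
    using theta_T_power_Phi[of k] by (simp add: A_def Z_def d_def n)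
  hence "d * Y = 6 * (of_nat n * fps_theta A) - d * fps_theta A" by (simp add: Y_def algebra_simps)
  hence Y: "fps_theta A = d * Y" unfolding d2 by (simp add: algebra_simps)
  \<comment> \<open>The exponent 6n - 1 of psi is d itself, so differentiating the power of psi also
    yields a factor d.\<close>
  have "psi_inv * psi ^ (6 * n) = (psi * psi_inv) * psi ^ Suc (6 * k + 4)"
    by (simp add: n mult_ac eval_nat_numeral)
  hence H: "H_fps n = psi ^ Suc (6 * k + 4) * A" by (simp add: H_fps_def A_def mult.assoc)
  have ds: "of_nat (Suc (6 * k + 4)) = d" unfolding d_def by (rule arg_cong) simp
  have "fps_theta (H_fps n) = d * (psi ^ (6 * k + 4) * fps_theta psi * A + psi ^ Suc (6 * k + 4) * Y)"
    unfolding H fps_theta_mult fps_theta_power Y ds by (simp only: distrib_left mult_ac)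
  hence "L_fps n = d * (12 * (psi ^ (6 * k + 4) * fps_theta psi * A + psi ^ Suc (6 * k + 4) * Y) - P_fps * H_fps n)"
    unfolding L_fps_def d [symmetric] by (simp add: right_diff_distrib mult_ac)
  moreover have "integral_fps (12 * (psi ^ (6 * k + 4) * fps_theta psi * A + psi ^ Suc (6 * k + 4) * Y) - P_fps * H_fps n)"
    unfolding Y_def Z_def A_def
    by (intro integral_fps_intros psi_integral T_fps_integral Phi_integral P_fps_integral H_fps_integral)
  ultimately show ?thesis unfolding d by blast
qed

text \<open>P has constant term 1, so at order n the operator multiplies by 12n - (6n - 1) = 6n + 1,
  the numerator of the factor in the theorem.\<close>

lemma L_fps_nth:
  shows "i < n \<Longrightarrow> L_fps n $ i = 0" and "L_fps n $ n = of_nat (6 * n + 1) * of_nat (hyp_coeff n)"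
proof -
  have L: "L_fps n = fps_const 12 * fps_theta (H_fps n) - fps_const (of_int (6 * int n - 1)) * (P_fps * H_fps n)"
    by (simp only: L_fps_def numeral_fps_const fps_of_int)
  have "(P_fps * H_fps n) $ i = 0" if "i < 0 + n" for i
    by (rule fps_mult_nth_add(2)[OF _ _ that]) (auto simp: H_fps_nth)
  thus "i < n \<Longrightarrow> L_fps n $ i = 0"
    unfolding L by (simp add: H_fps_nth)
  have "(P_fps * H_fps n) $ (0 + n) = P_fps $ 0 * H_fps n $ n"
    by (rule fps_mult_nth_add(1)) (auto simp: H_fps_nth)
  hence PH: "(P_fps * H_fps n) $ n = of_nat (hyp_coeff n)" by (simp add: H_fps_nth)
  show "L_fps n $ n = of_nat (6 * n + 1) * of_nat (hyp_coeff n)"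
    unfolding L fps_sub_nth fps_mult_left_const_nth fps_nth_theta PH H_fps_nth(2) by (simp add: algebra_simps)
qed

text \<open>P^2 F1 arises once from 12 theta P and w - 2 times from the Serre derivative of F1;
  subtracting w - 1 times P F removes it and keeps the depth at one.\<close>

lemma qmf_serre_derivative:
  assumes "qmf w f F"
  shows "\<exists>g. qmf (w + 2) g (12 * fps_theta F - of_int (w - 1) * (P_fps * F))"
proof -
  obtain f0 F0 f1 F1 where *: "mf w f0 F0" "mf (w - 2) f1 F1" "F = F0 + P_fps * F1"
    using assms by (auto simp: qmf_def)
  define S0 S1 where "S0 = fps_theta F0 - fps_const (of_int w / 12) * (P_fps * F0)"
    and "S1 = fps_theta F1 - fps_const (of_int (w - 2) / 12) * (P_fps * F1)"
  obtain s0 s1 where s: "mf (w + 2) s0 S0" "mf (w - 2 + 2) s1 S1"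
    using mf_serre_derivative[OF *(1)] mf_serre_derivative[OF *(2)] unfolding S0_def S1_def by blast
  have c: "12 * fps_const (of_int k / 12) = (of_int k :: complex fps)" for k
    by (simp add: numeral_fps_const fps_of_int [symmetric])
  have S: "12 * S0 = 12 * fps_theta F0 - of_int w * (P_fps * F0)"
    "12 * S1 = 12 * fps_theta F1 - of_int (w - 2) * (P_fps * F1)"
    unfolding S0_def S1_def by (simp_all only: right_diff_distrib mult.assoc [symmetric] c)
  have "mf (w - 2 + 4) (\<lambda>z. f1 z * E4 z) (F1 * Q_fps)" by (intro mf_mult * mf_E4)
  hence "mf (w + 2) (\<lambda>z. 12 * s0 z - f1 z * E4 z) (fps_const 12 * S0 - F1 * Q_fps)"
    by (intro mf_diff mf_cmult s) (simp add: algebra_simps)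
  moreover have "mf (w + 2 - 2) (\<lambda>z. f0 z + 12 * s1 z) (F0 + fps_const 12 * S1)"
    by (intro mf_add mf_cmult) (use * s in auto)
  ultimately obtain g where "qmf (w + 2) g (fps_const 12 * S0 - F1 * Q_fps + P_fps * (F0 + fps_const 12 * S1))"
    using qmfI by blast
  moreover have "fps_const 12 * S0 - F1 * Q_fps + P_fps * (F0 + fps_const 12 * S1) =
      12 * fps_theta F - of_int (w - 1) * (P_fps * F)"
  proof -
    have "12 * fps_theta F = 12 * fps_theta F0 + (12 * fps_theta P_fps) * F1 + 12 * (P_fps * fps_theta F1)"
      by (simp add: *(3) fps_theta_mult algebra_simps)
    also have "\<dots> = 12 * fps_theta F0 + (P_fps ^ 2 - Q_fps) * F1 + 12 * (P_fps * fps_theta F1)"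
      unfolding ramanujan_P ..
    finally show ?thesis
      unfolding numeral_fps_const [symmetric] S distrib_left
      by (simp add: *(3) power2_eq_square algebra_simps)
  qed
  ultimately show ?thesis by auto
qed

text \<open>The recurrence involves two predecessors, so consecutive pairs are carried through the
  induction; \<open>Delta\<close> raises the weight by 12 and \<open>E6\<close> by 6.\<close>

lemma H_fps_qmf: "\<exists>h. qmf (6 * int n) h (H_fps n)"
proof -
  have "(\<exists>h. qmf (6 * int n) h (H_fps n)) \<and> (\<exists>h. qmf (6 * int (n + 1)) h (H_fps (n + 1)))"
  proof (induction n)
    case 0
    have "qmf (6 * int 0) (\<lambda>_. 1) (H_fps 0)"
      using mf_imp_qmf[OF mf_const[of 1]] by (simp add: H_fps_0)
    moreover have "\<exists>h. qmf 6 h (H_fps 1)"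
    proof -
      have "mf 6 (\<lambda>z. (- 1 / 12) * E6 z) (fps_const (- 1 / 12) * R_fps)" by (intro mf_cmult mf_E6)
      moreover have "mf (6 - 2) (\<lambda>z. (1 / 12) * E4 z) (fps_const (1 / 12) * Q_fps)" using mf_cmult[OF mf_E4, of "1 / 12"] by simp
      ultimately have "\<exists>h. qmf 6 h (fps_const (- 1 / 12) * R_fps + P_fps * (fps_const (1 / 12) * Q_fps))"
        using qmfI by blast
      moreover have "fps_const (- 1 / 12) * R_fps + P_fps * (fps_const (1 / 12) * Q_fps) = fps_const (1 / 12) * (P_fps * Q_fps - R_fps)"
        by (rule fps_ext) (simp add: mult.left_commute[of P_fps] diff_divide_distrib)
      moreover have "fps_const (1 / 12) * (P_fps * Q_fps - R_fps) = H_fps 1"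
        unfolding H_fps_1 [symmetric] by (simp add: numeral_fps_const mult.assoc [symmetric])
      ultimately show ?thesis by simp
    qed
    ultimately show ?case by auto
  next
    case (Suc n)
    then obtain g h where g: "qmf (6 * int n) g (H_fps n)" and h: "qmf (6 * int (n + 1)) h (H_fps (n + 1))" by blast
    define a b c :: complex where "a = of_nat ((n + 2) * (n + 1))" and "b = of_nat (12 * ((6 * n + 1) * (6 * n + 5)))"
      and "c = of_nat ((n + 1) ^ 2)"
    have a0: "a \<noteq> 0" unfolding a_def of_nat_eq_0_iff by simp
    have w: "6 * int n + 12 = 6 * int (n + 2)" "6 * int (n + 1) + 6 = 6 * int (n + 2)" by simp_all
    note q = qmf_mult_mf[OF g mf_Delta, unfolded w] qmf_mult_mf[OF h mf_E6, unfolded w]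
    have "\<exists>f. qmf (6 * int (n + 2)) f (fps_const (1 / a) * (fps_const b * (H_fps n * Delta_fps) - fps_const c * (H_fps (n + 1) * R_fps)))"
      using qmf_cmult[OF qmf_diff[OF qmf_cmult[OF q(1), of b] qmf_cmult[OF q(2), of c]], of "1 / a"] by blast
    moreover have "fps_const b * (H_fps n * Delta_fps) - fps_const c * (H_fps (n + 1) * R_fps) = fps_const a * H_fps (n + 2)"
      using H_fps_rec[of n] unfolding a_def b_def c_def fps_of_nat
      by (simp only: of_nat_mult of_nat_power of_nat_numeral mult.assoc)
    moreover have "fps_const (1 / a) * (fps_const a * H_fps (n + 2)) = H_fps (n + 2)"
      using a0 by (simp add: mult.assoc [symmetric])
    ultimately have "\<exists>f. qmf (6 * int (n + 2)) f (H_fps (n + 2))" by metis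
    with h show ?case by (auto simp: numeral_2_eq_2)
  qed
  thus ?thesis by blast
qed

lemma L_fps_qmf: "\<exists>h. qmf (6 * int n + 2) h (L_fps n)"
  using H_fps_qmf[of n] qmf_serre_derivative unfolding L_fps_def by blast

lemma QH_qmf: "\<exists>h. qmf (6 * int n + 4) h (H_fps n * Q_fps)"
  using H_fps_qmf[of n] qmf_mult_mf[OF _ mf_E4] by blast

section \<open>Identification with the extremal forms\<close>

definition extremal_fps :: "int \<Rightarrow> nat \<Rightarrow> complex fps \<Rightarrow> bool" where
  "extremal_fps w n F \<longleftrightarrow> (\<exists>f. qmf w f F) \<and> (\<forall>i<n. F $ i = 0) \<and> F $ n = 1"

lemma extremal_fpsI:
  assumes "\<exists>f. qmf w f F" "\<And>i. i < n \<Longrightarrow> F $ i = 0" "F $ n = c" "c \<noteq> 0"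
  shows "extremal_fps w n (fps_const (1 / c) * F)"
  using assms qmf_cmult unfolding extremal_fps_def by (auto intro: qmf_cmult)

lemma hyp_coeff_nonzero: "of_nat (hyp_coeff n) \<noteq> (0 :: complex)"
  using hyp_coeff_pos[of n] by simp

lemma extremal_0: "extremal_fps (6 * int n) n (fps_const (1 / of_nat (hyp_coeff n)) * H_fps n)"
  by (intro extremal_fpsI H_fps_qmf H_fps_nth hyp_coeff_nonzero)

lemma extremal_2:
  "extremal_fps (6 * int n + 2) n (fps_const (1 / (of_nat (6 * n + 1) * of_nat (hyp_coeff n))) * L_fps n)"
proof -
  have "of_nat (6 * n + 1) \<noteq> (0 :: complex)" unfolding of_nat_eq_0_iff by simp
  thus ?thesis by (intro extremal_fpsI L_fps_qmf L_fps_nth) (use hyp_coeff_nonzero in auto)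
qed

lemma extremal_4: "extremal_fps (6 * int n + 4) n (fps_const (1 / of_nat (hyp_coeff n)) * (H_fps n * Q_fps))"
proof (intro extremal_fpsI QH_qmf hyp_coeff_nonzero)
  show "(H_fps n * Q_fps) $ i = 0" if "i < n" for i
    using fps_mult_nth_add(2)[of n "H_fps n" 0 Q_fps i] that by (simp add: H_fps_nth)
  show "(H_fps n * Q_fps) $ n = of_nat (hyp_coeff n)"
    using fps_mult_nth_add(1)[of n "H_fps n" 0 Q_fps] by (simp add: H_fps_nth)
qed

text \<open>The forms of weight 6n + a and order j < n are obtained from the extremal ones of weight
  6j + a by multiplying with E6^(n-j), whose constant term is 1. With n > 0 and a < 6 the weight is
  below 12n.\<close>

lemma has_qexp_G1:
  assumes ext: "\<And>j. j < n \<Longrightarrow> \<exists>F. extremal_fps (6 * int j + int a) j F" and F: "extremal_fps (6 * int n + int a) n F"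
    and n: "n > 0" and a: "a < 6"
  shows "has_qexp (G1 (6 * n + a)) F"
proof -
  have w: "6 * n + a \<ge> 2" "6 * n + a < 6 * Suc n" "6 * n + a < 12 * n" using n a by auto
  have iw: "int (6 * n + a) = 6 * int n + int a" by simp
  obtain f where f: "qmf (int (6 * n + a)) f F" using F unfolding extremal_fps_def iw by blast
  then obtain g0 K0 g1 K1 where g: "mf (int (6 * n + a)) g0 K0" "mf (int (6 * n + a) - 2) g1 K1" "F = K0 + P_fps * K1"
    unfolding qmf_def by blast
  have fam: "\<exists>f F. qmf (int (6 * n + a)) f F \<and> (\<forall>i<j. F $ i = 0) \<and> F $ j = 1" if j: "j < n" for j
  proof -
    obtain G h where G: "qmf (6 * int j + int a) h G" "\<forall>i<j. G $ i = 0" "G $ j = 1"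
      using ext[OF j] unfolding extremal_fps_def by blast
    have "qmf (6 * int j + int a + int (n - j) * 6) (\<lambda>z. h z * E6 z ^ (n - j)) (G * R_fps ^ (n - j))"
      by (intro qmf_mult_mf mf_power G mf_E6)
    moreover have "6 * int j + int a + int (n - j) * 6 = int (6 * n + a)" using j by (simp add: of_nat_diff)
    moreover have "(G * R_fps ^ (n - j)) $ i = 0" if "i < j" for i
      using fps_mult_nth_add(2)[of j G 0 "R_fps ^ (n - j)" i] that G by simp
    moreover have "(G * R_fps ^ (n - j)) $ j = 1"
      using fps_mult_nth_add(1)[of j G 0 "R_fps ^ (n - j)"] G by (simp add: fps_nth_power_0)
    ultimately show ?thesis by metis
  qed
  show ?thesis
    by (rule G1_eqI[OF w(1,2) fam g(1,2,3)]) (use F w in \<open>auto simp: extremal_fps_def\<close>)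
qed

lemma has_qexp_G1_2: "has_qexp (G1 2) P_fps"
  using G1_eqI[of 2 0 "\<lambda>_. 0" 0 "\<lambda>_. 1" "fps_const 1" P_fps] mf_0[of 2] mf_const[of 1] by simp

lemma integral_coeffsI:
  assumes "has_qexp f F" "integral_fps (fps_const c * F)"
  shows "integral_coeffs (\<lambda>z. c * f z)"
  using assms(2) fourier_coeff_has_qexp[OF has_qexp_cmult[OF assms(1), of c]]
  by (simp add: integral_coeffs_def integral_fps_def)

lemma integral_G1_0: "integral_coeffs (\<lambda>z. of_nat (hyp_coeff n) * G1 (6 * n) z)"
proof (cases "n = 0")
  case True
  have "has_qexp (G1 0) (fps_const 1)" using has_qexp_const[of 1] by (simp add: G1_def)
  thus ?thesis using True by (intro integral_coeffsI) (auto simp: integral_fps_1)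
next
  case False
  have "has_qexp (G1 (6 * n + 0)) (fps_const (1 / of_nat (hyp_coeff n)) * H_fps n)"
    using False extremal_0 by (intro has_qexp_G1) auto
  thus ?thesis
    using H_fps_integral[of n] hyp_coeff_nonzero[of n]
    by (intro integral_coeffsI[where F = "fps_const (1 / of_nat (hyp_coeff n)) * H_fps n"]) (auto simp: mult.assoc [symmetric])
qed

text \<open>Normalisation divides L by (6n + 1) times \<open>hyp_coeff n\<close>, so the stated
  factor leaves L / (6n - 1), which is integral. At n = 0 the factor is -1 and the form is
  \<open>E2\<close>.\<close>

lemma integral_G1_2:
  "integral_coeffs (\<lambda>z. of_int (6 * int n + 1) / of_int (6 * int n - 1) * of_nat (hyp_coeff n) * G1 (6 * n + 2) z)"
proof (cases "n = 0")
  case True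
  have "integral_fps (fps_const (- 1) * P_fps)" using P_fps_integral by (simp add: integral_fps_def)
  from integral_coeffsI[OF has_qexp_G1_2 this] show ?thesis using True by (simp add: numeral_2_eq_2)
next
  case False
  define c d :: complex where "c = of_nat (hyp_coeff n)" and "d = of_int (6 * int n - 1)"
  define e :: complex where "e = of_int (6 * int n + 1)"
  have e': "of_nat (6 * n + 1) = e" by (simp add: e_def)
  have "6 * int n - 1 \<noteq> 0" "6 * int n + 1 \<noteq> 0" by presburger+
  hence nz: "c \<noteq> 0" "d \<noteq> 0" "e \<noteq> 0"
    unfolding d_def e_def c_def of_int_eq_0_iff using hyp_coeff_nonzero[of n] by simp_all
  have q: "has_qexp (G1 (6 * n + 2)) (fps_const (1 / (e * c)) * L_fps n)"
    using False extremal_2 unfolding e' [symmetric] c_def by (intro has_qexp_G1) auto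
  obtain K where K: "integral_fps K" "L_fps n = of_int (6 * int n - 1) * K"
    using L_fps_divisible[of n] False by auto
  have "fps_const (e / d * c) * (fps_const (1 / (e * c)) * L_fps n) = fps_const (e / d * c * (1 / (e * c)) * d) * K"
    unfolding K(2) fps_of_int [symmetric] d_def by (simp add: mult.assoc [symmetric] del: of_int_diff)
  also have "e / d * c * (1 / (e * c)) * d = 1" using nz by simp
  finally have eq: "fps_const (e / d * c) * (fps_const (1 / (e * c)) * L_fps n) = fps_const 1 * K" .
  have "integral_fps (fps_const (e / d * c) * (fps_const (1 / (e * c)) * L_fps n))"
    unfolding eq using K(1) by simp
  from integral_coeffsI[OF q this] show ?thesis unfolding c_def d_def e_def .
qed

text \<open>For n = 0 the product H Q is Q itself, which has no \<open>E2\<close> part; this is the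
  exception of weight 4 and the reason for m \<ge> 1 in the theorem.\<close>

lemma integral_G1_4:
  assumes "n > 0"
  shows "integral_coeffs (\<lambda>z. of_nat (hyp_coeff n) * G1 (6 * n + 4) z)"
proof -
  have q: "has_qexp (G1 (6 * n + 4)) (fps_const (1 / of_nat (hyp_coeff n)) * (H_fps n * Q_fps))"
    using assms extremal_4 by (intro has_qexp_G1) auto
  have "integral_fps (H_fps n * Q_fps)" by (intro integral_fps_mult H_fps_integral Q_fps_integral)
  thus ?thesis using hyp_coeff_nonzero[of n] by (intro integral_coeffsI[OF q]) (simp add: mult.assoc [symmetric])
qed

theorem theorem5p1:
  fixes m :: nat
  defines "A \<equiv> of_nat ((6*m) choose (2*m)) * of_nat ((12*m) choose (6*m)) :: complex"
      and "B \<equiv> of_nat ((6*m+3) choose (2*m+1)) * of_nat ((12*m+6) choose (6*m+3)) :: complex"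
  shows "integral_coeffs (\<lambda>z. A * G1 (12*m) z) \<and>
         integral_coeffs (\<lambda>z. of_int (12 * int m + 1) / of_int (12 * int m - 1) * A * G1 (12*m+2) z) \<and>
         integral_coeffs (\<lambda>z. B * G1 (12*m+6) z) \<and>
         integral_coeffs (\<lambda>z. of_int (12 * int m + 7) / of_int (12 * int m + 5) * B * G1 (12*m+8) z) \<and>
         integral_coeffs (\<lambda>z. B * G1 (12*m+10) z) \<and>
         (m \<ge> 1 \<longrightarrow> integral_coeffs (\<lambda>z. A * G1 (12*m+4) z))"
proof -
  have A: "A = of_nat (hyp_coeff (2 * m))"
    by (simp add: A_def hyp_coeff_def)
  have "3 * (2 * m + 1) = 6 * m + 3" "6 * (2 * m + 1) = 12 * m + 6" by simp_all
  hence B: "B = of_nat (hyp_coeff (2 * m + 1))"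
    by (simp only: B_def hyp_coeff_def of_nat_mult)
  have w: "6 * (2 * m) = 12 * m" "6 * (2 * m + 1) = 12 * m + 6" "12 * m + 6 + 2 = 12 * m + 8"
    "12 * m + 6 + 4 = 12 * m + 10"
    "6 * int (2 * m) + 1 = 12 * int m + 1" "6 * int (2 * m) - 1 = 12 * int m - 1"
    "6 * int (2 * m + 1) + 1 = 12 * int m + 7" "6 * int (2 * m + 1) - 1 = 12 * int m + 5" by simp_all
  have m: "m \<ge> 1 \<Longrightarrow> 2 * m > 0" "2 * m + 1 > 0" by simp_all
  show ?thesis unfolding A B
    using integral_G1_0[of "2 * m"] integral_G1_0[of "2 * m + 1"] integral_G1_2[of "2 * m"]
      integral_G1_2[of "2 * m + 1"] integral_G1_4[OF m(1)] integral_G1_4[OF m(2)]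
    unfolding w by blast
qed

end
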